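(* Let $G$ be a graph with degree sequence $d=(d_1,\dots,d_n)$. Then $G$ is a hereditary unigraph if and only if the following conditions hold: (a) For every pair $k,k'$ of consecutive terms in $EG(d)$ such that $k' \geq k+2$, either (i) the terms $d_i$ with $k <i \leq k'$ are all equal and belong to $\{d^*_{k'},\ d^*_{k}-\delta_{k}-2\}$, or (ii) the terms $d_i$ such that $k<d_i<k'$ are all equal and belong to $\{k+1,k'-1\}$. (b) If $t$ denotes the last term of $EG(d)$, then if any terms $d_i$ satisfy both $i>t$ and $d_i>t$, these terms collectively form one of the sequences \[((t+2)^5), \quad ((t+1)^{2r}), \quad (t+r, (t+1)^{2s+r}),\quad ((t+2r-2)^{2r}),\quad ((t+2s+r-1)^{2s+r}, t+2s)\] for some $r \geq 2$ and $s \geq 1$.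
   Context: All graphs are finite, with no loops or multiple edges. Degree sequences are listed in descending order, and $k^{\alpha}$ in a sequence denotes $\alpha$ copies of the term $k$. A unigraph is a graph that is, up to isomorphism, the unique graph having its degree sequence. A hereditary unigraph is a graph all of whose induced subgraphs (including itself) are unigraphs. For a degree sequence $d=(d_1,\dots,d_n)$ in descending order and an integer $0\le k\le n$, the $k$th Erdős–Gallai inequality is $\sum_{i=1}^k d_i \leq k(k-1) + \sum_{i=k+1}^n \min\{k,d_i\}$ (empty sums are $0$). $EG(d)$ denotes the list, in increasing order, of those $k$ for which the $k$th Erdős–Gallai inequality holds with equality; it always begins with $0$. For $j\ge 0$, $d^*_j=\max\{i: d_i\ge j\}$ (taken to be $0$ if there is no such $i$), i.e. the number of terms of $d$ that are at least $j$, and $\delta_j=|\{i: i>j \text{ and } d_i=j\}|$. *)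

theory Defs
  imports
    "Graph_Theory.Digraph_Isomorphism"
    "HOL-Library.Multiset"
begin

text \<open>
  Finite simple graphs are the locale predicate \<^const>\<open>pair_graph\<close>: an undirected edge
  \<open>uv\<close> is the pair of opposite arcs \<open>(u, v)\<close> and \<open>(v, u)\<close>,
  so the degree of a vertex is its out-degree.
  The graph without vertices is admitted; its degree sequence is \<open>[]\<close>.
\<close>

definition degree_sequence :: "'a pair_pre_digraph \<Rightarrow> nat list" where
  "degree_sequence G =
     rev (sorted_list_of_multiset
       (image_mset (out_degree (with_proj G)) (mset_set (pverts G))))"

text \<open>
  Quantifying over graphs on the same vertex type loses nothing: a graph with the degree sequence
  of \<open>G\<close> has as many vertices as \<open>G\<close>, so it has an isomorphic copy on the vertex set of \<open>G\<close>.
\<close>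

definition unigraph :: "'a pair_pre_digraph \<Rightarrow> bool" where
  "unigraph G \<longleftrightarrow> pair_graph G \<and>
     (\<forall>H :: 'a pair_pre_digraph. pair_graph H \<and> degree_sequence H = degree_sequence G \<longrightarrow>
        digraph_iso (with_proj H) (with_proj G))"

definition hereditary_unigraph :: "'a pair_pre_digraph \<Rightarrow> bool" where
  "hereditary_unigraph G \<longleftrightarrow> pair_graph G \<and>
     (\<forall>H :: 'a pair_pre_digraph.
        induced_subgraph (with_proj H) (with_proj G) \<longrightarrow> unigraph H)"

text \<open>The indices of a sequence \<open>d\<^sub>1, \<dots>, d\<^sub>n\<close> start at 1, those of lists at 0.\<close>

abbreviation seq_term :: "nat list \<Rightarrow> nat \<Rightarrow> nat" where
  "seq_term d i \<equiv> d ! (i - 1)"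

definition EG_equality :: "nat list \<Rightarrow> nat \<Rightarrow> bool" where
  "EG_equality d k \<longleftrightarrow>
     (\<Sum>i = 1..k. seq_term d i) = k * (k - 1) + (\<Sum>i = k + 1..length d. min k (seq_term d i))"

definition EG :: "nat list \<Rightarrow> nat list" where
  "EG d = filter (EG_equality d) [0..<length d + 1]"

text \<open>The element 0 only serves the case that no term is at least \<open>j\<close>.\<close>

definition dstar :: "nat list \<Rightarrow> nat \<Rightarrow> nat" where
  "dstar d j = Max (insert 0 {i \<in> {1..length d}. j \<le> seq_term d i})"

definition delta :: "nat list \<Rightarrow> nat \<Rightarrow> nat" where
  "delta d j = card {i \<in> {1..length d}. j < i \<and> seq_term d i = j}"

definition consecutive_in :: "'b list \<Rightarrow> 'b \<Rightarrow> 'b \<Rightarrow> bool" where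
  "consecutive_in xs x y \<longleftrightarrow> (\<exists>j. Suc j < length xs \<and> xs ! j = x \<and> xs ! Suc j = y)"

text \<open>
  The difference in the first condition is taken in the integers, since it may be negative.
  The second condition holds vacuously if no term lies strictly between \<open>k\<close> and \<open>k'\<close>.
\<close>

definition cond_a_i :: "nat list \<Rightarrow> nat \<Rightarrow> nat \<Rightarrow> bool" where
  "cond_a_i d k k' \<longleftrightarrow>
     (\<exists>c. (\<forall>i \<in> {k<..k'}. seq_term d i = c) \<and>
          int c \<in> {int (dstar d k'), int (dstar d k) - int (delta d k) - 2})"

definition cond_a_ii :: "nat list \<Rightarrow> nat \<Rightarrow> nat \<Rightarrow> bool" where
  "cond_a_ii d k k' \<longleftrightarrow>
     (\<exists>c \<in> {k + 1, k' - 1}. \<forall>i \<in> {1..length d}.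
        k < seq_term d i \<and> seq_term d i < k' \<longrightarrow> seq_term d i = c)"

definition tail_terms :: "nat list \<Rightarrow> nat \<Rightarrow> nat list" where
  "tail_terms d t = [seq_term d i. i \<leftarrow> [1..<length d + 1], t < i \<and> t < seq_term d i]"

end

theory Submission
  imports Defs
begin

text \<open>
  A graph is treated as a symmetric irreflexive relation together with a vertex set.  Write
  \<open>(A, B) \<circ> C\<close> for a graph on \<open>A \<union> B \<union> C\<close> in which \<open>A\<close> is a clique, \<open>B\<close> is independent, every
  vertex of \<open>A\<close> is adjacent to all of \<open>C\<close> and no vertex of \<open>B\<close> is adjacent to any of \<open>C\<close>.  The
  proof rests on two observations.

  The first is that degrees see such decompositions.  Counting the edges between \<open>A\<close> and \<open>B\<close> from
  both sides shows that whether a graph has the form \<open>(A, B) \<circ> C\<close> depends only on the degree sums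
  over \<open>A\<close> and \<open>B\<close> (\<open>decomp_iff_degree_sum\<close>).  With \<open>A\<close> the set of the \<open>k\<close> vertices of largest
  degree, the condition is exactly equality in the \<open>k\<close>th Erdos-Gallai inequality
  (\<open>EG_equality_iff_decomp\<close>).  So two consecutive equalities \<open>k < k'\<close> enclose a split graph that
  cannot be decomposed any further, except for vertices of degree \<open>k'\<close>, which are isolated once
  the first \<open>k'\<close> vertices are removed; and the terms in (b) are the degrees in the part that
  remains after the last equality.

  The second is a list of the indecomposable pieces.  In a split piece, the edges between the
  clique and the independent set form a disjoint union of stars whose centres all lie on one side,
  or the bipartite complement of such a graph (\<open>bip_indecomposable\<close>).  The last piece is a
  five-cycle, or a disjoint union of a star and at least one further edge, or the complement of
  such a union (\<open>hereditarily_unique_structure\<close>).  Condition (a)(i) says that every clique vertex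
  has exactly one neighbour, or exactly one non-neighbour, on the other side; (a)(ii) says the same
  of the vertices in the independent set; and (b) lists the degree sequences of the possible last
  pieces.

  Sufficiency: the graphs assembled from such pieces are closed under taking induced subgraphs
  (\<open>constructible_subset\<close>), and each is determined by its degrees
  (\<open>constructible_unique_realization\<close>), because a degree-preserving bijection carries decompositions
  to decompositions and the pieces can be matched one after the other.

  Necessity: exchanging two edges \<open>xy\<close>, \<open>zw\<close> for \<open>xz\<close>, \<open>yw\<close> preserves all degrees, so an
  induced subgraph that changes its isomorphism type under such an exchange cannot occur in a
  hereditary unigraph.  This rules out a short list of graphs on five or six vertices
  (\<open>no_P5\<close> to \<open>no_split_2P3\<close>).  Extremality does the rest: for a largest induced star with
  additional disjoint edges (\<open>two_K2_decomp\<close>), or a largest star forest between the two sides of a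
  split graph (\<open>maximal_stars_homogeneous\<close>), the excluded graphs force every other vertex to see
  all or nothing of it, so that it is itself a piece of a decomposition.
\<close>

section \<open>Graphs as relations, and degrees\<close>

definition sgraph :: "('a \<Rightarrow> 'a \<Rightarrow> bool) \<Rightarrow> bool" where
  "sgraph E \<longleftrightarrow> symp E \<and> irreflp E"

definition co :: "('a \<Rightarrow> 'a \<Rightarrow> bool) \<Rightarrow> 'a \<Rightarrow> 'a \<Rightarrow> bool" where
  "co E u v \<longleftrightarrow> u \<noteq> v \<and> \<not> E u v"

text \<open>
  For \<open>v \<in> X\<close> this is the degree of \<open>v\<close> in the subgraph induced on \<open>X\<close>; for \<open>v \<notin> X\<close> it counts
  the edges from \<open>v\<close> to \<open>X\<close>.
\<close>

definition deg :: "('a \<Rightarrow> 'a \<Rightarrow> bool) \<Rightarrow> 'a set \<Rightarrow> 'a \<Rightarrow> nat" where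
  "deg E X v = card {u \<in> X. E v u}"

lemma sgraph_sym: "sgraph E \<Longrightarrow> E u v \<longleftrightarrow> E v u"
  unfolding sgraph_def by (meson sympD)

lemma sgraph_irrefl: "sgraph E \<Longrightarrow> \<not> E u u"
  unfolding sgraph_def by (meson irreflpD)

lemma sgraphI: "(\<And>u v. E u v \<Longrightarrow> E v u) \<Longrightarrow> (\<And>u. \<not> E u u) \<Longrightarrow> sgraph E"
  unfolding sgraph_def by (meson sympI irreflpI)

lemma sgraph_co [simp]: "sgraph E \<Longrightarrow> sgraph (co E)"
  by (rule sgraphI) (simp_all add: co_def, metis sgraph_sym)

lemma co_co [simp]: "sgraph E \<Longrightarrow> co (co E) = E"
  unfolding fun_eq_iff co_def by (metis sgraph_irrefl)

lemma deg_le_card: "finite X \<Longrightarrow> deg E X v \<le> card X"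
  unfolding deg_def by (rule card_mono) auto

lemma deg_empty [simp]: "deg E {} v = 0"
  by (simp add: deg_def)

lemma deg_cong: "(\<And>u. u \<in> X \<Longrightarrow> E v u = E' v u) \<Longrightarrow> deg E X v = deg E' X v"
  unfolding deg_def by (rule arg_cong[where f = card]) auto

lemma deg_mono: "finite Y \<Longrightarrow> X \<subseteq> Y \<Longrightarrow> deg E X v \<le> deg E Y v"
  unfolding deg_def by (rule card_mono) auto

lemma deg_Un:
  assumes "finite X" "finite Y" "X \<inter> Y = {}"
  shows "deg E (X \<union> Y) v = deg E X v + deg E Y v"
proof -
  have "{u \<in> X \<union> Y. E v u} = {u \<in> X. E v u} \<union> {u \<in> Y. E v u}" by auto
  then show ?thesis
    unfolding deg_def using assms by (simp only:) (rule card_Un_disjoint, auto)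
qed

lemma deg_insert:
  assumes "finite X" "x \<notin> X"
  shows "deg E (insert x X) v = deg E X v + (if E v x then 1 else 0)"
proof -
  have "{u \<in> {x}. E v u} = (if E v x then {x} else {})" by auto
  then have "deg E {x} v = (if E v x then 1 else 0)" by (simp add: deg_def)
  then show ?thesis using deg_Un[of X "{x}" E v] assms by simp
qed

lemma deg_remove:
  assumes "finite X" "x \<in> X"
  shows "deg E X v = deg E (X - {x}) v + (if E v x then 1 else 0)"
  using deg_insert[of "X - {x}" x E v] assms by (auto simp: insert_absorb)

lemma deg_eq_0_iff: "finite X \<Longrightarrow> deg E X v = 0 \<longleftrightarrow> (\<forall>u\<in>X. \<not> E v u)"
  unfolding deg_def by auto

lemma deg_eq_1_iff: "deg E X v = 1 \<longleftrightarrow> (\<exists>!u. u \<in> X \<and> E v u)"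
  proof -
  have "(\<exists>x. {u \<in> X. E v u} = {x}) \<longleftrightarrow> (\<exists>!u. u \<in> X \<and> E v u)"
    by (auto simp: set_eq_iff) metis+
  then show ?thesis unfolding deg_def by (simp add: card_1_singleton_iff)
qed

lemma deg_ge_1_iff: "finite X \<Longrightarrow> 1 \<le> deg E X v \<longleftrightarrow> (\<exists>u\<in>X. E v u)"
  using deg_eq_0_iff[of X E v] by auto

lemma deg_eq_card_iff: "finite X \<Longrightarrow> deg E X v = card X \<longleftrightarrow> (\<forall>u\<in>X. E v u)"
  unfolding deg_def using card_subset_eq[of X "{u \<in> X. E v u}"] by (auto intro: arg_cong[where f = card])

lemma deg_co_outside:
  assumes "finite X" "v \<notin> X"
  shows "deg (co E) X v + deg E X v = card X"
proof -
  have "{u \<in> X. co E v u} = X - {u \<in> X. E v u}" using assms(2) by (auto simp: co_def)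
  moreover have "card {u \<in> X. E v u} \<le> card X" using assms by (intro card_mono) auto
  ultimately show ?thesis unfolding deg_def using assms(1) by (simp add: card_Diff_subset)
qed

lemma deg_self: "sgraph E \<Longrightarrow> finite X \<Longrightarrow> deg E (X - {v}) v = deg E X v"
  unfolding deg_def by (rule arg_cong[where f = card]) (auto dest: sgraph_irrefl)

lemma deg_co_inside:
  assumes "sgraph E" "finite X" "v \<in> X"
  shows "deg (co E) X v + deg E X v = card X - 1"
  using deg_co_outside[of "X - {v}" v E] assms by (simp add: deg_self)

lemma deg_le_inside: "sgraph E \<Longrightarrow> finite X \<Longrightarrow> v \<in> X \<Longrightarrow> deg E X v \<le> card X - 1"
  using deg_co_inside[of E X v] by linarith

lemma deg_eq_inside_iff:
  assumes "sgraph E" "finite X" "v \<in> X"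
  shows "deg E X v = card X - 1 \<longleftrightarrow> (\<forall>u\<in>X. u \<noteq> v \<longrightarrow> E v u)"
  using deg_eq_card_iff[of "X - {v}" E v] assms by (auto simp: deg_self)

lemma sum_deg_swap:
  assumes "sgraph E" "finite A" "finite B"
  shows "(\<Sum>a\<in>A. deg E B a) = (\<Sum>b\<in>B. deg E A b)"
proof -
  have *: "deg E X v = (\<Sum>u\<in>X. if E v u then 1 else 0)" if "finite X" for X v
    unfolding deg_def using that by (simp add: sum.If_cases Int_def)
  have "(\<Sum>a\<in>A. deg E B a) = (\<Sum>a\<in>A. \<Sum>b\<in>B. if E a b then 1 else 0)"
    using assms by (simp add: *)
  also have "\<dots> = (\<Sum>b\<in>B. \<Sum>a\<in>A. if E b a then 1 else 0)"
    by (subst sum.swap) (simp add: sgraph_sym[OF assms(1)])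
  finally show ?thesis using assms by (simp add: *)
qed

lemma sum_deg_insert:
  assumes E: "sgraph E" and X: "finite X" "x \<notin> X"
  shows "(\<Sum>v\<in>insert x X. deg E (insert x X) v) = (\<Sum>v\<in>X. deg E X v) + 2 * deg E X x"
proof -
  have "(\<Sum>v\<in>X. deg E (insert x X) v) = (\<Sum>v\<in>X. deg E X v) + (\<Sum>v\<in>X. deg E {x} v)"
    using X deg_Un[of X "{x}" E] by (simp add: sum.distrib)
  moreover have "(\<Sum>v\<in>X. deg E {x} v) = deg E X x" using sum_deg_swap[of E X "{x}"] E X by simp
  ultimately show ?thesis using X deg_insert[of X x E x] sgraph_irrefl[OF E] by simp
qed

lemma even_sum_deg:
  assumes "sgraph E" "finite X"
  shows "even (\<Sum>v\<in>X. deg E X v)"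
  using assms(2)
proof induction
  case (insert x X)
  then show ?case using sum_deg_insert[OF assms(1) insert.hyps] by presburger
qed simp

section \<open>Decompositions and degree sums\<close>

text \<open>
  This is the composition \<open>(A, B) \<circ> C\<close> of Tyshkevich, of the split graph with parts \<open>A\<close>, \<open>B\<close> and an
  arbitrary graph on \<open>C\<close>.  Each of the three sets may be empty.
\<close>

definition decomp :: "('a \<Rightarrow> 'a \<Rightarrow> bool) \<Rightarrow> 'a set \<Rightarrow> 'a set \<Rightarrow> 'a set \<Rightarrow> bool" where
  "decomp E A B C \<longleftrightarrow> A \<inter> B = {} \<and> A \<inter> C = {} \<and> B \<inter> C = {} \<and>
     (\<forall>a\<in>A. \<forall>a'\<in>A. a \<noteq> a' \<longrightarrow> E a a') \<and> (\<forall>b\<in>B. \<forall>b'\<in>B. \<not> E b b') \<and>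
     (\<forall>a\<in>A. \<forall>c\<in>C. E a c) \<and> (\<forall>b\<in>B. \<forall>c\<in>C. \<not> E b c)"

lemma decompD:
  assumes "decomp E A B C"
  shows "A \<inter> B = {}" "A \<inter> C = {}" "B \<inter> C = {}"
    and "\<And>a b. a \<in> A \<Longrightarrow> b \<in> B \<Longrightarrow> a \<noteq> b"
    and "\<And>a c. a \<in> A \<Longrightarrow> c \<in> C \<Longrightarrow> a \<noteq> c"
    and "\<And>b c. b \<in> B \<Longrightarrow> c \<in> C \<Longrightarrow> b \<noteq> c"
    and "\<And>a a'. a \<in> A \<Longrightarrow> a' \<in> A \<Longrightarrow> a \<noteq> a' \<Longrightarrow> E a a'"
    and "\<And>b b'. b \<in> B \<Longrightarrow> b' \<in> B \<Longrightarrow> \<not> E b b'"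
    and "\<And>a c. a \<in> A \<Longrightarrow> c \<in> C \<Longrightarrow> E a c"
    and "\<And>b c. b \<in> B \<Longrightarrow> c \<in> C \<Longrightarrow> \<not> E b c"
  using assms by (simp_all add: decomp_def disjoint_iff) blast+

lemma decompI:
  assumes "\<And>a b. a \<in> A \<Longrightarrow> b \<in> B \<Longrightarrow> a \<noteq> b"
    and "\<And>a c. a \<in> A \<Longrightarrow> c \<in> C \<Longrightarrow> a \<noteq> c"
    and "\<And>b c. b \<in> B \<Longrightarrow> c \<in> C \<Longrightarrow> b \<noteq> c"
    and "\<And>a a'. a \<in> A \<Longrightarrow> a' \<in> A \<Longrightarrow> a \<noteq> a' \<Longrightarrow> E a a'"
    and "\<And>b b'. b \<in> B \<Longrightarrow> b' \<in> B \<Longrightarrow> \<not> E b b'"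
    and "\<And>a c. a \<in> A \<Longrightarrow> c \<in> C \<Longrightarrow> E a c"
    and "\<And>b c. b \<in> B \<Longrightarrow> c \<in> C \<Longrightarrow> \<not> E b c"
  shows "decomp E A B C"
proof -
  have "A \<inter> B = {}" "A \<inter> C = {}" "B \<inter> C = {}" using assms(1-3) by blast+
  then show ?thesis using assms(4-) by (simp add: decomp_def)
qed

lemma decomp_co: "decomp E A B C \<Longrightarrow> sgraph E \<Longrightarrow> decomp (co E) B A C"
  unfolding decomp_def co_def by blast

lemma decomp_subset:
  "decomp E A B C \<Longrightarrow> A' \<subseteq> A \<Longrightarrow> B' \<subseteq> B \<Longrightarrow> C' \<subseteq> C \<Longrightarrow> decomp E A' B' C'"
  unfolding decomp_def disjoint_iff by (meson subsetD)

text \<open>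
  The edges between \<open>A\<close> and \<open>B\<close> contribute equally to the degree sums over \<open>A\<close> and over \<open>B\<close>.  The
  two sums thus differ by what \<open>A\<close> sees in \<open>A \<union> C\<close>, less what \<open>B\<close> sees in \<open>B \<union> C\<close>.  The former is
  at most \<open>card A * (card A - 1 + card C)\<close> and the latter at least 0; both bounds are attained
  exactly when \<open>(A, B, C)\<close> is a decomposition.
\<close>

context
  fixes E :: "'a \<Rightarrow> 'a \<Rightarrow> bool" and A B C :: "'a set"
  assumes E: "sgraph E" and fin: "finite A" "finite B" "finite C"
begin

context
  assumes disj: "A \<inter> B = {}" "A \<inter> C = {}" "B \<inter> C = {}"
begin

private lemma sum_split:
  "(\<Sum>a\<in>A. deg E (A \<union> B \<union> C) a) + (\<Sum>b\<in>B. deg E (B \<union> C) b) =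
   (\<Sum>a\<in>A. deg E (A \<union> C) a) + (\<Sum>b\<in>B. deg E (A \<union> B \<union> C) b)"
proof -
  have "deg E (A \<union> B \<union> C) v = deg E (A \<union> C) v + deg E B v" for v
    using fin disj by (subst deg_Un[symmetric]) (auto intro: arg_cong[where f = "\<lambda>X. deg E X v"])
  moreover have "deg E (A \<union> B \<union> C) v = deg E (B \<union> C) v + deg E A v" for v
    using fin disj by (subst deg_Un[symmetric]) (auto intro: arg_cong[where f = "\<lambda>X. deg E X v"])
  ultimately have "(\<Sum>a\<in>A. deg E (A \<union> B \<union> C) a) = (\<Sum>a\<in>A. deg E (A \<union> C) a) + (\<Sum>a\<in>A. deg E B a)"
    "(\<Sum>b\<in>B. deg E (A \<union> B \<union> C) b) = (\<Sum>b\<in>B. deg E (B \<union> C) b) + (\<Sum>b\<in>B. deg E A b)"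
    by (simp_all add: sum.distrib[symmetric])
  then show ?thesis using sum_deg_swap[OF E fin(1,2)] by simp
qed

private lemma card_AC: "a \<in> A \<Longrightarrow> card (A \<union> C) - 1 = card A - 1 + card C"
  using fin disj card_Un_disjoint[of A C] card_gt_0_iff[of A] by auto

private lemma deg_AC_le: "a \<in> A \<Longrightarrow> deg E (A \<union> C) a \<le> card A - 1 + card C"
  using deg_le_inside[OF E, of "A \<union> C" a] fin card_AC by simp

private lemma sum_AC_le: "(\<Sum>a\<in>A. deg E (A \<union> C) a) \<le> card A * (card A - 1 + card C)"
  using sum_bounded_above[of A "deg E (A \<union> C)" "card A - 1 + card C"] deg_AC_le by simp

lemma degree_sum_le:
  "(\<Sum>a\<in>A. deg E (A \<union> B \<union> C) a) \<le>
     card A * (card A - 1 + card C) + (\<Sum>b\<in>B. deg E (A \<union> B \<union> C) b)"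
  using sum_split sum_AC_le by linarith

lemma decomp_iff_degree_sum:
  "decomp E A B C \<longleftrightarrow> (\<Sum>a\<in>A. deg E (A \<union> B \<union> C) a) =
     card A * (card A - 1 + card C) + (\<Sum>b\<in>B. deg E (A \<union> B \<union> C) b)"
proof -
  have full: "deg E (A \<union> C) a = card A - 1 + card C \<longleftrightarrow> (\<forall>u\<in>A \<union> C. u \<noteq> a \<longrightarrow> E a u)" if "a \<in> A" for a
    using deg_eq_inside_iff[OF E, of "A \<union> C" a] that fin card_AC by simp
  have none: "deg E (B \<union> C) b = 0 \<longleftrightarrow> (\<forall>u\<in>B \<union> C. \<not> E b u)" for b
    using fin by (simp add: deg_eq_0_iff)
  have "?thesis \<longleftrightarrow> (decomp E A B C \<longleftrightarrow>
     (\<Sum>a\<in>A. deg E (A \<union> C) a) = card A * (card A - 1 + card C) \<and> (\<Sum>b\<in>B. deg E (B \<union> C) b) = 0)"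
    using sum_split sum_AC_le by linarith
  moreover have "(\<Sum>b\<in>B. deg E (B \<union> C) b) = 0 \<longleftrightarrow> (\<forall>b\<in>B. deg E (B \<union> C) b = 0)"
    using fin by simp
  moreover have "(\<Sum>a\<in>A. deg E (A \<union> C) a) = card A * (card A - 1 + card C) \<longleftrightarrow>
     (\<forall>a\<in>A. deg E (A \<union> C) a = card A - 1 + card C)"
  proof
    assume eq: "(\<Sum>a\<in>A. deg E (A \<union> C) a) = card A * (card A - 1 + card C)"
    show "\<forall>a\<in>A. deg E (A \<union> C) a = card A - 1 + card C"
    proof (rule ccontr)
      assume "\<not> ?thesis"
      then obtain a where "a \<in> A" "deg E (A \<union> C) a < card A - 1 + card C"
        using deg_AC_le by (metis order_le_less)
      then have "(\<Sum>a\<in>A. deg E (A \<union> C) a) < (\<Sum>a\<in>A. card A - 1 + card C)"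
        using deg_AC_le fin by (intro sum_strict_mono_ex1) auto
      then show False using eq by simp
    qed
  qed simp
  moreover have "decomp E A B C \<longleftrightarrow>
     (\<forall>a\<in>A. \<forall>u\<in>A \<union> C. u \<noteq> a \<longrightarrow> E a u) \<and> (\<forall>b\<in>B. \<forall>u\<in>B \<union> C. \<not> E b u)"
  proof -
    have "c \<noteq> a" if "a \<in> A" "c \<in> C" for a c using disj that by auto
    then have "(\<forall>a\<in>A. \<forall>c\<in>C. c \<noteq> a \<longrightarrow> E a c) \<longleftrightarrow> (\<forall>a\<in>A. \<forall>c\<in>C. E a c)" by simp
    then show ?thesis
      by (simp add: decomp_def disj ball_Un ball_conj_distrib conj_ac eq_commute)
  qed
  ultimately show ?thesis using full none by simp
qed

end

context
  assumes dec: "decomp E A B C"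
begin

private lemma disj: "A \<inter> B = {}" "A \<inter> C = {}" "B \<inter> C = {}"
  using dec by (auto simp: decomp_def)

lemma decomp_deg_clique:
  assumes "a \<in> A"
  shows "deg E (A \<union> B \<union> C) a = card A - 1 + card C + deg E B a"
proof -
  have "deg E A a = card A - 1"
    using dec assms deg_eq_inside_iff[OF E fin(1) assms] by (auto simp: decomp_def)
  moreover have "deg E C a = card C"
    using dec assms fin by (auto simp: decomp_def deg_eq_card_iff)
  ultimately show ?thesis using fin disj by (simp add: deg_Un Int_Un_distrib2)
qed

lemma decomp_deg_indep:
  assumes "b \<in> B"
  shows "deg E (A \<union> B \<union> C) b = deg E A b"
proof -
  have "deg E B b = 0" "deg E C b = 0"
    using dec assms fin by (auto simp: decomp_def deg_eq_0_iff)
  then show ?thesis using fin disj by (simp add: deg_Un Int_Un_distrib2)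
qed

lemma decomp_deg_core:
  assumes "c \<in> C"
  shows "deg E (A \<union> B \<union> C) c = card A + deg E C c"
proof -
  have "\<forall>b\<in>B. \<not> E b c" "\<forall>a\<in>A. E a c" using dec assms by (simp_all add: decomp_def)
  then have "\<forall>b\<in>B. \<not> E c b" "\<forall>a\<in>A. E c a" using sgraph_sym[OF E] by metis+
  then have "deg E B c = 0" "deg E A c = card A"
    using fin by (simp_all add: deg_eq_0_iff deg_eq_card_iff)
  then show ?thesis using fin disj by (simp add: deg_Un Int_Un_distrib2)
qed

end

end

text \<open>
  A decomposition is recognised by degree sums, so it survives any bijection that preserves degrees,
  even if the bijection does not preserve edges.
\<close>

lemma decomp_image:
  assumes E: "sgraph E" "sgraph E'" and fin: "finite A" "finite B" "finite C"
    and dec: "decomp E A B C"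
    and f: "bij_betw f (A \<union> B \<union> C) Y"
    and deg: "\<And>v. v \<in> A \<union> B \<union> C \<Longrightarrow> deg E' Y (f v) = deg E (A \<union> B \<union> C) v"
  shows "decomp E' (f ` A) (f ` B) (f ` C)"
proof -
  let ?X = "A \<union> B \<union> C"
  have inj: "inj_on f ?X" and Y: "Y = f ` A \<union> f ` B \<union> f ` C"
    using f by (auto simp: bij_betw_def)
  have disj: "A \<inter> B = {}" "A \<inter> C = {}"
    "B \<inter> C = {}" using dec by (auto simp: decomp_def)
  have disj': "f ` A \<inter> f ` B = {}" "f ` A \<inter> f ` C = {}" "f ` B \<inter> f ` C = {}"
    using disj inj by (auto dest: inj_onD)
  have injs: "inj_on f A" "inj_on f B" "inj_on f C" using inj by (auto intro: inj_on_subset)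
  have sum: "(\<Sum>y\<in>f ` Z. deg E' Y y) = (\<Sum>v\<in>Z. deg E ?X v)" if "Z \<subseteq> ?X" for Z
    using that deg inj_on_subset[OF inj that] by (subst sum.reindex) (auto intro!: sum.cong)
  have "(\<Sum>v\<in>A. deg E ?X v) = card A * (card A - 1 + card C) + (\<Sum>v\<in>B. deg E ?X v)"
    using decomp_iff_degree_sum[OF E(1) fin disj] dec by blast
  then have "(\<Sum>y\<in>f ` A. deg E' Y y) =
    card (f ` A) * (card (f ` A) - 1 + card (f ` C)) + (\<Sum>y\<in>f ` B. deg E' Y y)"
    using sum[of A] sum[of B] injs by (simp add: card_image le_supI1)
  then show ?thesis
    using decomp_iff_degree_sum[OF E(2) _ _ _ disj'] fin unfolding Y by blast
qed

text \<open>
  Composition is associative: decomposing the third part refines the whole decomposition.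
\<close>

lemma decomp_trans:
  assumes "decomp E A B C" "C = D \<union> N \<union> C'" "decomp E D N C'" "sgraph E"
  shows "decomp E (A \<union> D) (B \<union> N) C'"
proof -
  have "\<forall>a\<in>A. \<forall>d\<in>D. E a d" "\<forall>b\<in>B. \<forall>n\<in>N. \<not> E b n"
    using assms(1,2) unfolding decomp_def by simp_all
  then have 1: "\<forall>d\<in>D. \<forall>a\<in>A. E d a" and 2: "\<forall>n\<in>N. \<forall>b\<in>B. \<not> E n b"
    using sgraph_sym[OF assms(4)] by metis+
  show ?thesis
    using assms(1,3) 1 2 unfolding assms(2) decomp_def
    by (simp add: Int_Un_distrib Int_Un_distrib2 ball_Un Int_commute)
qed

section \<open>Isomorphisms and star forests\<close>

text \<open>
  The fibres of \<open>p\<close> and \<open>q\<close> over the same label are equally large, and bijections between them can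
  be put together.
\<close>

lemma exists_label_preserving_bij:
  assumes "finite X" "finite Y"
    and "\<And>c. card {x \<in> X. p x = c} = card {y \<in> Y. q y = c}"
  obtains f where "bij_betw f X Y" "\<And>x. x \<in> X \<Longrightarrow> q (f x) = p x"
proof -
  have "\<exists>g. bij_betw g {x \<in> X. p x = c} {y \<in> Y. q y = c}" for c
    using assms by (intro finite_same_card_bij) auto
  then obtain g where g: "\<And>c. bij_betw (g c) {x \<in> X. p x = c} {y \<in> Y. q y = c}"
    by metis
  define f where "f x = g (p x) x" for x
  have f: "f x \<in> Y \<and> q (f x) = p x" if "x \<in> X" for x
    using bij_betw_apply[OF g[of "p x"], of x] that by (simp add: f_def)
  have "inj_on f X"
  proof (rule inj_onI)
    fix x x' assume *: "x \<in> X" "x' \<in> X" "f x = f x'"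
    then have "p x = p x'" using f by metis
    then show "x = x'"
      using * inj_onD[OF bij_betw_imp_inj_on[OF g[of "p x"]], of x x'] by (simp add: f_def)
  qed
  moreover have "y \<in> f ` X" if "y \<in> Y" for y
  proof -
    have "y \<in> g (q y) ` {x \<in> X. p x = q y}"
      using bij_betw_imp_surj_on[OF g[of "q y"]] that by auto
    then obtain x where "x \<in> X" "p x = q y" "y = g (q y) x" by auto
    then have "y = f x" by (simp add: f_def)
    then show ?thesis using \<open>x \<in> X\<close> by blast
  qed
  ultimately have "bij_betw f X Y" using f by (auto simp: bij_betw_def)
  then show ?thesis using f that by blast
qed

definition iso_on where
  "iso_on E X E' Y \<longleftrightarrow> (\<exists>f. bij_betw f X Y \<and> (\<forall>u\<in>X. \<forall>v\<in>X. E' (f u) (f v) \<longleftrightarrow> E u v))"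

lemma iso_on_co:
  assumes "iso_on (co E) X (co E') Y" "sgraph E" "sgraph E'"
  shows "iso_on E X E' Y"
proof -
  obtain f where f: "bij_betw f X Y" "\<And>u v. u \<in> X \<Longrightarrow> v \<in> X \<Longrightarrow> co E' (f u) (f v) \<longleftrightarrow> co E u v"
    using assms(1) by (auto simp: iso_on_def)
  have "E' (f u) (f v) \<longleftrightarrow> E u v" if "u \<in> X" "v \<in> X" for u v
  proof (cases "u = v")
    case True
    then show ?thesis using assms(2,3) by (simp add: sgraph_irrefl)
  next
    case False
    then have "f u \<noteq> f v" using f(1) that by (auto simp: bij_betw_def dest: inj_onD)
    then show ?thesis using f(2)[OF that] False by (simp add: co_def)
  qed
  then show ?thesis using f(1) by (auto simp: iso_on_def)
qed

lemma iso_on_union: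
  assumes 1: "iso_on E X1 E' Y1" and 2: "iso_on E X2 E' Y2"
    and disj: "X1 \<inter> X2 = {}" "Y1 \<inter> Y2 = {}"
    and E: "sgraph E" "sgraph E'"
    and X: "\<And>x y. x \<in> X1 \<Longrightarrow> y \<in> X2 \<Longrightarrow> E x y \<longleftrightarrow> joined"
    and Y: "\<And>x y. x \<in> Y1 \<Longrightarrow> y \<in> Y2 \<Longrightarrow> E' x y \<longleftrightarrow> joined"
  shows "iso_on E (X1 \<union> X2) E' (Y1 \<union> Y2)"
proof -
  obtain f g where f: "bij_betw f X1 Y1" "\<And>u v. u \<in> X1 \<Longrightarrow> v \<in> X1 \<Longrightarrow> E' (f u) (f v) \<longleftrightarrow> E u v"
    and g: "bij_betw g X2 Y2" "\<And>u v. u \<in> X2 \<Longrightarrow> v \<in> X2 \<Longrightarrow> E' (g u) (g v) \<longleftrightarrow> E u v"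
    using 1 2 by (auto simp: iso_on_def)
  define h where "h v = (if v \<in> X1 then f v else g v)" for v
  have h1: "h v = f v" if "v \<in> X1" for v using that by (simp add: h_def)
  have h2: "h v = g v" if "v \<in> X2" for v using that disj by (auto simp: h_def)
  have b1: "bij_betw h X1 Y1" using f(1) h1 by (simp cong: bij_betw_cong)
  have b2: "bij_betw h X2 Y2" using g(1) h2 by (simp cong: bij_betw_cong)
  have "bij_betw h (X1 \<union> X2) (Y1 \<union> Y2)"
    using bij_betw_combine[OF b1 b2 disj(2)] .
  moreover have "E' (h u) (h v) \<longleftrightarrow> E u v" if uv: "u \<in> X1 \<union> X2" "v \<in> X1 \<union> X2" for u v
  proof -
    have 12: "E' (h x) (h y) \<longleftrightarrow> E x y" if "x \<in> X1" "y \<in> X2" for x y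
      using X[OF that] Y bij_betw_apply[OF b1 that(1)] bij_betw_apply[OF b2 that(2)] by simp
    have 21: "E' (h y) (h x) \<longleftrightarrow> E y x" if "x \<in> X1" "y \<in> X2" for x y
      using 12[OF that] sgraph_sym[OF E(1), of x y] sgraph_sym[OF E(2), of "h x" "h y"] by simp
    show ?thesis using uv f(2) g(2) h1 h2 12 21 by (elim UnE) simp_all
  qed
  ultimately show ?thesis unfolding iso_on_def by blast
qed

text \<open>
  The edges between \<open>A\<close> and \<open>B\<close> form a disjoint union of stars with centres in \<open>A\<close> and leaves in \<open>B\<close>.
  A centre without leaves is allowed, so that \<open>stars E A {}\<close> always holds.
\<close>

definition stars :: "('a \<Rightarrow> 'a \<Rightarrow> bool) \<Rightarrow> 'a set \<Rightarrow> 'a set \<Rightarrow> bool" where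
  "stars E A B \<longleftrightarrow> (\<forall>b\<in>B. deg E A b = 1)"

text \<open>
  The four cases arise from one another by exchanging the two sides and by passing to the complement,
  which makes the class symmetric under both.
\<close>

definition star_type :: "('a \<Rightarrow> 'a \<Rightarrow> bool) \<Rightarrow> 'a set \<Rightarrow> 'a set \<Rightarrow> bool" where
  "star_type E A B \<longleftrightarrow> stars E A B \<or> stars (co E) A B \<or> stars E B A \<or> stars (co E) B A"

lemma star_type_co: "star_type E A B \<Longrightarrow> sgraph E \<Longrightarrow> star_type (co E) B A"
  unfolding star_type_def by auto

text \<open>
  A star forest with centres in \<open>A\<close> is determined by the number of leaves at each centre, and this
  number is the degree of the centre.
\<close>

lemma stars_unique_realization:
  assumes E: "sgraph E" "sgraph E'" and fin: "finite A" "finite B" and disj: "A \<inter> B = {}"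
    and disj': "A' \<inter> B' = {}"
    and f: "bij_betw f A A'" "bij_betw f B B'"
    and degA: "\<And>a. a \<in> A \<Longrightarrow> deg E' B' (f a) = deg E B a"
    and degB: "\<And>b. b \<in> B \<Longrightarrow> deg E' A' (f b) = deg E A b"
    and "stars E A B"
  obtains h where "bij_betw h A A'" "bij_betw h B B'"
    "\<And>a b. a \<in> A \<Longrightarrow> b \<in> B \<Longrightarrow> E' (h a) (h b) \<longleftrightarrow> E a b"
proof -
  have fin': "finite A'" "finite B'" using f fin by (auto simp: bij_betw_def)
  have one: "\<exists>!a. a \<in> A \<and> E b a" if "b \<in> B" for b
    using assms(11) that by (simp add: stars_def deg_eq_1_iff[symmetric])
  have one': "\<exists>!a. a \<in> A' \<and> E' b a" if "b \<in> B'" for b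
  proof -
    obtain b0 where "b0 \<in> B" "b = f b0" using \<open>b \<in> B'\<close> f(2) unfolding bij_betw_def by blast
    then show ?thesis using assms(11) degB[of b0] by (simp add: stars_def deg_eq_1_iff[symmetric])
  qed
  define p where "p b = (THE a. a \<in> A \<and> E b a)" for b
  define p' where "p' b = (THE a. a \<in> A' \<and> E' b a)" for b
  have p: "E b a \<longleftrightarrow> p b = a" if "b \<in> B" "a \<in> A" for a b
    using theI'[OF one[OF that(1)]] one[OF that(1)] that unfolding p_def by metis
  have p': "E' b a \<longleftrightarrow> p' b = a" if "b \<in> B'" "a \<in> A'" for a b
    using theI'[OF one'[OF that(1)]] one'[OF that(1)] that unfolding p'_def by metis
  have pA: "p b \<in> A" if "b \<in> B" for b using theI'[OF one[OF that]] unfolding p_def by blast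
  have pA': "p' b \<in> A'" if "b \<in> B'" for b using theI'[OF one'[OF that]] unfolding p'_def by blast
  have fA: "f a \<in> A'" if "a \<in> A" for a using f(1) that by (auto simp: bij_betw_def)
  have finj: "f a = f a' \<longleftrightarrow> a = a'" if "a \<in> A" "a' \<in> A" for a a'
    using f(1) that by (auto simp: bij_betw_def inj_on_eq_iff)
  have cards: "card {b \<in> B. f (p b) = c} = card {b \<in> B'. p' b = c}" for c
  proof (cases "c \<in> A'")
    case True
    then obtain a where a: "a \<in> A" "c = f a" using f(1) by (auto simp: bij_betw_def)
    have "{b \<in> B. f (p b) = c} = {b \<in> B. E a b}"
      using a p pA finj sgraph_sym[OF E(1), of a] by auto
    moreover have "{b \<in> B'. p' b = c} = {b \<in> B'. E' c b}"
      using True p' sgraph_sym[OF E(2), of c] by auto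
    ultimately show ?thesis using degA[OF a(1)] a by (simp add: deg_def)
  next
    case False
    then have "{b \<in> B. f (p b) = c} = {}" "{b \<in> B'. p' b = c} = {}" using pA pA' fA by auto
    then show ?thesis by (simp only: card.empty)
  qed
  obtain q where q: "bij_betw q B B'" "\<And>b. b \<in> B \<Longrightarrow> p' (q b) = f (p b)"
    by (rule exists_label_preserving_bij[OF fin(2) fin'(2) cards]) blast
  define h where "h v = (if v \<in> A then f v else q v)" for v
  have hA: "h a = f a" if "a \<in> A" for a using that by (simp add: h_def)
  have hB: "h b = q b" if "b \<in> B" for b using that disj by (auto simp: h_def)
  show ?thesis
  proof
    show "bij_betw h A A'" using f(1) hA by (simp cong: bij_betw_cong)
    show "bij_betw h B B'" using q(1) hB by (simp cong: bij_betw_cong)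
    fix a b assume ab: "a \<in> A" "b \<in> B"
    have qB: "q b \<in> B'" using q(1) ab(2) by (auto simp: bij_betw_def)
    have "E' (h a) (h b) \<longleftrightarrow> E' (q b) (f a)" using ab hA hB sgraph_sym[OF E(2)] by simp
    also have "\<dots> \<longleftrightarrow> f (p b) = f a" using p'[OF qB fA[OF ab(1)]] q(2)[OF ab(2)] by simp
    also have "\<dots> \<longleftrightarrow> E a b" using finj[OF pA[OF ab(2)] ab(1)] p[OF ab(2,1)] sgraph_sym[OF E(1)] by simp
    finally show "E' (h a) (h b) \<longleftrightarrow> E a b" .
  qed
qed

lemma star_type_unique_realization:
  assumes E: "sgraph E" "sgraph E'" and fin: "finite A" "finite B" and disj: "A \<inter> B = {}"
    and disj': "A' \<inter> B' = {}"
    and f: "bij_betw f A A'" "bij_betw f B B'"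
    and degA: "\<And>a. a \<in> A \<Longrightarrow> deg E' B' (f a) = deg E B a"
    and degB: "\<And>b. b \<in> B \<Longrightarrow> deg E' A' (f b) = deg E A b"
    and "star_type E A B"
  obtains h where "bij_betw h A A'" "bij_betw h B B'"
    "\<And>a b. a \<in> A \<Longrightarrow> b \<in> B \<Longrightarrow> E' (h a) (h b) \<longleftrightarrow> E a b"
proof -
  note result = that
  have fin': "finite A'" "finite B'" and card: "card A' = card A" "card B' = card B"
    using f fin by (auto simp: bij_betw_def card_image)
  have fA: "f a \<in> A'" "f a \<notin> B'" "a \<notin> B" if "a \<in> A" for a
    using f(1) that disj disj' by (auto simp: bij_betw_def)
  have fB: "f b \<in> B'" "f b \<notin> A'" "b \<notin> A" if "b \<in> B" for b
    using f(2) that disj disj' by (auto simp: bij_betw_def)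
  have codegA: "deg (co E') B' (f a) = deg (co E) B a" if "a \<in> A" for a
    using deg_co_outside[OF fin(2) fA(3), OF that, of E] deg_co_outside[OF fin'(2) fA(2), OF that, of E']
      degA[OF that] card by simp
  have codegB: "deg (co E') A' (f b) = deg (co E) A b" if "b \<in> B" for b
    using deg_co_outside[OF fin(1) fB(3), OF that, of E] deg_co_outside[OF fin'(1) fB(2), OF that, of E']
      degB[OF that] card by simp
  have goal: thesis if "bij_betw h A A'" "bij_betw h B B'"
    "\<And>a b. a \<in> A \<Longrightarrow> b \<in> B \<Longrightarrow> co E' (h a) (h b) \<longleftrightarrow> co E a b" for h
  proof (rule result[OF that(1,2)])
    fix a b assume ab: "a \<in> A" "b \<in> B"
    have "h a \<in> A'" "h b \<in> B'" using that(1,2) ab by (auto simp: bij_betw_def)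
    then have "h a \<noteq> h b" "a \<noteq> b" using ab disj disj' by auto
    then show "E' (h a) (h b) \<longleftrightarrow> E a b" using that(3)[OF ab] by (simp add: co_def)
  qed
  have goal_swap: thesis if "bij_betw h B B'" "bij_betw h A A'"
    "\<And>a b. b \<in> B \<Longrightarrow> a \<in> A \<Longrightarrow> E' (h b) (h a) \<longleftrightarrow> E b a" for h
    using result[OF that(2,1)] that(3)
      sgraph_sym[OF E(1)] sgraph_sym[OF E(2)] by metis
  have disjs: "B \<inter> A = {}" "B' \<inter> A' = {}" using disj disj' by auto
  have coE: "sgraph (co E)" "sgraph (co E')" using E by auto
  from assms(11) consider "stars E A B" | "stars (co E) A B" | "stars E B A" | "stars (co E) B A"
    by (auto simp: star_type_def)
  then show ?thesis
  proof cases
    case 1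
    then show ?thesis using stars_unique_realization[OF E fin disj disj' f degA degB 1] result by blast
  next
    case 2
    show ?thesis
      by (rule stars_unique_realization[OF coE fin disj disj' f codegA codegB 2]) (simp_all add: goal)
  next
    case 3
    show ?thesis
      by (rule stars_unique_realization[OF E fin(2,1) disjs f(2,1) degB degA 3]) (simp_all add: goal_swap)
  next
    case 4
    have sw: thesis if "bij_betw h B B'" "bij_betw h A A'"
      "\<And>a b. b \<in> B \<Longrightarrow> a \<in> A \<Longrightarrow> co E' (h b) (h a) \<longleftrightarrow> co E b a" for h
      using goal[OF that(2,1)] that(3) sgraph_sym[OF coE(1)] sgraph_sym[OF coE(2)] by metis
    show ?thesis
      by (rule stars_unique_realization[OF coE fin(2,1) disjs f(2,1) codegB codegA 4]) (simp_all add: sw)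
  qed
qed

section \<open>A class of graphs determined by their degrees\<close>

text \<open>
  In such a graph the component of \<open>c\<close> is a star and every other component has one or two vertices.
\<close>

definition near_matching :: "('a \<Rightarrow> 'a \<Rightarrow> bool) \<Rightarrow> 'a set \<Rightarrow> bool" where
  "near_matching E X \<longleftrightarrow> (\<exists>c. \<forall>v\<in>X. v \<noteq> c \<longrightarrow> deg E X v \<le> 1)"

text \<open>
  A two-regular graph on five vertices is a cycle.  Stated in terms of degrees, the property is
  visibly shared by all graphs with the same degrees.
\<close>

definition five_cycle :: "('a \<Rightarrow> 'a \<Rightarrow> bool) \<Rightarrow> 'a set \<Rightarrow> bool" where
  "five_cycle E X \<longleftrightarrow> card X = 5 \<and> (\<forall>v\<in>X. deg E X v = 2)"

text \<open>
  The graphs assembled from the pieces described in the introduction.  Dominating and isolated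
  vertices need no rule of their own: they are attached with \<open>B = {}\<close> or with \<open>A = {}\<close>.
\<close>

inductive constructible :: "('a \<Rightarrow> 'a \<Rightarrow> bool) \<Rightarrow> 'a set \<Rightarrow> bool" for E where
  near_matching: "near_matching E X \<Longrightarrow> constructible E X"
| co_near_matching: "near_matching (co E) X \<Longrightarrow> constructible E X"
| five_cycle: "five_cycle E X \<Longrightarrow> constructible E X"
| attach: "decomp E A B C \<Longrightarrow> star_type E A B \<Longrightarrow> constructible E C \<Longrightarrow> constructible E (A \<union> B \<union> C)"

lemma constructible_co:
  assumes "constructible E X" "sgraph E"
  shows "constructible (co E) X"
  using assms(1)
proof induction
  case (near_matching X)
  then show ?case using assms(2) by (simp add: constructible.co_near_matching)
next
  case (co_near_matching X)
  then show ?case by (rule constructible.near_matching)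
next
  case (five_cycle X)
  then have "finite X" by (intro card_ge_0_finite) (simp add: five_cycle_def)
  then have "five_cycle (co E) X"
    using five_cycle deg_co_inside[OF assms(2), of X] by (fastforce simp: five_cycle_def)
  then show ?case by (rule constructible.five_cycle)
next
  case (attach A B C)
  have "constructible (co E) (B \<union> A \<union> C)"
    using attach assms(2) by (intro constructible.attach decomp_co star_type_co)
  then show ?case by (simp add: Un_commute)
qed

lemma constructible_empty: "constructible E {}"
  by (rule constructible.near_matching) (simp add: near_matching_def)

lemma constructible_add_isolated:
  assumes "constructible E C" "decomp E {} B C"
  shows "constructible E (B \<union> C)"
  using constructible.attach[OF assms(2) _ assms(1)] by (simp add: star_type_def stars_def)

text \<open>
  Deleting a centre leaves its leaves isolated from \<open>A\<close>, or in the complementary case adjacent to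
  all of \<open>A\<close>.  In the first case they are split off as isolated vertices at the outside, in the
  second they join \<open>C\<close>, where they are isolated; the remaining leaves still form star forests.
\<close>

lemma constructible_stars_subset:
  assumes E: "sgraph E" and dec: "decomp E A B C" and st: "stars E A B \<or> stars (co E) A B"
    and C: "constructible E C" and sub: "A0 \<subseteq> A" "B0 \<subseteq> B"
  shows "constructible E (A0 \<union> B0 \<union> C)"
  using st
proof
  assume st: "stars E A B"
  define B1 where "B1 = {b \<in> B0. \<exists>a\<in>A0. E b a}"
  have "stars E A0 B1"
    unfolding stars_def
  proof
    fix b assume "b \<in> B1"
    then have "b \<in> B" "\<exists>a\<in>A0. E b a" using sub by (auto simp: B1_def)
    moreover then have "\<exists>!a. a \<in> A \<and> E b a" using st by (simp add: stars_def deg_eq_1_iff[symmetric])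
    ultimately have "\<exists>!a. a \<in> A0 \<and> E b a" using sub(1) by blast
    then show "deg E A0 b = 1" by (simp add: deg_eq_1_iff[symmetric])
  qed
  moreover have "decomp E A0 B1 C" using decomp_subset[OF dec sub(1)] sub(2) by (simp add: B1_def subset_iff)
  ultimately have "constructible E (A0 \<union> B1 \<union> C)" using C by (intro constructible.attach) (auto simp: star_type_def)
  moreover have "decomp E {} (B0 - B1) (A0 \<union> B1 \<union> C)"
    using decomp_subset[OF dec sub, of C] by (auto simp: decomp_def B1_def)
  ultimately have "constructible E ((B0 - B1) \<union> (A0 \<union> B1 \<union> C))" by (rule constructible_add_isolated)
  moreover have "(B0 - B1) \<union> (A0 \<union> B1 \<union> C) = A0 \<union> B0 \<union> C" by (auto simp: B1_def)
  ultimately show ?thesis by simp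
next
  assume st: "stars (co E) A B"
  define B1 where "B1 = {b \<in> B0. \<exists>a\<in>A0. co E b a}"
  have "stars (co E) A0 B1"
    unfolding stars_def
  proof
    fix b assume "b \<in> B1"
    then have "b \<in> B" "\<exists>a\<in>A0. co E b a" using sub by (auto simp: B1_def)
    moreover then have "\<exists>!a. a \<in> A \<and> co E b a" using st by (simp add: stars_def deg_eq_1_iff[symmetric])
    ultimately have "\<exists>!a. a \<in> A0 \<and> co E b a" using sub(1) by blast
    then show "deg (co E) A0 b = 1" by (simp add: deg_eq_1_iff[symmetric])
  qed
  note stA = this
  have dec0: "decomp E A0 B0 C" using decomp_subset[OF dec sub] by simp
  have join: "E a b" if "a \<in> A0" "b \<in> B0 - B1" for a b
  proof -
    have "\<not> co E b a" using that by (auto simp: B1_def)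
    moreover have "a \<noteq> b" using that decompD(4)[OF dec0, of a b] by simp
    ultimately show ?thesis using sgraph_sym[OF E, of a b] by (simp add: co_def)
  qed
  have "decomp E {} (B0 - B1) C" using decomp_subset[OF dec0, of "{}" "B0 - B1" C] by simp
  then have "constructible E ((B0 - B1) \<union> C)" using C by (intro constructible_add_isolated)
  moreover have "decomp E A0 B1 ((B0 - B1) \<union> C)"
    using dec0 join by (auto simp: decomp_def B1_def)
  ultimately have "constructible E (A0 \<union> B1 \<union> ((B0 - B1) \<union> C))"
    using stA by (intro constructible.attach) (auto simp: star_type_def)
  moreover have "A0 \<union> B1 \<union> ((B0 - B1) \<union> C) = A0 \<union> B0 \<union> C" by (auto simp: B1_def)
  ultimately show ?thesis by simp
qed

lemma constructible_star_type_subset: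
  assumes E: "sgraph E" and dec: "decomp E A B C" and st: "star_type E A B"
    and C: "constructible E C" and sub: "A0 \<subseteq> A" "B0 \<subseteq> B"
  shows "constructible E (A0 \<union> B0 \<union> C)"
proof (cases "stars E A B \<or> stars (co E) A B")
  case True
  then show ?thesis using constructible_stars_subset[OF E dec _ C sub] by blast
next
  case False
  then have "stars (co E) B A \<or> stars (co (co E)) B A" using st E by (auto simp: star_type_def)
  then have "constructible (co E) (B0 \<union> A0 \<union> C)"
    using constructible_stars_subset[of "co E" B A C B0 A0] E decomp_co[OF dec E] constructible_co[OF C E] sub by simp
  then show ?thesis using constructible_co[of "co E" "B0 \<union> A0 \<union> C"] E by (simp add: Un_commute)
qed

text \<open>
  Let \<open>q\<close>, \<open>t\<close> be the neighbours of \<open>p\<close> and \<open>r\<close>, \<open>s\<close> the other two vertices.  An edge \<open>qt\<close> would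
  leave \<open>r\<close> and \<open>s\<close> with degree at most one, so \<open>q\<close> is adjacent to \<open>r\<close> or to \<open>s\<close>, and the degrees
  determine the remaining edges.
\<close>

lemma five_cycle_labelling:
  assumes E: "sgraph E" and X: "five_cycle E X" and "p \<in> X"
  obtains q r s t where "distinct [p, q, r, s, t]" "X = {p, q, r, s, t}"
    "E p q" "E q r" "E r s" "E s t" "E t p"
    "\<not> E p r" "\<not> E p s" "\<not> E q s" "\<not> E q t" "\<not> E r t"
proof -
  have fin: "finite X" using X by (intro card_ge_0_finite) (simp add: five_cycle_def)
  have "card {u \<in> X. E p u} = 2" using X \<open>p \<in> X\<close> by (simp add: five_cycle_def deg_def)
  then obtain q t where qt: "{u \<in> X. E p u} = {q, t}" "q \<noteq> t" by (auto simp: card_2_iff)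
  have qtX: "q \<in> X" "t \<in> X" "E p q" "E p t" using qt(1) by auto
  have np: "q \<noteq> p" "t \<noteq> p" using qtX sgraph_irrefl[OF E] by auto
  have "card (X - {p, q, t}) = 2"
    using X fin \<open>p \<in> X\<close> qtX np qt(2) by (simp add: five_cycle_def card_Diff_subset)
  then obtain r s where rs: "X - {p, q, t} = {r, s}" "r \<noteq> s" by (auto simp: card_2_iff)
  have dist: "distinct [p, q, r, s, t]" using rs np qt(2) by auto
  have X_eq: "X = {p, q, r, s, t}" using rs(1) qtX \<open>p \<in> X\<close> by blast
  have "r \<notin> {u \<in> X. E p u}" "s \<notin> {u \<in> X. E p u}" unfolding qt(1) using dist by auto
  then have nrs: "\<not> E p r" "\<not> E p s" using rs(1) by blast+
  have sym: "E r q = E q r" "E s q = E q s" "E t q = E q t" "E s r = E r s" "E t r = E r t"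
    "E t s = E s t"
    "E q p" "E t p" "\<not> E r p" "\<not> E s p"
    using sgraph_sym[OF E] qtX nrs by metis+
  have irr: "\<not> E v v" for v using sgraph_irrefl[OF E] .
  have deg: "deg E X q = 2" "deg E X r = 2" "deg E X s = 2" "deg E X t = 2"
    using X X_eq by (auto simp: five_cycle_def)
  have eqs: "of_bool (E q r) + of_bool (E q s) + of_bool (E q t) = (1::nat)"
    "of_bool (E q r) + of_bool (E r s) + of_bool (E r t) = (2::nat)"
    "of_bool (E q s) + of_bool (E r s) + of_bool (E s t) = (2::nat)"
    "of_bool (E q t) + of_bool (E r t) + of_bool (E s t) = (1::nat)"
    using deg dist unfolding X_eq by (simp_all add: deg_insert sym irr of_bool_def)
  show ?thesis
  proof (cases "E q r")
    case True
    then have "E r s" "E s t" "\<not> E q s" "\<not> E q t" "\<not> E r t"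
      using eqs by (cases "E r s"; cases "E s t"; cases "E q s"; cases "E q t"; cases "E r t"; simp)+
    then show ?thesis using that[of q r s t] True dist X_eq qtX sym nrs by blast
  next
    case False
    then have "E q s" "E r s" "E r t" "\<not> E s t" "\<not> E q t"
      using eqs by (cases "E r s"; cases "E s t"; cases "E q s"; cases "E q t"; cases "E r t"; simp)+
    then show ?thesis using that[of q s r t] False dist X_eq qtX sym nrs by auto
  qed
qed

text \<open>
  Deleting a vertex from a five-cycle leaves a path with four vertices.  This is a split graph: its
  inner vertices form a clique, and each has one end of the path as its private neighbour.
\<close>

lemma constructible_proper_subset_five_cycle:
  assumes E: "sgraph E" and X: "five_cycle E X" and Y: "Y \<subseteq> X" "Y \<noteq> X"
  shows "constructible E Y"
proof -
  obtain p where p: "p \<in> X" "p \<notin> Y" using Y by blast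
  obtain q r s t where c: "distinct [p, q, r, s, t]" "X = {p, q, r, s, t}"
    "E p q" "E q r" "E r s" "E s t" "E t p"
    "\<not> E p r" "\<not> E p s" "\<not> E q s" "\<not> E q t" "\<not> E r t"
    using five_cycle_labelling[OF E X p(1)] by metis
  have sym: "E s r" "\<not> E t q" "\<not> E t r" "E t s"
    using c sgraph_sym[OF E] by metis+
  have "decomp E {r, s} {q, t} {}"
    using c sym by (auto simp: decomp_def sgraph_irrefl[OF E])
  moreover have "star_type E {r, s} {q, t}"
    using c sym by (simp add: star_type_def stars_def deg_insert)
  ultimately have "constructible E (({r, s} \<inter> Y) \<union> ({q, t} \<inter> Y) \<union> {})"
    using constructible_empty by (intro constructible_star_type_subset[OF E]) auto
  moreover have "({r, s} \<inter> Y) \<union> ({q, t} \<inter> Y) \<union> {} = Y" using Y(1) p c(2) by auto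
  ultimately show ?thesis by simp
qed

lemma near_matching_subset:
  assumes "near_matching E X" "Y \<subseteq> X" "finite X"
  shows "near_matching E Y"
proof -
  obtain c where "\<forall>v\<in>X. v \<noteq> c \<longrightarrow> deg E X v \<le> 1" using assms(1) by (auto simp: near_matching_def)
  then have "\<forall>v\<in>Y. v \<noteq> c \<longrightarrow> deg E Y v \<le> 1"
    using deg_mono[OF assms(3,2), of E] assms(2) by (meson order_trans subsetD)
  then show ?thesis by (auto simp: near_matching_def)
qed

text \<open>
  Deleting vertices from a near-matching leaves a near-matching, from a five-cycle a split piece, and
  from a star forest a smaller star forest after splitting off leaves that have lost their centre.
\<close>

lemma constructible_subset:
  assumes E: "sgraph E" and X: "constructible E X" "finite X" and Y: "Y \<subseteq> X"
  shows "constructible E Y"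
  using X Y
proof (induction arbitrary: Y)
  case (near_matching X)
  then show ?case by (meson constructible.near_matching near_matching_subset)
next
  case (co_near_matching X)
  then show ?case by (meson constructible.co_near_matching near_matching_subset)
next
  case (five_cycle X)
  then show ?case using constructible.five_cycle constructible_proper_subset_five_cycle[OF E] by metis
next
  case (attach A B C)
  have "constructible E (Y \<inter> C)" using attach by simp
  moreover have "decomp E A B (Y \<inter> C)" using decomp_subset[OF attach(1)] by simp
  ultimately have "constructible E ((Y \<inter> A) \<union> (Y \<inter> B) \<union> (Y \<inter> C))"
    using attach(2) by (intro constructible_star_type_subset[OF E]) auto
  moreover have "(Y \<inter> A) \<union> (Y \<inter> B) \<union> (Y \<inter> C) = Y" using attach by blast
  ultimately show ?case by simp
qed

lemma iso_on_empty [simp]: "iso_on E {} E' {}"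
  by (simp add: iso_on_def bij_betw_def)

lemma iso_on_independent:
  assumes "finite X" "finite Y" "card X = card Y"
    "\<And>u v. u \<in> X \<Longrightarrow> v \<in> X \<Longrightarrow> \<not> E u v" "\<And>u v. u \<in> Y \<Longrightarrow> v \<in> Y \<Longrightarrow> \<not> E' u v"
  shows "iso_on E X E' Y"
proof -
  obtain f where "bij_betw f X Y" using finite_same_card_bij[OF assms(1,2,3)] by blast
  then show ?thesis using assms(4,5) unfolding iso_on_def by (metis bij_betw_apply)
qed

lemma perfect_matching_remove_edge:
  assumes E: "sgraph E" and X: "finite X" "\<forall>v\<in>X. deg E X v = 1" "v \<in> X"
  obtains w where "w \<in> X" "E v w" "w \<noteq> v"
    "\<forall>u\<in>X - {v, w}. deg E (X - {v, w}) u = 1"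
    "\<And>x y. x \<in> {v, w} \<Longrightarrow> y \<in> X - {v, w} \<Longrightarrow> \<not> E x y"
proof -
  have one: "\<exists>!u. u \<in> X \<and> E x u" if "x \<in> X" for x
    using X(2) that by (simp add: deg_eq_1_iff[symmetric])
  obtain w where w: "w \<in> X" "E v w" using one[OF X(3)] by blast
  have wv: "w \<noteq> v" "E w v" using w sgraph_irrefl[OF E] sgraph_sym[OF E] by auto
  have cross: "\<not> E x y" if "x \<in> {v, w}" "y \<in> X - {v, w}" for x y
    using that one[OF X(3)] one[OF w(1)] w wv X(3) by blast
  have "deg E (X - {v, w}) u = 1" if u: "u \<in> X - {v, w}" for u
  proof -
    have "\<not> E u v" "\<not> E u w" using cross[of v u] cross[of w u] u sgraph_sym[OF E] by auto
    then have "{y \<in> X - {v, w}. E u y} = {y \<in> X. E u y}" by auto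
    then have "deg E (X - {v, w}) u = deg E X u" by (simp only: deg_def)
    then show ?thesis using X(2) u by simp
  qed
  then show ?thesis using that w wv cross by blast
qed

lemma iso_on_perfect_matching:
  assumes E: "sgraph E" "sgraph E'"
    and "finite X" "finite Y" "card X = card Y" "\<forall>v\<in>X. deg E X v = 1"
      "\<forall>v\<in>Y. deg E' Y v = 1"
  shows "iso_on E X E' Y"
  using assms(3-)
proof (induction "card X" arbitrary: X Y rule: less_induct)
  case less
  show ?case
  proof (cases "X = {}")
    case True
    then show ?thesis using less.prems by simp
  next
    case False
    then obtain v v' where v: "v \<in> X" "v' \<in> Y" using less.prems by fastforce
    obtain w where w: "w \<in> X" "E v w" "w \<noteq> v"
      "\<forall>u\<in>X - {v, w}. deg E (X - {v, w}) u = 1"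
      "\<And>x y. x \<in> {v, w} \<Longrightarrow> y \<in> X - {v, w} \<Longrightarrow> \<not> E x y"
      using perfect_matching_remove_edge[OF E(1) less.prems(1,4) v(1)] by metis
    obtain w' where w': "w' \<in> Y" "E' v' w'" "w' \<noteq> v'"
      "\<forall>u\<in>Y - {v', w'}. deg E' (Y - {v', w'}) u = 1"
      "\<And>x y. x \<in> {v', w'} \<Longrightarrow> y \<in> Y - {v', w'} \<Longrightarrow> \<not> E' x y"
      using perfect_matching_remove_edge[OF E(2) less.prems(2,5) v(2)] by metis
    have c: "card (X - {v, w}) = card X - 2" "card (Y - {v', w'}) = card Y - 2" "card X > 0"
      using less.prems(1,2) v w(1,3) w'(1,3) by (auto simp: card_Diff_subset card_gt_0_iff)
    have "iso_on E (X - {v, w}) E' (Y - {v', w'})"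
      using less.hyps[of "X - {v, w}" "Y - {v', w'}"] less.prems(1,2,3) c w(4) w'(4) by simp
    moreover have "iso_on E {v, w} E' {v', w'}"
    proof -
      have "bij_betw (\<lambda>x. if x = v then v' else w') {v, w} {v', w'}"
        using w(3) w'(3) by (auto simp: bij_betw_def inj_on_def)
      moreover have "\<not> E v v" "\<not> E w w" "E w v" "\<not> E' v' v'" "\<not> E' w' w'" "E' w' v'"
        using w(2) w'(2) sgraph_irrefl E sgraph_sym[OF E(1)] sgraph_sym[OF E(2)] by metis+
      ultimately show ?thesis
        unfolding iso_on_def using w(2,3) w'(2,3) by (intro exI[of _ "\<lambda>x. if x = v then v' else w'"]) auto
    qed
    ultimately have "iso_on E ({v, w} \<union> (X - {v, w})) E' ({v', w'} \<union> (Y - {v', w'}))"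
      using w(5) w'(5) E by (intro iso_on_union[where joined = False]) auto
    moreover have "{v, w} \<union> (X - {v, w}) = X" "{v', w'} \<union> (Y - {v', w'}) = Y"
      using v w(1) w'(1) by auto
    ultimately show ?thesis by simp
  qed
qed

text \<open>
  The graph falls into the star with centre \<open>c\<close> and leaves \<open>P\<close>, the perfectly matched set \<open>M\<close> and
  the isolated vertices \<open>Z\<close>.  The sizes of all parts can be read off from the degrees.
\<close>

lemma near_matching_parts:
  assumes E: "sgraph E" and X: "finite X" "c \<in> X"
    "\<forall>v\<in>X. v \<noteq> c \<longrightarrow> deg E X v \<le> 1"
  defines "P \<equiv> {v \<in> X. E c v}"
  defines "M \<equiv> {v \<in> X - {c}. deg E X v = 1} - P" and "Z \<equiv> {v \<in> X - {c}. deg E X v = 0}"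
  shows "X = ({c} \<union> P) \<union> (M \<union> Z)"
    "({c} \<union> P) \<inter> (M \<union> Z) = {}" "M \<inter> Z = {}" "c \<notin> P"
    "card P = deg E X c" "card {v \<in> X - {c}. deg E X v = 1} = card P + card M"
    "\<forall>v\<in>M. deg E M v = 1"
    "\<And>u v. u \<in> P \<Longrightarrow> v \<in> P \<Longrightarrow> \<not> E u v"
    "\<And>u v. u \<in> {c} \<union> P \<Longrightarrow> v \<in> M \<union> Z \<Longrightarrow> \<not> E u v"
    "\<And>u v. u \<in> M \<union> Z \<Longrightarrow> v \<in> Z \<Longrightarrow> \<not> E u v"
proof -
  have nc: "c \<notin> P" using sgraph_irrefl[OF E] by (simp add: P_def)
  have cv: "E v c" if "v \<in> P" for v using that sgraph_sym[OF E] by (simp add: P_def)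
  have P1: "deg E X v = 1" if "v \<in> P" for v
  proof -
    have "v \<in> X" "v \<noteq> c" using that nc by (auto simp: P_def)
    moreover have "1 \<le> deg E X v" unfolding deg_ge_1_iff[OF X(1)] using cv[OF that] X(2) by blast
    ultimately show ?thesis using X(3) by (metis le_antisym)
  qed
  have only: "u = w" if "v \<in> X" "v \<noteq> c" "u \<in> X" "E v u" "w \<in> X" "E v w" for u v w
  proof -
    have "1 \<le> deg E X v" unfolding deg_ge_1_iff[OF X(1)] using that by blast
    then have "deg E X v = 1" using X(3) that by (metis le_antisym)
    then have "\<exists>!u. u \<in> X \<and> E v u" by (simp only: deg_eq_1_iff)
    then show ?thesis using that by blast
  qed
  have Z: "\<not> E v u" if "v \<in> Z" "u \<in> X" for u v
    using that deg_eq_0_iff[OF X(1), of E v] by (simp add: Z_def)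
  have sub: "P \<subseteq> X" "M \<subseteq> X" "Z \<subseteq> X" by (auto simp: P_def M_def Z_def)
  have le1: "deg E X v = 0 \<or> deg E X v = 1" if "v \<in> X" "v \<noteq> c" for v
    using X(3) that by (metis One_nat_def le_Suc_eq le_zero_eq)
  show "X = ({c} \<union> P) \<union> (M \<union> Z)" using le1 X(2) sub unfolding M_def Z_def by blast
  show "({c} \<union> P) \<inter> (M \<union> Z) = {}" using P1 by (auto simp: M_def Z_def)
  show "M \<inter> Z = {}" by (auto simp: M_def Z_def)
  show "c \<notin> P" by (rule nc)
  show "card P = deg E X c" by (simp add: P_def deg_def)
  have "{v \<in> X - {c}. deg E X v = 1} = P \<union> M" using P1 nc sub(1) by (auto simp: M_def)
  moreover have "P \<inter> M = {}" by (auto simp: M_def)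
  ultimately show "card {v \<in> X - {c}. deg E X v = 1} = card P + card M"
    using X(1) sub by (metis card_Un_disjoint finite_subset)
  show PP: "\<not> E u v" if "u \<in> P" "v \<in> P" for u v
    using only[of u v c] cv[OF that(1)] that nc sub(1) X(2) by blast
  show cross: "\<not> E u v" if "u \<in> {c} \<union> P" "v \<in> M \<union> Z" for u v
  proof
    assume uv: "E u v"
    have v: "v \<in> X" "v \<noteq> c" "v \<notin> P" using that(2) P1 by (auto simp: M_def Z_def)
    show False
    proof (cases "u = c")
      case True
      then show False using uv v by (simp add: P_def)
    next
      case False
      then have "u \<in> P" using that(1) by simp
      then show False using only[of u v c] cv uv v False sub(1) X(2) by blast
    qed
  qed
  show MZ: "\<not> E u v" if "u \<in> M \<union> Z" "v \<in> Z" for u v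
    using Z[of v u] that sub sgraph_sym[OF E, of u v] by blast
  show "\<forall>v\<in>M. deg E M v = 1"
  proof
    fix v assume v: "v \<in> M"
    have "deg E M v = deg E X v"
    proof -
      have "u \<in> M" if "u \<in> X" "E v u" for u
      proof -
        have "E u v" using that(2) sgraph_sym[OF E] by simp
        then have "u \<notin> {c} \<union> P" "u \<notin> Z" using cross v Z sub by blast+
        then show ?thesis using le1[OF that(1)] that(1) by (auto simp: M_def Z_def)
      qed
      then have "{u \<in> M. E v u} = {u \<in> X. E v u}" using sub by auto
      then show ?thesis by (simp only: deg_def)
    qed
    then show "deg E M v = 1" using v by (simp add: M_def)
  qed
qed

lemma near_matching_unique_realization:
  assumes E: "sgraph E" "sgraph E'" and X: "near_matching E X" "finite X"
    and f: "bij_betw f X Y" and deg: "\<And>v. v \<in> X \<Longrightarrow> deg E' Y (f v) = deg E X v"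
  shows "iso_on E X E' Y"
proof (cases "X = {}")
  case True
  then show ?thesis using f by (simp add: bij_betw_def)
next
  case False
  obtain c0 where c0: "\<forall>v\<in>X. v \<noteq> c0 \<longrightarrow> deg E X v \<le> 1" using X(1) by (auto simp: near_matching_def)
  obtain c where c: "c \<in> X" "\<forall>v\<in>X. v \<noteq> c \<longrightarrow> deg E X v \<le> 1"
    using c0 False by (metis all_not_in_conv)
  have Y: "finite Y" "f c \<in> Y"
    "\<forall>v\<in>Y. v \<noteq> f c \<longrightarrow> deg E' Y v \<le> 1"
    using f X(2) c deg by (auto simp: bij_betw_def)
  have cards: "card {v \<in> Y - {f c}. deg E' Y v = k} = card {v \<in> X - {c}. deg E X v = k}" for k
  proof -
    have "{v \<in> Y - {f c}. deg E' Y v = k} = f ` {v \<in> X - {c}. deg E X v = k}"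
      using f c(1) deg by (auto simp: bij_betw_def inj_on_eq_iff)
    moreover have "inj_on f {v \<in> X - {c}. deg E X v = k}"
      using f by (auto simp: bij_betw_def intro: inj_on_subset)
    ultimately show ?thesis by (simp add: card_image)
  qed
  note x = near_matching_parts[OF E(1) X(2) c]
  note y = near_matching_parts[OF E(2) Y]
  define P M Z where "P = {v \<in> X. E c v}" and "M = {v \<in> X - {c}. deg E X v = 1} - P"
    and "Z = {v \<in> X - {c}. deg E X v = 0}"
  define P' M' Z' where "P' = {v \<in> Y. E' (f c) v}" and "M' = {v \<in> Y - {f c}. deg E' Y v = 1} - P'"
    and "Z' = {v \<in> Y - {f c}. deg E' Y v = 0}"
  note x = x[folded P_def, folded M_def Z_def]
  note y = y[folded P'_def, folded M'_def Z'_def]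
  have fin: "finite P" "finite M" "finite Z" "finite P'" "finite M'" "finite Z'"
    using X(2) Y(1) by (auto simp: P_def M_def Z_def P'_def M'_def Z'_def)
  have card: "card P = card P'" "card M = card M'" "card Z = card Z'"
    using x(5,6) y(5,6) cards[of 1] cards[of 0] deg[OF c(1)] by (simp_all add: Z_def Z'_def)
  have "iso_on E {c} E' {f c}"
    using sgraph_irrefl[OF E(1)] sgraph_irrefl[OF E(2)] by (intro iso_on_independent) auto
  moreover have "iso_on E P E' P'" using fin card x(8) y(8) by (intro iso_on_independent) auto
  ultimately have star: "iso_on E ({c} \<union> P) E' ({f c} \<union> P')"
    using E x(4) y(4) by (intro iso_on_union[where joined = True]) (auto simp: P_def P'_def)
  have "iso_on E M E' M'" using fin card x(7) y(7) E by (intro iso_on_perfect_matching) auto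
  moreover have "iso_on E Z E' Z'" using fin card x(10) y(10) by (intro iso_on_independent) auto
  ultimately have rest: "iso_on E (M \<union> Z) E' (M' \<union> Z')"
    using E x(3,10) y(3,10) by (intro iso_on_union[where joined = False]) auto
  have "iso_on E (({c} \<union> P) \<union> (M \<union> Z)) E' (({f c} \<union> P') \<union> (M' \<union> Z'))"
    by (rule iso_on_union[OF star rest x(2) y(2) E, where joined = False]) (use x(9) y(9) in auto)
  then show ?thesis using x(1) y(1) by simp
qed

lemma five_cycle_unique_realization:
  assumes E: "sgraph E" "sgraph E'" and X: "five_cycle E X" and Y: "five_cycle E' Y"
  shows "iso_on E X E' Y"
proof -
  have "X \<noteq> {}" "Y \<noteq> {}" using X Y by (auto simp: five_cycle_def)
  then obtain p p' where p: "p \<in> X" "p' \<in> Y" by blast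
  obtain q r s t where x: "distinct [p, q, r, s, t]" "X = {p, q, r, s, t}"
    "E p q" "E q r" "E r s" "E s t" "E t p"
    "\<not> E p r" "\<not> E p s" "\<not> E q s" "\<not> E q t" "\<not> E r t"
    using five_cycle_labelling[OF E(1) X p(1)] by metis
  obtain q' r' s' t' where y: "distinct [p', q', r', s', t']" "Y = {p', q', r', s', t'}"
    "E' p' q'" "E' q' r'" "E' r' s'" "E' s' t'" "E' t' p'"
    "\<not> E' p' r'" "\<not> E' p' s'" "\<not> E' q' s'" "\<not> E' q' t'" "\<not> E' r' t'"
    using five_cycle_labelling[OF E(2) Y p(2)] by metis
  have xs: "E q p" "E r q" "E s r" "E t s" "E p t"
    "\<not> E r p" "\<not> E s p" "\<not> E s q" "\<not> E t q" "\<not> E t r"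
    using x sgraph_sym[OF E(1)] by metis+
  have ys: "E' q' p'" "E' r' q'" "E' s' r'" "E' t' s'" "E' p' t'"
    "\<not> E' r' p'" "\<not> E' s' p'" "\<not> E' s' q'" "\<not> E' t' q'" "\<not> E' t' r'"
    using y sgraph_sym[OF E(2)] by metis+
  define f where "f v = (if v = p then p' else if v = q then q' else if v = r then r'
    else if v = s then s' else t')" for v
  have fv: "f p = p'" "f q = q'" "f r = r'" "f s = s'" "f t = t'" using x(1) by (auto simp: f_def)
  have "f ` X = Y" using fv x(2) y(2) by simp
  moreover have "inj_on f X" using x(1,2) y(1) fv by (auto simp: inj_on_def)
  ultimately have "bij_betw f X Y" by (simp add: bij_betw_def)
  moreover have "\<forall>u\<in>X. \<forall>v\<in>X. E' (f u) (f v) \<longleftrightarrow> E u v"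
    unfolding x(2) using fv x(3-) y(3-) xs ys sgraph_irrefl[OF E(1)] sgraph_irrefl[OF E(2)] by simp
  ultimately show ?thesis by (auto simp: iso_on_def)
qed

text \<open>
  A bijection \<open>f\<close> that preserves degrees need not be an isomorphism, but it shows that the other graph
  has the same pieces, with the same degrees inside them; on each piece it is replaced by an
  isomorphism.
\<close>

theorem constructible_unique_realization:
  assumes E: "sgraph E" "sgraph E'" and X: "constructible E X" "finite X"
    and f: "bij_betw f X Y" and deg: "\<And>v. v \<in> X \<Longrightarrow> deg E' Y (f v) = deg E X v"
  shows "iso_on E X E' Y"
  using X f deg
proof (induction arbitrary: Y f)
  case (near_matching X)
  then show ?case using near_matching_unique_realization[OF E] by blast
next
  case (co_near_matching X)
  have fin: "finite Y" and cY: "card Y = card X" and fY: "\<And>v. v \<in> X \<Longrightarrow> f v \<in> Y"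
    using co_near_matching(2,3) by (auto simp: bij_betw_def card_image)
  have "deg (co E') Y (f v) = deg (co E) X v" if "v \<in> X" for v
    using deg_co_inside[OF E(1) co_near_matching(2) that] deg_co_inside[OF E(2) fin fY[OF that]]
      co_near_matching(4)[OF that] cY by simp
  then have "iso_on (co E) X (co E') Y"
    using co_near_matching(1-3) E by (intro near_matching_unique_realization) auto
  then show ?case using E by (rule iso_on_co)
next
  case (five_cycle X)
  have "card Y = card X" using five_cycle(3) by (simp add: bij_betw_same_card)
  moreover have "\<forall>v\<in>Y. deg E' Y v = 2" using five_cycle by (auto simp: bij_betw_def five_cycle_def)
  ultimately have "five_cycle E' Y" using five_cycle(1) by (simp add: five_cycle_def)
  then show ?case using five_cycle_unique_realization[OF E five_cycle(1)] by blast
next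
  case (attach A B C)
  have fin: "finite A" "finite B" "finite C" using attach.prems(1) by auto
  note f = attach.prems(2)
  have inj: "inj_on f (A \<union> B \<union> C)" using f by (simp add: bij_betw_def)
  have dec: "decomp E' (f ` A) (f ` B) (f ` C)"
    using decomp_image[OF E fin attach.hyps(1) f attach.prems(3)] .
  have Y: "Y = f ` A \<union> f ` B \<union> f ` C" using f by (auto simp: bij_betw_def)
  have fin': "finite (f ` A)" "finite (f ` B)" "finite (f ` C)" using fin by auto
  have fA: "bij_betw f A (f ` A)" and fB: "bij_betw f B (f ` B)" and fC: "bij_betw f C (f ` C)"
    using inj by (auto simp: bij_betw_def intro: inj_on_subset)
  have card: "card (f ` A) = card A" "card (f ` C) = card C" using fA fC by (auto simp: bij_betw_def card_image)
  have degA: "deg E' (f ` B) (f a) = deg E B a" if "a \<in> A" for a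
    using attach.prems(3)[of a] that decomp_deg_clique[OF E(1) fin attach.hyps(1) that]
      decomp_deg_clique[OF E(2) fin' dec, of "f a"] card unfolding Y by simp
  have degB: "deg E' (f ` A) (f b) = deg E A b" if "b \<in> B" for b
    using attach.prems(3)[of b] that decomp_deg_indep[OF E(1) fin attach.hyps(1) that]
      decomp_deg_indep[OF E(2) fin' dec, of "f b"] unfolding Y by simp
  have degC: "deg E' (f ` C) (f c) = deg E C c" if "c \<in> C" for c
    using attach.prems(3)[of c] that decomp_deg_core[OF E(1) fin attach.hyps(1) that]
      decomp_deg_core[OF E(2) fin' dec, of "f c"] card unfolding Y by simp
  have disj: "A \<inter> B = {}" "f ` A \<inter> f ` B = {}" "(A \<union> B) \<inter> C = {}"
    "(f ` A \<union> f ` B) \<inter> f ` C = {}"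
    using attach.hyps(1) dec by (auto simp: decomp_def)
  obtain h where h: "bij_betw h A (f ` A)" "bij_betw h B (f ` B)"
    "\<And>a b. a \<in> A \<Longrightarrow> b \<in> B \<Longrightarrow> E' (h a) (h b) \<longleftrightarrow> E a b"
    using star_type_unique_realization[OF E fin(1,2) disj(1,2) fA fB degA degB attach.hyps(2)] by blast
  obtain g where g: "bij_betw g C (f ` C)" "\<And>u v. u \<in> C \<Longrightarrow> v \<in> C \<Longrightarrow> E' (g u) (g v) \<longleftrightarrow> E u v"
    using attach.IH[OF fin(3) fC degC] by (auto simp: iso_on_def)
  define F where "F v = (if v \<in> C then g v else h v)" for v
  have FC: "F v = g v" if "v \<in> C" for v using that by (simp add: F_def)
  have FAB: "F v = h v" if "v \<in> A \<union> B" for v using that disj(3) by (auto simp: F_def)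
  have bA: "bij_betw F A (f ` A)" and bB: "bij_betw F B (f ` B)" and bC: "bij_betw F C (f ` C)"
    using h(1,2) g(1) FC FAB by (simp_all cong: bij_betw_cong)
  have bij: "bij_betw F (A \<union> B \<union> C) Y"
    unfolding Y by (intro bij_betw_combine bA bB bC disj)
  have FAA: "F a \<in> f ` A" if "a \<in> A" for a using bij_betw_apply[OF bA that] .
  have FBB: "F b \<in> f ` B" if "b \<in> B" for b using bij_betw_apply[OF bB that] .
  have FCC: "F c \<in> f ` C" if "c \<in> C" for c using bij_betw_apply[OF bC that] .
  have AA: "E' (F a) (F a') \<longleftrightarrow> E a a'" if "a \<in> A" "a' \<in> A" for a a'
  proof (cases "a = a'")
    case True
    then show ?thesis using E by (simp add: sgraph_irrefl)
  next
    case False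
    then have ne: "F a \<noteq> F a'" using bA that by (auto simp: bij_betw_def inj_on_eq_iff)
    show ?thesis
      using decompD(7)[OF attach.hyps(1) that False] decompD(7)[OF dec FAA[OF that(1)] FAA[OF that(2)] ne] by simp
  qed
  have BB: "E' (F b) (F b') \<longleftrightarrow> E b b'" if "b \<in> B" "b' \<in> B" for b b'
    using decompD(8)[OF attach.hyps(1) that] decompD(8)[OF dec FBB[OF that(1)] FBB[OF that(2)]] by simp
  have AB: "E' (F a) (F b) \<longleftrightarrow> E a b" if "a \<in> A" "b \<in> B" for a b
    using h(3)[OF that] FAB that by simp
  have AC: "E' (F a) (F c) \<longleftrightarrow> E a c" if "a \<in> A" "c \<in> C" for a c
    using decompD(9)[OF attach.hyps(1) that] decompD(9)[OF dec FAA[OF that(1)] FCC[OF that(2)]] by simp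
  have BC: "E' (F b) (F c) \<longleftrightarrow> E b c" if "b \<in> B" "c \<in> C" for b c
    using decompD(10)[OF attach.hyps(1) that] decompD(10)[OF dec FBB[OF that(1)] FCC[OF that(2)]] by simp
  have CC: "E' (F c) (F c') \<longleftrightarrow> E c c'" if "c \<in> C" "c' \<in> C" for c c'
    using g(2)[OF that] FC that by simp
  have sym: "E' (F u) (F v) \<longleftrightarrow> E u v" if "E' (F v) (F u) \<longleftrightarrow> E v u" for u v
    using that sgraph_sym[OF E(1), of u v] sgraph_sym[OF E(2), of "F u" "F v"] by simp
  have "E' (F u) (F v) \<longleftrightarrow> E u v" if "u \<in> A \<union> B \<union> C" "v \<in> A \<union> B \<union> C" for u v
    using that AA BB AB AC BC CC sym by (elim UnE) metis+
  then show ?case unfolding iso_on_def by (intro exI[of _ F]) (simp add: bij)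
qed

section \<open>Switchings and forbidden subgraphs\<close>

text \<open>
  A version of hereditary uniqueness in which the competing graph \<open>E'\<close> has the same vertices and
  gives each vertex the same degree.  This is weaker than being a hereditary unigraph, but enough
  for the necessity part, since the exchange of edges used there keeps the degree of every vertex.
\<close>

definition hereditarily_unique :: "('a \<Rightarrow> 'a \<Rightarrow> bool) \<Rightarrow> 'a set \<Rightarrow> bool" where
  "hereditarily_unique E V \<longleftrightarrow> (\<forall>X\<subseteq>V. \<forall>E'. sgraph E' \<longrightarrow> (\<forall>v\<in>X. deg E' X v = deg E X v) \<longrightarrow> iso_on E X E' X)"

lemma hereditarily_unique_subset: "hereditarily_unique E V \<Longrightarrow> W \<subseteq> V \<Longrightarrow> hereditarily_unique E W"
  unfolding hereditarily_unique_def by (meson order_trans)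

lemma hereditarily_unique_co:
  assumes E: "sgraph E" and V: "finite V" and hu: "hereditarily_unique E V"
  shows "hereditarily_unique (co E) V"
  unfolding hereditarily_unique_def
proof (intro allI impI)
  fix X E' assume X: "X \<subseteq> V" and E': "sgraph E'" "\<forall>v\<in>X. deg E' X v = deg (co E) X v"
  have fin: "finite X" using X V by (rule finite_subset)
  have "deg (co E') X v = deg E X v" if "v \<in> X" for v
    using deg_co_inside[OF E fin that] deg_co_inside[OF E'(1) fin that] E'(2) that by simp
  then have "iso_on E X (co E') X" using hu X E'(1) by (simp add: hereditarily_unique_def)
  then show "iso_on (co E) X E' X" using E E'(1) by (metis co_co iso_on_co sgraph_co)
qed

text \<open>
  Whether the graph \<open>F\<close> has an edge whose ends have degrees \<open>p\<close> and \<open>q\<close> is invariant under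
  isomorphism, and it is the only invariant needed to tell apart the graphs that follow.  The degrees
  are measured in a second graph \<open>E\<close>, because a switching changes the edges but not the degrees.
\<close>

definition has_edge ::
    "('a \<Rightarrow> 'a \<Rightarrow> bool) \<Rightarrow> ('a \<Rightarrow> 'a \<Rightarrow> bool) \<Rightarrow> 'a set \<Rightarrow> nat \<Rightarrow> nat \<Rightarrow> bool" where
  "has_edge F E X p q \<longleftrightarrow> (\<exists>u\<in>X. \<exists>v\<in>X. F u v \<and> deg E X u = p \<and> deg E X v = q)"

lemma has_edge_iso_on:
  assumes "iso_on E X E' Y"
  shows "has_edge E' E' Y p q \<longleftrightarrow> has_edge E E X p q"
proof -
  obtain f where f: "bij_betw f X Y" "\<And>u v. u \<in> X \<Longrightarrow> v \<in> X \<Longrightarrow> E' (f u) (f v) \<longleftrightarrow> E u v"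
    using assms unfolding iso_on_def by metis
  have Y: "Y = f ` X" using f(1) by (simp add: bij_betw_def)
  have deg: "deg E' Y (f u) = deg E X u" if "u \<in> X" for u
  proof -
    have "{v \<in> Y. E' (f u) v} = f ` {v \<in> X. E u v}" using f(2)[OF that] unfolding Y by auto
    moreover have "inj_on f {v \<in> X. E u v}" using f(1) unfolding bij_betw_def by (auto intro: inj_on_subset)
    ultimately show ?thesis by (simp add: deg_def card_image)
  qed
  show ?thesis unfolding has_edge_def unfolding Y using f(2) deg unfolding Y by auto
qed

lemma deg_exchange:
  assumes "finite X" "p \<in> X" "q \<in> X" "p \<noteq> q" "E v p" "\<not> E v q" "\<not> E' v p"
    "E' v q"
    and "\<And>u. u \<in> X \<Longrightarrow> u \<noteq> p \<Longrightarrow> u \<noteq> q \<Longrightarrow> E' v u \<longleftrightarrow> E v u"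
  shows "deg E' X v = deg E X v"
proof -
  have "deg F X v = deg F (X - {p} - {q}) v + (if F v q then 1 else 0) + (if F v p then 1 else 0)" for F
    using deg_remove[of X p F v] deg_remove[of "X - {p}" q F v] assms(1-4) by simp
  moreover have "deg E' (X - {p} - {q}) v = deg E (X - {p} - {q}) v"
    by (rule deg_cong) (simp add: assms(9))
  ultimately show ?thesis using assms(5-8) by simp
qed

text \<open>
  The edges \<open>xy\<close> and \<open>zw\<close> are exchanged for \<open>xz\<close> and \<open>yw\<close>.
\<close>

definition switch :: "('a \<Rightarrow> 'a \<Rightarrow> bool) \<Rightarrow> 'a \<Rightarrow> 'a \<Rightarrow> 'a \<Rightarrow> 'a \<Rightarrow> 'a \<Rightarrow> 'a \<Rightarrow> bool" where
  "switch E x y z w u v \<longleftrightarrow>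
     {u, v} = {x, z} \<or> {u, v} = {y, w} \<or> {u, v} \<noteq> {x, y} \<and> {u, v} \<noteq> {z, w} \<and> E u v"

lemma sgraph_switch:
  assumes "sgraph E" "x \<noteq> z" "y \<noteq> w"
  shows "sgraph (switch E x y z w)"
proof (rule sgraphI)
  show "switch E x y z w v u" if "switch E x y z w u v" for u v
    using that sgraph_sym[OF assms(1), of u v] by (simp add: switch_def insert_commute[of v u])
  show "\<not> switch E x y z w u u" for u
    using assms sgraph_irrefl[OF assms(1)] by (auto simp: switch_def doubleton_eq_iff)
qed

lemma deg_switch:
  assumes E: "sgraph E" and X: "finite X" "{x, y, z, w} \<subseteq> X" and dist: "distinct [x, y, z, w]"
    and edges: "E x y" "E z w" "\<not> E x z" "\<not> E y w"
  shows "deg (switch E x y z w) X v = deg E X v"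
proof -
  have sym: "E y x" "E w z" "\<not> E z x" "\<not> E w y"
    using edges sgraph_sym[OF E] by metis+
  have mem: "x \<in> X" "y \<in> X" "z \<in> X" "w \<in> X" using X(2) by auto
  have neq: "x \<noteq> y" "x \<noteq> z" "x \<noteq> w" "y \<noteq> z" "y \<noteq> w"
    "z \<noteq> w" using dist by auto
  have E': "switch E x y z w u u' \<longleftrightarrow> (u = x \<and> u' = z \<or> u = z \<and> u' = x) \<or> (u = y \<and> u' = w \<or> u = w \<and> u' = y) \<or>
      \<not> (u = x \<and> u' = y \<or> u = y \<and> u' = x) \<and> \<not> (u = z \<and> u' = w \<or> u = w \<and> u' = z) \<and> E u u'" for u u'
    unfolding switch_def doubleton_eq_iff ..
  consider "v = x" | "v = y" | "v = z" | "v = w" | "v \<notin> {x, y, z, w}" by blast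
  then show ?thesis
  proof cases
    case 1
    then show ?thesis using X(1) mem neq edges sym by (intro deg_exchange[of X y z]) (simp_all add: E')
  next
    case 2
    then show ?thesis using X(1) mem neq edges sym by (intro deg_exchange[of X x w]) (simp_all add: E')
  next
    case 3
    then show ?thesis using X(1) mem neq edges sym by (intro deg_exchange[of X w x]) (simp_all add: E')
  next
    case 4
    then show ?thesis using X(1) mem neq edges sym by (intro deg_exchange[of X z y]) (simp_all add: E')
  next
    case 5
    then show ?thesis by (intro deg_cong) (simp add: E')
  qed
qed

lemma hereditarily_unique_switch:
  assumes E: "sgraph E" and hu: "hereditarily_unique E V" and X: "finite X" "X \<subseteq> V"
    and "x \<in> X" "y \<in> X" "z \<in> X" "w \<in> X" "distinct [x, y, z, w]"
    and "E x y" "E z w" "\<not> E x z" "\<not> E y w"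
  shows "has_edge E E X p q \<longleftrightarrow> has_edge (switch E x y z w) E X p q"
proof -
  have deg: "deg (switch E x y z w) X v = deg E X v" for v
    using assms by (intro deg_switch) auto
  have "sgraph (switch E x y z w)" using assms by (intro sgraph_switch) auto
  then have "iso_on E X (switch E x y z w) X" using hu X deg by (simp add: hereditarily_unique_def)
  then have "has_edge E E X p q \<longleftrightarrow> has_edge (switch E x y z w) (switch E x y z w) X p q"
    by (simp only: has_edge_iso_on)
  then show ?thesis by (simp add: has_edge_def deg)
qed

text \<open>
  Exchanging \<open>ab\<close>, \<open>ed\<close> for \<open>ae\<close>, \<open>bd\<close> turns the path into the edge \<open>ae\<close> and the triangle \<open>bcd\<close>.
  Only the latter graph has an edge between two vertices of degree 1.
\<close>

lemma no_P5:
  assumes E: "sgraph E" and hu: "hereditarily_unique E V" and V: "{a, b, c, d, e} \<subseteq> V"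
    and dist: "distinct [a, b, c, d, e]"
    and edges: "E a b" "\<not> E a c" "\<not> E a d" "\<not> E a e" "E b c" "\<not> E b d"
      "\<not> E b e" "E c d" "\<not> E c e" "E d e"
  shows False
proof -
  let ?X = "{a, b, c, d, e}"
  have sym: "E b a = E a b" "E c a = E a c" "E d a = E a d" "E e a = E a e" "E c b = E b c"
    "E d b = E b d" "E e b = E b e" "E d c = E c d" "E e c = E c e" "E e d = E d e"
    by (rule sgraph_sym[OF E])+
  have irr: "\<not> E u u" for u using E by (rule sgraph_irrefl)
  have neq: "a \<noteq> b" "a \<noteq> c" "a \<noteq> d" "a \<noteq> e" "b \<noteq> c"
    "b \<noteq> d" "b \<noteq> e" "c \<noteq> d" "c \<noteq> e" "d \<noteq> e"
    using dist by simp_all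
  have degs: "deg E ?X a = 1" "deg E ?X b = 2" "deg E ?X c = 2" "deg E ?X d = 2" "deg E ?X e = 1"
    using edges sym irr neq by (simp_all add: deg_insert)
  have "\<not> has_edge E E ?X 1 1"
    using edges sym irr neq by (simp add: degs has_edge_def)
  moreover have "has_edge (switch E a b e d) E ?X 1 1"
    unfolding has_edge_def using edges sym irr neq
    by (intro bexI[where x = e] bexI[where x = a]) (simp_all add: degs switch_def doubleton_eq_iff)
  moreover have "has_edge E E ?X 1 1 \<longleftrightarrow> has_edge (switch E a b e d) E ?X 1 1"
    by (rule hereditarily_unique_switch[OF E hu _ V]) (use edges sym neq in simp_all)
  ultimately show False by (simp only: simp_thms)
qed

text \<open>
  Exchanging \<open>ab\<close>, \<open>cd\<close> for \<open>ac\<close>, \<open>bd\<close> turns the edge and the triangle into the path \<open>acedb\<close>.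
\<close>

lemma no_K2_K3:
  assumes E: "sgraph E" and hu: "hereditarily_unique E V" and V: "{a, b, c, d, e} \<subseteq> V"
    and dist: "distinct [a, b, c, d, e]"
    and edges: "E a b" "\<not> E a c" "\<not> E a d" "\<not> E a e" "\<not> E b c" "\<not> E b d"
      "\<not> E b e" "E c d" "E c e" "E d e"
  shows False
proof -
  let ?X = "{a, b, c, d, e}"
  have sym: "E b a = E a b" "E c a = E a c" "E d a = E a d" "E e a = E a e" "E c b = E b c"
    "E d b = E b d" "E e b = E b e" "E d c = E c d" "E e c = E c e" "E e d = E d e"
    by (rule sgraph_sym[OF E])+
  have irr: "\<not> E u u" for u using E by (rule sgraph_irrefl)
  have neq: "a \<noteq> b" "a \<noteq> c" "a \<noteq> d" "a \<noteq> e" "b \<noteq> c"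
    "b \<noteq> d" "b \<noteq> e" "c \<noteq> d" "c \<noteq> e" "d \<noteq> e"
    using dist by simp_all
  have degs: "deg E ?X a = 1" "deg E ?X b = 1" "deg E ?X c = 2" "deg E ?X d = 2" "deg E ?X e = 2"
    using edges sym irr neq by (simp_all add: deg_insert)
  have "has_edge E E ?X 1 1"
    unfolding has_edge_def using edges sym irr neq
    by (intro bexI[where x = b] bexI[where x = a]) (simp_all add: degs)
  moreover have "\<not> has_edge (switch E a b c d) E ?X 1 1"
    using edges sym irr neq by (simp add: degs has_edge_def switch_def doubleton_eq_iff)
  moreover have "has_edge E E ?X 1 1 \<longleftrightarrow> has_edge (switch E a b c d) E ?X 1 1"
    by (rule hereditarily_unique_switch[OF E hu _ V]) (use edges sym neq in simp_all)
  ultimately show False by (simp only: simp_thms)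
qed

text \<open>
  The triangle \<open>vab\<close> with the tail \<open>v\<close>, \<open>c\<close>, \<open>d\<close> becomes the four-cycle through \<open>v\<close>, \<open>b\<close>, \<open>a\<close>, \<open>c\<close> with
  the end vertex \<open>d\<close> attached to \<open>v\<close>: the vertex of degree 1 moves from a neighbour of degree 2 to
  one of degree 3.
\<close>

lemma no_triangle_tail:
  assumes E: "sgraph E" and hu: "hereditarily_unique E V" and V: "{v, a, b, c, d} \<subseteq> V"
    and dist: "distinct [v, a, b, c, d]"
    and edges: "E v a" "E v b" "E v c" "\<not> E v d" "E a b" "\<not> E a c" "\<not> E a d"
      "\<not> E b c" "\<not> E b d" "E c d"
  shows False
proof -
  let ?X = "{v, a, b, c, d}"
  have sym: "E a v = E v a" "E b v = E v b" "E c v = E v c" "E d v = E v d" "E b a = E a b"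
    "E c a = E a c" "E d a = E a d" "E c b = E b c" "E d b = E b d" "E d c = E c d"
    by (rule sgraph_sym[OF E])+
  have irr: "\<not> E u u" for u using E by (rule sgraph_irrefl)
  have neq: "v \<noteq> a" "v \<noteq> b" "v \<noteq> c" "v \<noteq> d" "a \<noteq> b"
    "a \<noteq> c" "a \<noteq> d" "b \<noteq> c" "b \<noteq> d" "c \<noteq> d"
    using dist by simp_all
  have degs: "deg E ?X v = 3" "deg E ?X a = 2" "deg E ?X b = 2" "deg E ?X c = 2" "deg E ?X d = 1"
    using edges sym irr neq by (simp_all add: deg_insert)
  have "\<not> has_edge E E ?X 1 3"
    using edges sym irr neq by (simp add: degs has_edge_def)
  moreover have "has_edge (switch E c d a v) E ?X 1 3"
    unfolding has_edge_def using edges sym irr neq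
    by (intro bexI[where x = d] bexI[where x = v]) (simp_all add: degs switch_def doubleton_eq_iff)
  moreover have "has_edge E E ?X 1 3 \<longleftrightarrow> has_edge (switch E c d a v) E ?X 1 3"
    by (rule hereditarily_unique_switch[OF E hu _ V]) (use edges sym neq in simp_all)
  ultimately show False by (simp only: simp_thms)
qed

text \<open>
  Two paths \<open>abc\<close>, \<open>def\<close> become the edge \<open>ad\<close> and the path \<open>cbef\<close>.
\<close>

lemma no_2P3:
  assumes E: "sgraph E" and hu: "hereditarily_unique E V" and V: "{a, b, c, d, e, f} \<subseteq> V"
    and dist: "distinct [a, b, c, d, e, f]"
    and edges: "E a b" "\<not> E a c" "\<not> E a d" "\<not> E a e" "\<not> E a f" "E b c"
      "\<not> E b d" "\<not> E b e" "\<not> E b f" "\<not> E c d" "\<not> E c e" "\<not> E c f"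
      "E d e" "\<not> E d f" "E e f"
  shows False
proof -
  let ?X = "{a, b, c, d, e, f}"
  have sym: "E b a = E a b" "E c a = E a c" "E d a = E a d" "E e a = E a e" "E f a = E a f"
    "E c b = E b c" "E d b = E b d" "E e b = E b e" "E f b = E b f" "E d c = E c d"
    "E e c = E c e" "E f c = E c f" "E e d = E d e" "E f d = E d f" "E f e = E e f"
    by (rule sgraph_sym[OF E])+
  have irr: "\<not> E u u" for u using E by (rule sgraph_irrefl)
  have neq: "a \<noteq> b" "a \<noteq> c" "a \<noteq> d" "a \<noteq> e" "a \<noteq> f"
    "b \<noteq> c" "b \<noteq> d" "b \<noteq> e" "b \<noteq> f" "c \<noteq> d" "c \<noteq> e"
    "c \<noteq> f" "d \<noteq> e" "d \<noteq> f" "e \<noteq> f"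
    using dist by simp_all
  have degs: "deg E ?X a = 1" "deg E ?X b = 2" "deg E ?X c = 1" "deg E ?X d = 1" "deg E ?X e = 2"
    "deg E ?X f = 1"
    using edges sym irr neq by (simp_all add: deg_insert)
  have "\<not> has_edge E E ?X 1 1"
    using edges sym irr neq by (simp add: degs has_edge_def)
  moreover have "has_edge (switch E a b d e) E ?X 1 1"
    unfolding has_edge_def using edges sym irr neq
    by (intro bexI[where x = d] bexI[where x = a]) (simp_all add: degs switch_def doubleton_eq_iff)
  moreover have "has_edge E E ?X 1 1 \<longleftrightarrow> has_edge (switch E a b d e) E ?X 1 1"
    by (rule hereditarily_unique_switch[OF E hu _ V]) (use edges sym neq in simp_all)
  ultimately show False by (simp only: simp_thms)
qed

text \<open>
  The edge \<open>ab\<close> and the path \<open>cdef\<close> become two paths with three vertices.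
\<close>

lemma no_K2_P4:
  assumes E: "sgraph E" and hu: "hereditarily_unique E V" and V: "{a, b, c, d, e, f} \<subseteq> V"
    and dist: "distinct [a, b, c, d, e, f]"
    and edges: "E a b" "\<not> E a c" "\<not> E a d" "\<not> E a e" "\<not> E a f" "\<not> E b c"
      "\<not> E b d" "\<not> E b e" "\<not> E b f" "E c d" "\<not> E c e" "\<not> E c f" "E d e"
      "\<not> E d f" "E e f"
  shows False
proof -
  let ?X = "{a, b, c, d, e, f}"
  have sym: "E b a = E a b" "E c a = E a c" "E d a = E a d" "E e a = E a e" "E f a = E a f"
    "E c b = E b c" "E d b = E b d" "E e b = E b e" "E f b = E b f" "E d c = E c d"
    "E e c = E c e" "E f c = E c f" "E e d = E d e" "E f d = E d f" "E f e = E e f"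
    by (rule sgraph_sym[OF E])+
  have irr: "\<not> E u u" for u using E by (rule sgraph_irrefl)
  have neq: "a \<noteq> b" "a \<noteq> c" "a \<noteq> d" "a \<noteq> e" "a \<noteq> f"
    "b \<noteq> c" "b \<noteq> d" "b \<noteq> e" "b \<noteq> f" "c \<noteq> d" "c \<noteq> e"
    "c \<noteq> f" "d \<noteq> e" "d \<noteq> f" "e \<noteq> f"
    using dist by simp_all
  have degs: "deg E ?X a = 1" "deg E ?X b = 1" "deg E ?X c = 1" "deg E ?X d = 2" "deg E ?X e = 2"
    "deg E ?X f = 1"
    using edges sym irr neq by (simp_all add: deg_insert)
  have "has_edge E E ?X 1 1"
    unfolding has_edge_def using edges sym irr neq
    by (intro bexI[where x = b] bexI[where x = a]) (simp_all add: degs)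
  moreover have "\<not> has_edge (switch E a b d e) E ?X 1 1"
    using edges sym irr neq by (simp add: degs has_edge_def switch_def doubleton_eq_iff)
  moreover have "has_edge E E ?X 1 1 \<longleftrightarrow> has_edge (switch E a b d e) E ?X 1 1"
    by (rule hereditarily_unique_switch[OF E hu _ V]) (use edges sym neq in simp_all)
  ultimately show False by (simp only: simp_thms)
qed

text \<open>
  The edge \<open>ab\<close> and the four-cycle \<open>cdef\<close> become a path with six vertices.
\<close>

lemma no_K2_C4:
  assumes E: "sgraph E" and hu: "hereditarily_unique E V" and V: "{a, b, c, d, e, f} \<subseteq> V"
    and dist: "distinct [a, b, c, d, e, f]"
    and edges: "E a b" "\<not> E a c" "\<not> E a d" "\<not> E a e" "\<not> E a f" "\<not> E b c"
      "\<not> E b d" "\<not> E b e" "\<not> E b f" "E c d" "\<not> E c e" "E c f" "E d e"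
      "\<not> E d f" "E e f"
  shows False
proof -
  let ?X = "{a, b, c, d, e, f}"
  have sym: "E b a = E a b" "E c a = E a c" "E d a = E a d" "E e a = E a e" "E f a = E a f"
    "E c b = E b c" "E d b = E b d" "E e b = E b e" "E f b = E b f" "E d c = E c d"
    "E e c = E c e" "E f c = E c f" "E e d = E d e" "E f d = E d f" "E f e = E e f"
    by (rule sgraph_sym[OF E])+
  have irr: "\<not> E u u" for u using E by (rule sgraph_irrefl)
  have neq: "a \<noteq> b" "a \<noteq> c" "a \<noteq> d" "a \<noteq> e" "a \<noteq> f"
    "b \<noteq> c" "b \<noteq> d" "b \<noteq> e" "b \<noteq> f" "c \<noteq> d" "c \<noteq> e"
    "c \<noteq> f" "d \<noteq> e" "d \<noteq> f" "e \<noteq> f"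
    using dist by simp_all
  have degs: "deg E ?X a = 1" "deg E ?X b = 1" "deg E ?X c = 2" "deg E ?X d = 2" "deg E ?X e = 2"
    "deg E ?X f = 2"
    using edges sym irr neq by (simp_all add: deg_insert)
  have "has_edge E E ?X 1 1"
    unfolding has_edge_def using edges sym irr neq
    by (intro bexI[where x = b] bexI[where x = a]) (simp_all add: degs)
  moreover have "\<not> has_edge (switch E a b c d) E ?X 1 1"
    using edges sym irr neq by (simp add: degs has_edge_def switch_def doubleton_eq_iff)
  moreover have "has_edge E E ?X 1 1 \<longleftrightarrow> has_edge (switch E a b c d) E ?X 1 1"
    by (rule hereditarily_unique_switch[OF E hu _ V]) (use edges sym neq in simp_all)
  ultimately show False by (simp only: simp_thms)
qed

text \<open>
  The complement of the previous configuration: \<open>u\<close>, \<open>v\<close> are not adjacent and see all of the two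
  independent edges \<open>ab\<close>, \<open>cd\<close>.  The exchange makes the two vertices of degree 4 adjacent.
\<close>

lemma no_co_K2_C4:
  assumes E: "sgraph E" and hu: "hereditarily_unique E V" and V: "{u, v, a, b, c, d} \<subseteq> V"
    and dist: "distinct [u, v, a, b, c, d]"
    and edges: "\<not> E u v" "E u a" "E u b" "E u c" "E u d" "E v a" "E v b" "E v c" "E v d"
      "E a b" "\<not> E a c" "\<not> E a d" "\<not> E b c" "\<not> E b d" "E c d"
  shows False
proof -
  let ?X = "{u, v, a, b, c, d}"
  have sym: "E v u = E u v" "E a u = E u a" "E b u = E u b" "E c u = E u c" "E d u = E u d"
    "E a v = E v a" "E b v = E v b" "E c v = E v c" "E d v = E v d" "E b a = E a b"
    "E c a = E a c" "E d a = E a d" "E c b = E b c" "E d b = E b d" "E d c = E c d"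
    by (rule sgraph_sym[OF E])+
  have irr: "\<not> E u u" for u using E by (rule sgraph_irrefl)
  have neq: "u \<noteq> v" "u \<noteq> a" "u \<noteq> b" "u \<noteq> c" "u \<noteq> d"
    "v \<noteq> a" "v \<noteq> b" "v \<noteq> c" "v \<noteq> d" "a \<noteq> b" "a \<noteq> c"
    "a \<noteq> d" "b \<noteq> c" "b \<noteq> d" "c \<noteq> d"
    using dist by simp_all
  have degs: "deg E ?X u = 4" "deg E ?X v = 4" "deg E ?X a = 3" "deg E ?X b = 3" "deg E ?X c = 3"
    "deg E ?X d = 3"
    using edges sym irr neq by (simp_all add: deg_insert)
  have "\<not> has_edge E E ?X 4 4"
    using edges sym irr neq by (simp add: degs has_edge_def)
  moreover have "has_edge (switch E u a v c) E ?X 4 4"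
    unfolding has_edge_def using edges sym irr neq
    by (intro bexI[where x = v] bexI[where x = u]) (simp_all add: degs switch_def doubleton_eq_iff)
  moreover have "has_edge E E ?X 4 4 \<longleftrightarrow> has_edge (switch E u a v c) E ?X 4 4"
    by (rule hereditarily_unique_switch[OF E hu _ V]) (use edges sym neq in simp_all)
  ultimately show False by (simp only: simp_thms)
qed

text \<open>
  In a split graph with clique \<open>a1\<close>, \<open>a2\<close>, \<open>a3\<close> and independent vertices \<open>b1\<close>, \<open>b2\<close>, \<open>b3\<close>, the edges
  between the sides form the path \<open>a2 b1 a1 b2\<close> and the edge \<open>a3 b3\<close>.  After the exchange they form
  the paths \<open>b2 a1 b3\<close> and \<open>a2 b1 a3\<close>, so the vertices of degrees 4 and 2 are no longer adjacent.
\<close>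

lemma no_split_P4_K2:
  assumes E: "sgraph E" and hu: "hereditarily_unique E V" and V: "{a1, a2, a3, b1, b2, b3} \<subseteq> V"
    and dist: "distinct [a1, a2, a3, b1, b2, b3]"
    and edges: "E a1 a2" "E a1 a3" "E a1 b1" "E a1 b2" "\<not> E a1 b3" "E a2 a3" "E a2 b1"
      "\<not> E a2 b2" "\<not> E a2 b3" "\<not> E a3 b1" "\<not> E a3 b2" "E a3 b3"
      "\<not> E b1 b2" "\<not> E b1 b3" "\<not> E b2 b3"
  shows False
proof -
  let ?X = "{a1, a2, a3, b1, b2, b3}"
  have sym: "E a2 a1 = E a1 a2" "E a3 a1 = E a1 a3" "E b1 a1 = E a1 b1" "E b2 a1 = E a1 b2"
    "E b3 a1 = E a1 b3" "E a3 a2 = E a2 a3" "E b1 a2 = E a2 b1" "E b2 a2 = E a2 b2"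
    "E b3 a2 = E a2 b3" "E b1 a3 = E a3 b1" "E b2 a3 = E a3 b2" "E b3 a3 = E a3 b3"
    "E b2 b1 = E b1 b2" "E b3 b1 = E b1 b3" "E b3 b2 = E b2 b3"
    by (rule sgraph_sym[OF E])+
  have irr: "\<not> E u u" for u using E by (rule sgraph_irrefl)
  have neq: "a1 \<noteq> a2" "a1 \<noteq> a3" "a1 \<noteq> b1" "a1 \<noteq> b2" "a1 \<noteq> b3"
    "a2 \<noteq> a3" "a2 \<noteq> b1" "a2 \<noteq> b2" "a2 \<noteq> b3" "a3 \<noteq> b1"
    "a3 \<noteq> b2" "a3 \<noteq> b3" "b1 \<noteq> b2" "b1 \<noteq> b3" "b2 \<noteq> b3"
    using dist by simp_all
  have degs: "deg E ?X a1 = 4" "deg E ?X a2 = 3" "deg E ?X a3 = 3" "deg E ?X b1 = 2"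
    "deg E ?X b2 = 1" "deg E ?X b3 = 1"
    using edges sym irr neq by (simp_all add: deg_insert)
  have "has_edge E E ?X 4 2"
    unfolding has_edge_def using edges sym irr neq
    by (intro bexI[where x = a1] bexI[where x = b1]) (simp_all add: degs)
  moreover have "\<not> has_edge (switch E a1 b1 b3 a3) E ?X 4 2"
    using edges sym irr neq by (simp add: degs has_edge_def switch_def doubleton_eq_iff)
  moreover have "has_edge E E ?X 4 2 \<longleftrightarrow> has_edge (switch E a1 b1 b3 a3) E ?X 4 2"
    by (rule hereditarily_unique_switch[OF E hu _ V]) (use edges sym neq in simp_all)
  ultimately show False by (simp only: simp_thms)
qed

text \<open>
  The same exchange in the opposite direction.
\<close>

lemma no_split_2P3:
  assumes E: "sgraph E" and hu: "hereditarily_unique E V" and V: "{a1, a2, a3, b1, b2, b3} \<subseteq> V"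
    and dist: "distinct [a1, a2, a3, b1, b2, b3]"
    and edges: "E a1 a2" "E a1 a3" "\<not> E a1 b1" "E a1 b2" "E a1 b3" "E a2 a3" "E a2 b1"
      "\<not> E a2 b2" "\<not> E a2 b3" "E a3 b1" "\<not> E a3 b2" "\<not> E a3 b3"
      "\<not> E b1 b2" "\<not> E b1 b3" "\<not> E b2 b3"
  shows False
proof -
  let ?X = "{a1, a2, a3, b1, b2, b3}"
  have sym: "E a2 a1 = E a1 a2" "E a3 a1 = E a1 a3" "E b1 a1 = E a1 b1" "E b2 a1 = E a1 b2"
    "E b3 a1 = E a1 b3" "E a3 a2 = E a2 a3" "E b1 a2 = E a2 b1" "E b2 a2 = E a2 b2"
    "E b3 a2 = E a2 b3" "E b1 a3 = E a3 b1" "E b2 a3 = E a3 b2" "E b3 a3 = E a3 b3"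
    "E b2 b1 = E b1 b2" "E b3 b1 = E b1 b3" "E b3 b2 = E b2 b3"
    by (rule sgraph_sym[OF E])+
  have irr: "\<not> E u u" for u using E by (rule sgraph_irrefl)
  have neq: "a1 \<noteq> a2" "a1 \<noteq> a3" "a1 \<noteq> b1" "a1 \<noteq> b2" "a1 \<noteq> b3"
    "a2 \<noteq> a3" "a2 \<noteq> b1" "a2 \<noteq> b2" "a2 \<noteq> b3" "a3 \<noteq> b1"
    "a3 \<noteq> b2" "a3 \<noteq> b3" "b1 \<noteq> b2" "b1 \<noteq> b3" "b2 \<noteq> b3"
    using dist by simp_all
  have degs: "deg E ?X a1 = 4" "deg E ?X a2 = 3" "deg E ?X a3 = 3" "deg E ?X b1 = 2"
    "deg E ?X b2 = 1" "deg E ?X b3 = 1"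
    using edges sym irr neq by (simp_all add: deg_insert)
  have "\<not> has_edge E E ?X 4 2"
    using edges sym irr neq by (simp add: degs has_edge_def)
  moreover have "has_edge (switch E a1 b3 b1 a3) E ?X 4 2"
    unfolding has_edge_def using edges sym irr neq
    by (intro bexI[where x = a1] bexI[where x = b1]) (simp_all add: degs switch_def doubleton_eq_iff)
  moreover have "has_edge E E ?X 4 2 \<longleftrightarrow> has_edge (switch E a1 b3 b1 a3) E ?X 4 2"
    by (rule hereditarily_unique_switch[OF E hu _ V]) (use edges sym neq in simp_all)
  ultimately show False by (simp only: simp_thms)
qed

section \<open>Graphs containing two independent edges\<close>

definition two_K2 :: "('a \<Rightarrow> 'a \<Rightarrow> bool) \<Rightarrow> 'a \<Rightarrow> 'a \<Rightarrow> 'a \<Rightarrow> 'a \<Rightarrow> bool" where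
  "two_K2 E a b c d \<longleftrightarrow> E a b \<and> E c d \<and> \<not> E a c \<and> \<not> E a d \<and> \<not> E b c \<and> \<not> E b d"

lemma two_K2_sym:
  assumes "sgraph E" "two_K2 E a b c d"
  shows "two_K2 E b a c d" "two_K2 E a b d c" "two_K2 E c d a b"
  using assms(2) sgraph_sym[OF assms(1)] unfolding two_K2_def by metis+

lemma two_K2_distinct:
  assumes "sgraph E" "two_K2 E a b c d"
  shows "distinct [a, b, c, d]"
proof -
  have "a \<noteq> b" "c \<noteq> d" using assms sgraph_irrefl[OF assms(1)] by (auto simp: two_K2_def)
  moreover have "a \<noteq> c" "a \<noteq> d" "b \<noteq> c" "b \<noteq> d"
    using assms(2) sgraph_sym[OF assms(1)] unfolding two_K2_def by metis+
  ultimately show ?thesis by simp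
qed

text \<open>
  Two neighbours of \<open>v\<close> on the same edge give an edge and a triangle unless there is a third
  neighbour, two neighbours on different edges give a path with five vertices unless there is a
  third, and three neighbours give a triangle with a tail unless there is a fourth.
\<close>

lemma two_K2_two_neighbours:
  assumes E: "sgraph E" and hu: "hereditarily_unique E V" and V: "{a, b, c, d, v} \<subseteq> V"
    and K: "two_K2 E a b c d" and v: "v \<notin> {a, b, c, d}"
    and xy: "x \<in> {a, b, c, d}" "y \<in> {a, b, c, d}" "x \<noteq> y" "E v x" "E v y"
    and u: "u \<in> {a, b, c, d}"
  shows "E v u"
proof -
  have sub: "E v r \<or> E v s" if "{p, q, r, s} = {a, b, c, d}" "two_K2 E p q r s" "E v p"
    "E v q" for p q r s
  proof (rule ccontr)
    assume neg: "\<not> (E v r \<or> E v s)"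
    have "distinct [r, s, v, p, q]" using two_K2_distinct[OF E that(2)] that(1) v by auto
    moreover have "{r, s, v, p, q} \<subseteq> V" using V that(1) by auto
    moreover have "E r s" "E p q" "\<not> E r v" "\<not> E s v" "\<not> E r p" "\<not> E r q"
      "\<not> E s p" "\<not> E s q"
      using that(2) neg sgraph_sym[OF E] unfolding two_K2_def by metis+
    ultimately show False using no_K2_K3[OF E hu, of r s v p q] that(3,4) by simp
  qed
  have cross: "E v q \<or> E v s" if "{p, q, r, s} = {a, b, c, d}" "two_K2 E p q r s" "E v p"
    "E v r" for p q r s
  proof (rule ccontr)
    assume neg: "\<not> (E v q \<or> E v s)"
    have "distinct [q, p, v, r, s]" using two_K2_distinct[OF E that(2)] that(1) v by auto
    moreover have "{q, p, v, r, s} \<subseteq> V" using V that(1) by auto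
    moreover have "E q p" "E p v" "E r s" "\<not> E q v" "\<not> E q r" "\<not> E q s"
      "\<not> E p r" "\<not> E p s" "\<not> E v s"
      using that(2,3) neg sgraph_sym[OF E] unfolding two_K2_def by metis+
    ultimately show False using no_P5[OF E hu, of q p v r s] that(4) by simp
  qed
  have three: "E v s" if "{p, q, r, s} = {a, b, c, d}" "two_K2 E p q r s" "E v p" "E v q"
    "E v r" for p q r s
  proof (rule ccontr)
    assume neg: "\<not> E v s"
    have "distinct [v, p, q, r, s]" using two_K2_distinct[OF E that(2)] that(1) v by auto
    moreover have "{v, p, q, r, s} \<subseteq> V" using V that(1) by auto
    moreover have "E p q" "E r s" "\<not> E p r" "\<not> E p s" "\<not> E q r" "\<not> E q s"
      using that(2) unfolding two_K2_def by metis+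
    ultimately show False using no_triangle_tail[OF E hu, of v p q r s] that(3-5) neg by simp
  qed
  have K1: "two_K2 E b a c d" "two_K2 E a b d c" "two_K2 E c d a b" using two_K2_sym[OF E K] by auto
  have K2: "two_K2 E b a d c" using two_K2_sym[OF E K1(1)] by auto
  have K3: "two_K2 E d c a b" "two_K2 E c d b a" using two_K2_sym[OF E K1(3)] by auto
  have K4: "two_K2 E d c b a" using two_K2_sym[OF E K3(1)] by auto
  have sets: "{b, a, c, d} = {a, b, c, d}" "{a, b, d, c} = {a, b, c, d}" "{c, d, a, b} = {a, b, c, d}"
    "{b, a, d, c} = {a, b, c, d}" "{d, c, a, b} = {a, b, c, d}" "{c, d, b, a} = {a, b, c, d}"
    "{d, c, b, a} = {a, b, c, d}" by auto
  have 1: "E v a \<Longrightarrow> E v b \<Longrightarrow> E v c \<or> E v d" using sub[OF refl K] .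
  have 2: "E v c \<Longrightarrow> E v d \<Longrightarrow> E v a \<or> E v b" using sub[OF sets(3) K1(3)] .
  have 3: "E v a \<Longrightarrow> E v c \<Longrightarrow> E v b \<or> E v d" using cross[OF refl K] .
  have 4: "E v b \<Longrightarrow> E v c \<Longrightarrow> E v a \<or> E v d" using cross[OF sets(1) K1(1)] .
  have 5: "E v a \<Longrightarrow> E v d \<Longrightarrow> E v b \<or> E v c" using cross[OF sets(2) K1(2)] .
  have 6: "E v b \<Longrightarrow> E v d \<Longrightarrow> E v a \<or> E v c" using cross[OF sets(4) K2] .
  have 7: "E v a \<Longrightarrow> E v b \<Longrightarrow> E v c \<Longrightarrow> E v d" using three[OF refl K] .
  have 8: "E v a \<Longrightarrow> E v b \<Longrightarrow> E v d \<Longrightarrow> E v c" using three[OF sets(2) K1(2)] .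
  have 9: "E v c \<Longrightarrow> E v d \<Longrightarrow> E v a \<Longrightarrow> E v b" using three[OF sets(3) K1(3)] .
  have 10: "E v c \<Longrightarrow> E v d \<Longrightarrow> E v b \<Longrightarrow> E v a" using three[OF sets(6) K3(2)] .
  have "E v a \<and> E v b \<or> E v a \<and> E v c \<or> E v a \<and> E v d \<or> E v b \<and> E v c \<or> E v b \<and> E v d \<or> E v c \<and> E v d"
    using xy by auto
  then have "E v a \<and> E v b \<and> E v c \<and> E v d" using 1 2 3 4 5 6 7 8 9 10 by argo
  then show ?thesis using u by auto
qed

text \<open>
  The graph on \<open>C\<close> is the disjoint union of a star with centre \<open>z\<close> and at least one further edge.
\<close>

definition star_matching :: "('a \<Rightarrow> 'a \<Rightarrow> bool) \<Rightarrow> 'a set \<Rightarrow> 'a \<Rightarrow> bool" where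
  "star_matching E C z \<longleftrightarrow> z \<in> C \<and> (\<exists>y\<in>C. E z y) \<and>
     (\<forall>v\<in>C. v \<noteq> z \<longrightarrow> (\<exists>!u. u \<in> C \<and> E v u)) \<and> (\<exists>x\<in>C. x \<noteq> z \<and> \<not> E z x)"

lemma Ex1_insert_iff: "\<not> E v w \<Longrightarrow> (\<exists>!u. u \<in> insert w C \<and> E v u) \<longleftrightarrow> (\<exists>!u. u \<in> C \<and> E v u)"
  by (metis insert_iff)

lemma Ex1_new_vertex:
  assumes "z \<in> C" "E v z" "\<not> E v v"
    "\<And>w. w \<in> C \<Longrightarrow> E v w \<Longrightarrow> w = z"
  shows "\<exists>!u. u \<in> insert v C \<and> E v u"
  using assms by blast

text \<open>
  A new leaf \<open>v\<close> is attached to \<open>z\<close>.  If the old star is a single edge, then \<open>z\<close> may be either of its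
  ends or an end of another single edge, whereas a larger star must have its centre at \<open>z\<close>.
\<close>

lemma star_matching_insert:
  assumes E: "sgraph E" and z: "z \<in> C" and v: "E v z"
    and only: "\<And>w. w \<in> C \<Longrightarrow> E v w \<Longrightarrow> w = z"
    and one: "\<And>w. w \<in> C \<Longrightarrow> w \<noteq> z \<Longrightarrow> \<exists>!u. u \<in> C \<and> E w u"
    and x: "x \<in> C" "x \<noteq> z" "\<not> E z x"
  shows "star_matching E (insert v C) z"
  unfolding star_matching_def
proof (intro conjI ballI impI)
  show "z \<in> insert v C" using z by simp
  show "\<exists>y\<in>insert v C. E z y" using v sgraph_sym[OF E, of z v] by simp
  show "\<exists>u\<in>insert v C. u \<noteq> z \<and> \<not> E z u" using x by blast
  fix w assume w: "w \<in> insert v C" "w \<noteq> z"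
  show "\<exists>!u. u \<in> insert v C \<and> E w u"
  proof (cases "w = v")
    case True
    show ?thesis unfolding True by (rule Ex1_new_vertex[where E = E, OF z v sgraph_irrefl[OF E] only])
  next
    case False
    then have wC: "w \<in> C" using w(1) by simp
    then have "\<not> E w v" using only[of w] w(2) sgraph_sym[OF E, of w v] by blast
    then show ?thesis
      using one[OF wC w(2)] by (simp only: Ex1_insert_iff simp_thms not_False_eq_True)
  qed
qed

text \<open>
  Let \<open>C\<close> be a largest set inducing a star and at least one further edge.  A vertex outside \<open>C\<close> that
  sees some but not all of \<open>C\<close> has only one neighbour in \<open>C\<close> or sees only leaves of the star, by
  \<open>two_K2_two_neighbours\<close>.  Such a vertex enlarges the star, or turns a single edge into a second
  star, or extends a leaf to a path, or closes a four-cycle; the first contradicts maximality and the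
  others produce excluded subgraphs.  So the vertices
  outside \<open>C\<close> see all or nothing of \<open>C\<close>.  Those that see all of \<open>C\<close> are pairwise adjacent by
  \<open>no_co_K2_C4\<close>, and an edge between two that see nothing could be added to \<open>C\<close>.
\<close>

theorem two_K2_decomp:
  assumes E: "sgraph E" and finV: "finite V" and hu: "hereditarily_unique E V"
    and abcd: "{a, b, c, d} \<subseteq> V" "two_K2 E a b c d"
  obtains D N C z where "V = D \<union> N \<union> C" "decomp E D N C" "star_matching E C z"
proof -
  have sym: "E u v \<longleftrightarrow> E v u" for u v using sgraph_sym[OF E] .
  have irr: "\<not> E u u" for u using sgraph_irrefl[OF E] .
  have "star_matching E {a, b, c, d} a"
  proof -
    have ed: "E a b" "E b a" "E c d" "E d c" "\<not> E a c" "\<not> E a d" "\<not> E b c" "\<not> E b d"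
      "\<not> E c a" "\<not> E d a" "\<not> E c b" "\<not> E d b"
      using abcd(2) sym unfolding two_K2_def by metis+
    have "\<exists>!u. u \<in> {a, b, c, d} \<and> E b u" using ed irr by (intro ex1I[of _ a]) auto
    moreover have "\<exists>!u. u \<in> {a, b, c, d} \<and> E c u" using ed irr by (intro ex1I[of _ d]) auto
    moreover have "\<exists>!u. u \<in> {a, b, c, d} \<and> E d u" using ed irr by (intro ex1I[of _ c]) auto
    moreover have "b \<noteq> a" "c \<noteq> a"
      "d \<noteq> a" using two_K2_distinct[OF E abcd(2)] by auto
    ultimately show ?thesis
      using ed by (simp add: star_matching_def)
  qed
  then have "\<exists>C. (C \<subseteq> V \<and> (\<exists>z. star_matching E C z)) \<and>
    (\<forall>C'. C' \<subseteq> V \<and> (\<exists>z. star_matching E C' z) \<longrightarrow> card C' \<le> card C)"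
    using abcd(1) finV
    by (intro ex_has_greatest_nat[where k = "{a, b, c, d}" and b = "Suc (card V)"])
      (auto simp: less_Suc_eq_le intro: card_mono)
  then obtain C z where C: "C \<subseteq> V" "star_matching E C z"
    and max: "\<And>C' z'. C' \<subseteq> V \<Longrightarrow> star_matching E C' z' \<Longrightarrow> card C' \<le> card C"
    by metis
  have finC: "finite C" using C(1) finV by (rule finite_subset)
  have no_ext: False if "star_matching E (insert v C) z'" "v \<in> V" "v \<notin> C" for v z'
    using max[OF _ that(1)] that(2,3) C(1) finC by simp
  have z: "z \<in> C" using C(2) by (simp add: star_matching_def)
  obtain y where y: "y \<in> C" "E z y" using C(2) unfolding star_matching_def by metis
  have one: "\<exists>!u. u \<in> C \<and> E v u" if "v \<in> C" "v \<noteq> z" for v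
    using C(2) that unfolding star_matching_def by metis
  have uniq: "u = w" if "v \<in> C" "v \<noteq> z" "u \<in> C" "E v u" "w \<in> C" "E v w" for u v w
    using one[OF that(1,2)] that(3-6) by blast
  \<comment> \<open>The vertices of the single edges: all of C except the star around z.\<close>
  define M where "M = {x \<in> C. x \<noteq> z \<and> \<not> E z x}"
  have M: "x \<in> C" "x \<noteq> z" "\<not> E z x" "\<not> E x z" if "x \<in> M" for x
    using that sym[of x z] by (auto simp: M_def)
  obtain x0 where x0: "x0 \<in> M" using C(2) unfolding star_matching_def M_def by blast
  have mate: "\<exists>x'\<in>M. E x x'" if x: "x \<in> M" for x
  proof -
    obtain x' where x': "x' \<in> C" "E x x'" using one[OF M(1,2)[OF x]] by blast
    have "E x' x" using x'(2) sym by simp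
    have "x' \<noteq> z" using M(4)[OF x] x'(2) by blast
    moreover have "\<not> E z x'"
    proof
      assume "E z x'"
      then have "E x' z" using sym by simp
      then have "z = x" using uniq[OF x'(1) \<open>x' \<noteq> z\<close> z _ M(1)[OF x] \<open>E x' x\<close>] by simp
      then show False using M(2)[OF x] by simp
    qed
    ultimately show ?thesis using x' by (auto simp: M_def)
  qed
  have away: "\<not> E u x \<and> \<not> E u x' \<and> \<not> E x u \<and> \<not> E x' u"
    if "x \<in> M" "x' \<in> M" "E x x'" "u \<in> C" "u \<noteq> x" "u \<noteq> x'" for x x' u
  proof -
    have "E x' x" using that(3) sym by simp
    then have "\<not> E x u" "\<not> E x' u"
      using uniq[OF M(1,2)[OF that(1)] that(4) _ M(1)[OF that(2)] that(3)]
        uniq[OF M(1,2)[OF that(2)] that(4) _ M(1)[OF that(1)]] that(5,6) by auto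
    then show ?thesis using sym by simp
  qed
  have leaf: "u = z" if "w \<in> C" "E z w" "u \<in> C" "E w u" for u w
  proof -
    have "w \<noteq> z" using that(2) irr by auto
    moreover have "E w z" using that(2) sym by simp
    ultimately show ?thesis using uniq[OF that(1) _ that(3,4) z] by simp
  qed
  have pair: "\<exists>w'\<in>C. two_K2 E w w' x x'"
    if "x \<in> M" "x' \<in> M" "E x x'" "w \<in> C" "w \<noteq> x" "w \<noteq> x'" for x x' w
  proof -
    obtain w' where w': "w' \<in> C" "E w w'" using y one[OF \<open>w \<in> C\<close>] by metis
    have "w' \<noteq> x" "w' \<noteq> x'" using away[OF that(1-6)] w'(2) by auto
    then have "two_K2 E w w' x x'"
      using away[OF that(1-6)] away[OF that(1-3) w'(1)] that(3) w'(2) by (simp add: two_K2_def)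
    then show ?thesis using w'(1) by blast
  qed
  have split: "(\<forall>w\<in>C. E v w) \<or> (\<forall>w\<in>C. \<not> E v w)" if v: "v \<in> V" "v \<notin> C" for v
  proof (rule ccontr)
    assume neg: "\<not> ?thesis"
    then obtain u where u: "u \<in> C" "E v u" by blast
    have incomplete: "\<not> (\<forall>w\<in>C. E v w)" using neg by blast
    have vne: "v \<noteq> w" if "w \<in> C" for w using v(2) that by blast
    \<comment> \<open>A vertex of a single edge together with any other vertex of C lies in a pair of
      independent edges, so two neighbours there already force all four.\<close>
    have spread: "E v q" if "x \<in> M" "x' \<in> M" "E x x'" "two_K2 E w w' x x'" "w \<in> C"
      "w' \<in> C"
      "p \<in> {w, w', x, x'}" "p' \<in> {w, w', x, x'}" "p \<noteq> p'" "E v p" "E v p'"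
        "q \<in> {w, w', x, x'}"
      for x x' w w' p p' q
      by (rule two_K2_two_neighbours[OF E hu _ that(4) _ that(7-12)])
        (use that(1,2,5,6) M(1) v C(1) in auto)
    have both: False if x: "x \<in> M" "x' \<in> M" "E x x'" and "E v x" "E v x'" for x x'
    proof -
      have "x \<noteq> x'" using x(3) irr by auto
      have "E v w" if "w \<in> C" for w
      proof (cases "w = x \<or> w = x'")
        case True
        then show ?thesis using \<open>E v x\<close> \<open>E v x'\<close> by auto
      next
        case False
        then obtain w' where "w' \<in> C" "two_K2 E w w' x x'" using pair[OF x \<open>w \<in> C\<close>] by auto
        then show ?thesis
          using spread[OF x _ that, of w' x x' w] \<open>x \<noteq> x'\<close> \<open>E v x\<close> \<open>E v x'\<close> by simp
      qed
      then show False using incomplete by blast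
    qed
    have onlyM: "w = x" if x: "x \<in> M" "E v x" and w: "w \<in> C" "E v w" for x w
    proof (rule ccontr)
      assume "w \<noteq> x"
      obtain x' where x': "x' \<in> M" "E x x'" using mate[OF x(1)] by blast
      show False
      proof (cases "w = x'")
        case True
        then show False using both[OF x(1) x'] x(2) w(2) by simp
      next
        case False
        then obtain w' where "w' \<in> C" "two_K2 E w w' x x'" using pair[OF x(1) x' w(1) \<open>w \<noteq> x\<close>] by auto
        then have "E v x'" using spread[OF x(1) x' _ w(1), of w' x w x'] x(2) w(2) \<open>w \<noteq> x\<close> by simp
        then show False using both[OF x(1) x' x(2)] by simp
      qed
    qed
    have noM: False if x: "x \<in> M" "E v x" for x
    proof -
      obtain x' where x': "x' \<in> M" "E x x'" using mate[OF x(1)] by blast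
      have only: "w = x" if "w \<in> C" "E v w" for w using onlyM[OF x that] .
      \<comment> \<open>The neighbour x of v lies on a single edge. If the star has a second leaf, two paths
        with three vertices appear; otherwise x can serve as the centre of a larger star.\<close>
      have xx: "x \<noteq> x'" "E x' x" using x'(2) irr sym by auto
      have nzx: "z \<noteq> x" "z \<noteq> x'" "\<not> E v z" "\<not> E v x'"
        using M(2)[OF x(1)] M(2)[OF x'(1)] only[OF z] only[OF M(1)[OF x'(1)]] xx(1) by auto
      show False
      proof (cases "\<exists>y2\<in>C. y2 \<noteq> y \<and> E z y2")
        case True
        then obtain y2 where y2: "y2 \<in> C" "y2 \<noteq> y" "E z y2" by blast
        have ys: "w \<noteq> x" "w \<noteq> x'" "w \<noteq> z" "\<not> E v w"
          "\<not> E w v" if "w \<in> C" "E z w" for w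
          using M(3)[OF x(1)] M(3)[OF x'(1)] that irr only[OF that(1)] sym[of w v] by auto
        have "\<not> E y y2" using leaf[OF y y2(1)] ys(3)[OF y2(1,3)] by auto
        then show False
          using no_2P3[OF E hu, of y z y2 v x x'] y y2 ys[OF y] ys[OF y2(1,3)] nzx xx x(2) x'(2) v C(1) z
            M(1)[OF x(1)] M(1)[OF x'(1)] away[OF x(1) x' y(1)] away[OF x(1) x' y2(1)] away[OF x(1) x' z]
            vne sym[of y z] sym[of z v] sym[of y v] sym[of y2 v] by auto
      next
        case False
        have "\<exists>!u. u \<in> C \<and> E w u" if w: "w \<in> C" "w \<noteq> x" for w
        proof (cases "w = z")
          case True
          show ?thesis unfolding True using y False by (intro ex1I[of _ y]) auto
        next
          case False
          then show ?thesis using one w(1) by blast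
        qed
        then have "star_matching E (insert v C) x"
          by (intro star_matching_insert[OF E M(1)[OF x(1)] x(2) only _ z nzx(1) M(4)[OF x(1)]]) simp_all
        then show False using no_ext v by blast
      qed
    qed
    obtain x' where x': "x' \<in> M" "E x0 x'" using mate[OF x0] by blast
    have K: "two_K2 E z w x0 x'" if "w \<in> C" "E z w" for w
    proof -
      have "w \<noteq> x0" "w \<noteq> x'" using that(2) M(3)[OF x0] M(3)[OF x'(1)] by auto
      then show ?thesis
        using that away[OF x0 x' that(1)] away[OF x0 x' z] M(2)[OF x0] M(2)[OF x'(1)] x'(2)
        by (auto simp: two_K2_def)
    qed
    have nx: "\<not> E v x0" "\<not> E v x'" using noM x0 x'(1) by auto
    have adj: "w = z \<or> E z w" if "w \<in> C" "E v w" for w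
      using noM[of w] that by (auto simp: M_def)
    show False
    proof (cases "E v z")
      case True
      have only: "w = z" if "w \<in> C" "E v w" for w
      proof (rule ccontr)
        assume "w \<noteq> z"
        then have "E z w" using adj[OF that] by simp
        then have "E v x0"
          using spread[OF x0 x' K[OF that(1)] z that(1), of z w x0] \<open>w \<noteq> z\<close> that(2) True by simp
        then show False using nx(1) by simp
      qed
      have "star_matching E (insert v C) z"
        by (rule star_matching_insert[OF E z True only one M(1-3)[OF x0]])
      then show False using no_ext v by blast
    next
      case False
      \<comment> \<open>The only neighbours of v in C are leaves of the star.\<close>
      then have zu: "E z u" using adj[OF u] u(2) by auto
      have uz: "u \<noteq> z" using zu irr by auto
      have Ku: "two_K2 E z u x0 x'" using K[OF u(1) zu] .
      have du: "distinct [z, u, x0, x']" using two_K2_distinct[OF E Ku] .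
      show False
      proof (cases "\<exists>y2\<in>C. y2 \<noteq> u \<and> E z y2")
        case True
        then obtain y2 where y2: "y2 \<in> C" "y2 \<noteq> u" "E z y2" by blast
        have K2: "two_K2 E z y2 x0 x'" using K[OF y2(1,3)] .
        have d2: "distinct [z, y2, x0, x']" using two_K2_distinct[OF E K2] .
        have "\<not> E u y2" using leaf[OF u(1) zu y2(1)] d2 by auto
        have mem: "x0 \<in> V" "x' \<in> V" "z \<in> V" "u \<in> V" "y2 \<in> V"
          using M(1)[OF x0] M(1)[OF x'(1)] z u(1) y2(1) C(1) by auto
        have edges: "\<not> E x0 v" "\<not> E x' v" "\<not> E x0 u" "\<not> E x' u"
          "\<not> E x0 z" "\<not> E x' z" "\<not> E x0 y2" "\<not> E x' y2"
          "E u z" "E u v"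
          using nx Ku K2 zu u(2) sym unfolding two_K2_def by metis+
        have vn: "v \<noteq> x0" "v \<noteq> x'" "v \<noteq> z" "v \<noteq> u" "v \<noteq> y2"
          using vne M(1)[OF x0] M(1)[OF x'(1)] z u(1) y2(1) by auto
        show False
        proof (cases "E v y2")
          case True
          then show False
            using no_K2_C4[OF E hu, of x0 x' v u z y2] mem v(1) vn du d2 y2 edges x'(2) False u(2)
              \<open>\<not> E u y2\<close> by auto
        next
          case nvy: False
          then show False
            using no_K2_P4[OF E hu, of x0 x' v u z y2] mem v(1) vn du d2 y2 edges x'(2) False u(2)
              \<open>\<not> E u y2\<close> by auto
        qed
      next
        case single: False
        have only: "w = u" if "w \<in> C" "E v w" for w
          using adj[OF that] that False single by blast
        have "\<exists>!t. t \<in> C \<and> E w t" if w: "w \<in> C" "w \<noteq> u" for w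
        proof (cases "w = z")
          case True
          show ?thesis unfolding True using u(1) zu single by (intro ex1I[of _ u]) auto
        next
          case False
          then show ?thesis using one w(1) by blast
        qed
        moreover have "x0 \<noteq> u" "\<not> E u x0" using Ku du by (auto simp: two_K2_def)
        ultimately have "star_matching E (insert v C) u"
          by (intro star_matching_insert[OF E u only _ M(1)[OF x0]]) simp_all
        then show False using no_ext v by blast
      qed
    qed
  qed
  define D where "D = {v \<in> V - C. \<forall>w\<in>C. E v w}"
  define N where "N = {v \<in> V - C. \<forall>w\<in>C. \<not> E v w}"
  obtain x' where x': "x' \<in> M" "E x0 x'" using mate[OF x0] by blast
  have K: "two_K2 E z y x0 x'"
    using y away[OF x0 x' y(1)] away[OF x0 x' z] M(2,3)[OF x0] M(2,3)[OF x'(1)] x'(2)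
    unfolding two_K2_def by metis
  have mem: "z \<in> C" "y \<in> C" "x0 \<in> C"
    "x' \<in> C" using z y M(1)[OF x0] M(1)[OF x'(1)] by auto
  have "V = D \<union> N \<union> C" using split C(1) by (auto simp: D_def N_def)
  moreover have "decomp E D N C"
  proof (rule decompI)
    show "p \<noteq> q" if "p \<in> D" "q \<in> N" for p q using that mem(1) by (auto simp: D_def N_def)
    show "p \<noteq> q" if "p \<in> D" "q \<in> C" for p q using that by (auto simp: D_def)
    show "p \<noteq> q" if "p \<in> N" "q \<in> C" for p q using that by (auto simp: N_def)
    show "E p q" if "p \<in> D" "q \<in> C" for p q using that by (auto simp: D_def)
    show "\<not> E p q" if "p \<in> N" "q \<in> C" for p q using that by (auto simp: N_def)
    show "E p q" if "p \<in> D" "q \<in> D" "p \<noteq> q" for p q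
    proof (rule ccontr)
      assume "\<not> E p q"
      have pq: "p \<in> V" "q \<in> V" "p \<notin> C"
        "q \<notin> C" using that(1,2) by (auto simp: D_def)
      have adj: "E p z" "E p y" "E p x0" "E p x'" "E q z" "E q y" "E q x0" "E q x'"
        using that(1,2) mem by (auto simp: D_def)
      have neq: "p \<noteq> z" "p \<noteq> y" "p \<noteq> x0" "p \<noteq> x'" "q \<noteq> z"
        "q \<noteq> y" "q \<noteq> x0" "q \<noteq> x'"
        using pq(3,4) mem by auto
      have "{p, q, z, y, x0, x'} \<subseteq> V" using pq mem C(1) by auto
      moreover have "distinct [p, q, z, y, x0, x']"
        using two_K2_distinct[OF E K] neq that(3) by simp
      ultimately show False
        using no_co_K2_C4[OF E hu, of p q z y x0 x'] adj K \<open>\<not> E p q\<close> by (simp add: two_K2_def)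
    qed
    show "\<not> E p q" if "p \<in> N" "q \<in> N" for p q
    proof
      assume Epq: "E p q"
      have pq: "p \<in> V" "q \<in> V" "p \<notin> C" "q \<notin> C"
        "p \<noteq> q" using that Epq irr by (auto simp: N_def)
      have away': "\<not> E p w" "\<not> E q w" "\<not> E w p" "\<not> E w q" if "w \<in> C" for w
        using \<open>p \<in> N\<close> \<open>q \<in> N\<close> that sym[of w p] sym[of w q] by (auto simp: N_def)
      have "star_matching E (insert p (insert q C)) z"
        unfolding star_matching_def
      proof (intro conjI ballI impI)
        show "z \<in> insert p (insert q C)" using z by simp
        show "\<exists>y\<in>insert p (insert q C). E z y" using y by blast
        show "\<exists>u\<in>insert p (insert q C). u \<noteq> z \<and> \<not> E z u" using M[OF x0] by auto
        fix w assume w: "w \<in> insert p (insert q C)" "w \<noteq> z"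
        consider "w = p" | "w = q" | "w \<in> C" using w(1) by blast
        then show "\<exists>!u. u \<in> insert p (insert q C) \<and> E w u"
        proof cases
          case 1
          then show ?thesis using Epq away' irr by (intro ex1I[of _ q]) auto
        next
          case 2
          then show ?thesis using Epq away' irr sym by (intro ex1I[of _ p]) auto
        next
          case 3
          then show ?thesis using one[OF 3 w(2)] away'(3,4)[OF 3] by (simp only: Ex1_insert_iff simp_thms not_False_eq_True)
        qed
      qed
      moreover have "insert p (insert q C) \<subseteq> V" using pq C(1) by simp
      ultimately have "card (insert p (insert q C)) \<le> card C" using max by blast
      then show False using pq finC by simp
    qed
  qed
  ultimately show ?thesis using that C(2) by blast
qed

section \<open>Pentagons and split graphs\<close>

definition pentagon :: "('a \<Rightarrow> 'a \<Rightarrow> bool) \<Rightarrow> 'a \<Rightarrow> 'a \<Rightarrow> 'a \<Rightarrow> 'a \<Rightarrow> 'a \<Rightarrow> bool" where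
  "pentagon E p q r s t \<longleftrightarrow> E p q \<and> E q r \<and> E r s \<and> E s t \<and> E t p \<and>
     \<not> E p r \<and> \<not> E p s \<and> \<not> E q s \<and> \<not> E q t \<and> \<not> E r t"

lemma pentagon_rotate:
  assumes "sgraph E" "pentagon E p q r s t"
  shows "pentagon E q r s t p"
  using assms(2) sgraph_sym[OF assms(1), of p r] sgraph_sym[OF assms(1), of p s]
  by (simp add: pentagon_def)

text \<open>
  Without two independent edges and without induced four-cycles, a neighbour of one vertex of an
  induced pentagon is a neighbour of the next one, hence of all.
\<close>

lemma pentagon_decomp:
  assumes E: "sgraph E" and pent: "pentagon E p q r s t" and V: "{p, q, r, s, t} \<subseteq> V"
    and nK: "\<And>a b c d. {a, b, c, d} \<subseteq> V \<Longrightarrow> \<not> two_K2 E a b c d"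
    and nC: "\<And>a b c d. {a, b, c, d} \<subseteq> V \<Longrightarrow> \<not> two_K2 (co E) a b c d"
  obtains D N where "V = D \<union> N \<union> {p, q, r, s, t}" "decomp E D N {p, q, r, s, t}"
    "five_cycle E {p, q, r, s, t}"
proof -
  have sym: "E u v \<longleftrightarrow> E v u" for u v using sgraph_sym[OF E] .
  have irr: "\<not> E u u" for u using sgraph_irrefl[OF E] .
  have ed: "E p q" "E q r" "E r s" "E s t" "E t p" "\<not> E p r" "\<not> E p s" "\<not> E q s"
    "\<not> E q t" "\<not> E r t"
    using pent by (auto simp: pentagon_def)
  have de: "E q p" "E r q" "E s r" "E t s" "E p t" "\<not> E r p" "\<not> E s p" "\<not> E s q"
    "\<not> E t q" "\<not> E t r"
    using ed sym by metis+
  have dist: "p \<noteq> q" "p \<noteq> r" "p \<noteq> s" "p \<noteq> t" "q \<noteq> r"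
    "q \<noteq> s" "q \<noteq> t" "r \<noteq> s" "r \<noteq> t" "s \<noteq> t"
    using ed de irr by metis+
  let ?C = "{p, q, r, s, t}"
  have step: "E v b" if pt: "pentagon E a b c d e" and sub: "{a, b, c, d, e} \<subseteq> V"
    and v: "v \<in> V" "v \<notin> {a, b, c, d, e}" "E v a" for a b c d e v
  proof (rule ccontr)
    assume nb: "\<not> E v b"
    have e: "E a b" "E b c" "E c d" "E d e" "E e a" "\<not> E a c" "\<not> E a d" "\<not> E b d"
      "\<not> E b e" "\<not> E c e"
      using pt by (auto simp: pentagon_def)
    have e': "E b a" "E c b" "E d c" "E e d" "E a e" "\<not> E c a" "\<not> E d a" "\<not> E e b"
      "\<not> E e c"
      using e sym by metis+
    have dst: "a \<noteq> c" "a \<noteq> d" using e e' by metis+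
    have "\<not> E v c"
      using nC[of v b a c] v sub nb e e' dst by (auto simp: two_K2_def co_def)
    moreover have "E v c \<or> E v d"
      using nK[of v a c d] v sub e by (auto simp: two_K2_def)
    ultimately have vd: "E v d" by simp
    have "E v e"
      using nC[of v e a d] v sub vd e e' dst by (auto simp: two_K2_def co_def)
    then show False
      using nK[of v e b c] v sub nb \<open>\<not> E v c\<close> e e' by (auto simp: two_K2_def)
  qed
  have all: "E v p \<and> E v q \<and> E v r \<and> E v s \<and> E v t" if v: "v \<in> V - ?C" and "\<exists>w\<in>?C. E v w" for v
  proof -
    note r1 = pentagon_rotate[OF E pent]
    note r2 = pentagon_rotate[OF E r1]
    note r3 = pentagon_rotate[OF E r2]
    note r4 = pentagon_rotate[OF E r3]
    have "E v p \<Longrightarrow> E v q" using step[OF pent V] v by simp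
    moreover have "E v q \<Longrightarrow> E v r" using step[OF r1] V v by simp
    moreover have "E v r \<Longrightarrow> E v s" using step[OF r2] V v by simp
    moreover have "E v s \<Longrightarrow> E v t" using step[OF r3] V v by simp
    moreover have "E v t \<Longrightarrow> E v p" using step[OF r4] V v by simp
    ultimately show ?thesis using that(2) by blast
  qed
  define D where "D = {v \<in> V - ?C. E v p}"
  define N where "N = {v \<in> V - ?C. \<not> E v p}"
  have adjD: "E v w" if "v \<in> D" "w \<in> ?C" for v w using all[of v] that by (auto simp: D_def)
  have adjN: "\<not> E v w" if "v \<in> N" "w \<in> ?C" for v w using all[of v] that by (auto simp: N_def)
  have "decomp E D N ?C"
  proof (rule decompI)
    show "a \<noteq> b" if "a \<in> D" "b \<in> N" for a b using that by (auto simp: D_def N_def)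
    show "a \<noteq> b" if "a \<in> D" "b \<in> ?C" for a b using that by (auto simp: D_def)
    show "a \<noteq> b" if "a \<in> N" "b \<in> ?C" for a b using that by (auto simp: N_def)
    show "E a b" if "a \<in> D" "b \<in> ?C" for a b using adjD that .
    show "\<not> E a b" if "a \<in> N" "b \<in> ?C" for a b using adjN that .
    show "E a b" if "a \<in> D" "b \<in> D" "a \<noteq> b" for a b
    proof (rule ccontr)
      assume "\<not> E a b"
      moreover have "E a p" "E a r" "E b p" "E b r" using adjD that by auto
      ultimately have "two_K2 (co E) a b p r" using that(3) dist(2) ed(6) by (simp add: two_K2_def co_def)
      moreover have "{a, b, p, r} \<subseteq> V" using that V by (auto simp: D_def)
      ultimately show False using nC by blast
    qed
    show "\<not> E a b" if "a \<in> N" "b \<in> N" for a b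
    proof
      assume "E a b"
      moreover have "\<not> E a p" "\<not> E a q" "\<not> E b p" "\<not> E b q" using adjN that by auto
      ultimately have "two_K2 E a b p q" using ed(1) by (simp add: two_K2_def)
      moreover have "{a, b, p, q} \<subseteq> V" using that V by (auto simp: N_def)
      ultimately show False using nK by blast
    qed
  qed
  moreover have "V = D \<union> N \<union> ?C" using V by (auto simp: D_def N_def)
  moreover have "five_cycle E ?C"
    using dist ed de irr by (simp add: five_cycle_def deg_insert)
  ultimately show ?thesis using that by blast
qed

text \<open>
  This is the theorem of Foldes and Hammer.  Among the cliques of maximum size, \<open>A\<close> is chosen such
  that the fewest edges lie outside it.  If \<open>xy\<close> is an edge outside \<open>A\<close>, the non-neighbours of \<open>x\<close> and
  of \<open>y\<close> in \<open>A\<close> are nested, since otherwise there is an induced four-cycle.  The vertex \<open>x\<close> with fewer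
  non-neighbours has only one, \<open>u\<close>; exchanging \<open>u\<close> for \<open>x\<close> gives another maximum clique.  By the
  choice of \<open>A\<close>, the vertex \<open>u\<close> has a neighbour \<open>z\<close> outside \<open>A\<close> that \<open>x\<close> does not have, and one of the
  excluded subgraphs is found in \<open>x\<close>, \<open>y\<close>, \<open>z\<close>, \<open>u\<close> and a further non-neighbour \<open>w\<close> of \<open>y\<close>.
\<close>

lemma split_if_no_K2_C4_pentagon:
  assumes E: "sgraph E" and finV: "finite V"
    and nK: "\<And>a b c d. {a, b, c, d} \<subseteq> V \<Longrightarrow> \<not> two_K2 E a b c d"
    and nC: "\<And>a b c d. {a, b, c, d} \<subseteq> V \<Longrightarrow> \<not> two_K2 (co E) a b c d"
    and nP: "\<And>p q r s t. {p, q, r, s, t} \<subseteq> V \<Longrightarrow> \<not> pentagon E p q r s t"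
  obtains A B where "V = A \<union> B" "decomp E A B {}"
proof -
  have sym: "E u v \<longleftrightarrow> E v u" for u v using sgraph_sym[OF E] .
  have irr: "\<not> E u u" for u using sgraph_irrefl[OF E] .
  define clique where "clique A \<longleftrightarrow> A \<subseteq> V \<and> (\<forall>a\<in>A. \<forall>b\<in>A. a \<noteq> b \<longrightarrow> E a b)" for A
  \<comment> \<open>Twice the number of edges outside A.\<close>
  define m where "m A = (\<Sum>v\<in>V - A. deg E (V - A) v)" for A
  have "\<exists>A. clique A \<and> (\<forall>A'. clique A' \<longrightarrow> card A' \<le> card A)"
    using finV by (intro ex_has_greatest_nat[where k = "{}" and b = "Suc (card V)"])
      (auto simp: clique_def less_Suc_eq_le intro: card_mono)
  then obtain A1 where A1: "clique A1" "\<And>A'. clique A' \<Longrightarrow> card A' \<le> card A1" by blast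
  have "\<exists>A. (clique A \<and> card A = card A1) \<and> (\<forall>A'. clique A' \<and> card A' = card A1 \<longrightarrow> m A \<le> m A')"
    using A1(1) by (intro ex_has_least_nat[where k = A1]) simp
  then obtain A where A: "clique A" "card A = card A1"
    and min: "\<And>A'. clique A' \<Longrightarrow> card A' = card A1 \<Longrightarrow> m A \<le> m A'" by blast
  have max: "card A' \<le> card A" if "clique A'" for A' using A1(2)[OF that] A(2) by simp
  have AV: "A \<subseteq> V" and cl: "\<And>a b. a \<in> A \<Longrightarrow> b \<in> A \<Longrightarrow> a \<noteq> b \<Longrightarrow> E a b"
    using A(1) by (auto simp: clique_def)
  have finA: "finite A" using AV finV by (rule finite_subset)
  have non: "\<exists>a\<in>A. \<not> E x a" if "x \<in> V" "x \<notin> A" for x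
  proof (rule ccontr)
    assume "\<not> ?thesis"
    then have "\<forall>a\<in>A. E x a \<and> E a x" using sym by blast
    then have "clique (insert x A)" using that(1) AV cl by (auto simp: clique_def)
    then show False using max[of "insert x A"] that(2) finA by simp
  qed
  have core: False if x: "x \<in> V" "x \<notin> A" and y: "y \<in> V" "y \<notin> A" and xy: "E x y"
    and sub: "\<And>a. a \<in> A \<Longrightarrow> \<not> E x a \<Longrightarrow> \<not> E y a" for x y
  proof -
    obtain u where u: "u \<in> A" "\<not> E x u" using non[OF x] by blast
    have uV: "u \<in> V" and ux: "u \<noteq> x" "u \<noteq> y" using u(1) AV x y by auto
    have yu: "\<not> E y u" using sub[OF u] .
    have rev: "E y x" "\<not> E u x" "\<not> E u y" using xy u(2) yu sym by metis+
    have uniq: "E x a" if "a \<in> A" "a \<noteq> u" for a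
    proof (rule ccontr)
      assume "\<not> E x a"
      then have "two_K2 E x y u a" using xy u yu sub[OF that(1)] cl[OF u(1) that(1)] that(2)
        by (simp add: two_K2_def)
      then show False using nK[of x y u a] x y uV that(1) AV by auto
    qed
    have "\<exists>w\<in>A. w \<noteq> u \<and> \<not> E y w"
    proof (rule ccontr)
      assume "\<not> ?thesis"
      then have ya: "E y a" "E a y" if "a \<in> A" "a \<noteq> u" for a using that sym by blast+
      have xa: "E x a" "E a x" if "a \<in> A" "a \<noteq> u" for a using that uniq sym by blast+
      have "clique (insert x (insert y (A - {u})))"
        unfolding clique_def using x y AV cl xa ya xy rev(1) by (simp add: subset_iff)
      moreover have "card (insert x (insert y (A - {u}))) = card A + 1"
      proof -
        have "x \<noteq> y" using xy irr by auto
        then have "card (insert x (insert y (A - {u}))) = Suc (Suc (card (A - {u})))"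
          using x(2) y(2) finA by simp
        then show ?thesis using card_Suc_Diff1[OF finA u(1)] by simp
      qed
      ultimately show False using max[of "insert x (insert y (A - {u}))"] by simp
    qed
    then obtain w where w: "w \<in> A" "w \<noteq> u" "\<not> E y w" by blast
    have xw: "E x w" using uniq[OF w(1,2)] .
    have wV: "w \<in> V" using w(1) AV by auto
    define R where "R = V - A - {x}"
    have finR: "finite R" using finV by (simp add: R_def)
    let ?A' = "insert x (A - {u})"
    have xa: "E x a" "E a x" if "a \<in> A" "a \<noteq> u" for a using that uniq sym by blast+
    have "clique ?A'"
      unfolding clique_def using x(1) AV cl xa by (simp add: subset_iff)
    moreover have "card ?A' = card A1"
      using x(2) finA u(1) A(2) by (metis card_Suc_Diff1 card_insert_disjoint finite_Diff Diff_iff)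
    ultimately have "m A \<le> m ?A'" using min by blast
    moreover have "V - A = insert x R" "x \<notin> R" using x by (auto simp: R_def)
    moreover have "V - ?A' = insert u R" "u \<notin> R" using x u(1) uV by (auto simp: R_def)
    ultimately have degs: "deg E R x \<le> deg E R u"
      using sum_deg_insert[OF E finR, of x] sum_deg_insert[OF E finR, of u] by (simp add: m_def)
    have yR: "y \<in> R" using y xy irr by (auto simp: R_def)
    have "\<exists>z\<in>R. E u z \<and> \<not> E x z"
    proof (rule ccontr)
      assume "\<not> ?thesis"
      then have "{v \<in> R. E u v} \<subseteq> {v \<in> R. E x v}" by blast
      moreover have "y \<in> {v \<in> R. E x v}" "y \<notin> {v \<in> R. E u v}" using yR xy rev by auto
      ultimately have "{v \<in> R. E u v} \<subset> {v \<in> R. E x v}" by blast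
      then have "deg E R u < deg E R x" unfolding deg_def using finR by (intro psubset_card_mono) auto
      then show False using degs by simp
    qed
    then obtain z where z: "z \<in> V" "z \<notin> A" "E u z" "\<not> E x z" by (auto simp: R_def)
    have zu: "E z u" using z(3) sym by simp
    have yz: "E y z"
    proof (rule ccontr)
      assume "\<not> E y z"
      then have "two_K2 E x y u z" using xy z(3,4) u(2) yu by (simp add: two_K2_def)
      then show False using nK[of x y u z] x y uV z(1) by simp
    qed
    have zy: "E z y" using yz sym by simp
    have xz: "x \<noteq> z" "y \<noteq> w" using z(3) rev y(2) w(1) by auto
    show False
    proof (cases "E z w")
      case True
      then have "two_K2 (co E) x z y w"
        using z(4) xz w(3) xy xw zy by (simp add: two_K2_def co_def)
      then show False using nC[of x z y w] x y z wV by simp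
    next
      case False
      have "E w x" using xw sym by simp
      then have "pentagon E x y z u w"
        using xy yz zu cl[OF u(1) w(1)] w z(4) u(2) yu False by (simp add: pentagon_def)
      then show False using nP[of x y z u w] x y z uV wV by simp
    qed
  qed
  have indep: "\<not> E x y" if x: "x \<in> V" "x \<notin> A" and y: "y \<in> V" "y \<notin> A" for x y
  proof
    assume xy: "E x y"
    then have yx: "E y x" using sym by simp
    have "\<not> (\<forall>a\<in>A. \<not> E x a \<longrightarrow> \<not> E y a)" using core[OF x y xy] by blast
    then obtain u where u: "u \<in> A" "\<not> E x u" "E y u" by blast
    have "\<not> (\<forall>a\<in>A. \<not> E y a \<longrightarrow> \<not> E x a)" using core[OF y x yx] by blast
    then obtain w where w: "w \<in> A" "\<not> E y w" "E x w" by blast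
    have "u \<noteq> w" "x \<noteq> u" "y \<noteq> w" using u w x y by auto
    moreover have "E u y" "E u w" using u(3) sym cl[OF u(1) w(1)] \<open>u \<noteq> w\<close> by auto
    ultimately have "two_K2 (co E) x u y w" using u w xy by (simp add: two_K2_def co_def)
    then show False using nC[of x u y w] x y u w AV by auto
  qed
  have "decomp E A (V - A) {}"
    by (rule decompI) (use cl indep in auto)
  moreover have "V = A \<union> (V - A)" using AV by blast
  ultimately show ?thesis using that by blast
qed

text \<open>
  A four-cycle is a pair of independent edges in the complement, so the second case is the first one
  for the complement.
\<close>

theorem hereditarily_unique_structure:
  assumes E: "sgraph E" and finV: "finite V" and hu: "hereditarily_unique E V"
  obtains
    (matching) D N C z where "V = D \<union> N \<union> C" "decomp E D N C" "star_matching E C z"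
  | (co_matching) D N C z where "V = D \<union> N \<union> C" "decomp E D N C"
    "star_matching (co E) C z"
  | (cycle) D N C where "V = D \<union> N \<union> C" "decomp E D N C" "five_cycle E C"
  | (split) A B where "V = A \<union> B" "decomp E A B {}"
proof -
  consider a b c d where "{a, b, c, d} \<subseteq> V" "two_K2 E a b c d"
    | a b c d where "{a, b, c, d} \<subseteq> V" "two_K2 (co E) a b c d"
    | p q r s t where "{p, q, r, s, t} \<subseteq> V" "pentagon E p q r s t"
      "\<And>a b c d. {a, b, c, d} \<subseteq> V \<Longrightarrow> \<not> two_K2 E a b c d"
      "\<And>a b c d. {a, b, c, d} \<subseteq> V \<Longrightarrow> \<not> two_K2 (co E) a b c d"
    | "\<And>p q r s t. {p, q, r, s, t} \<subseteq> V \<Longrightarrow> \<not> pentagon E p q r s t"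
      "\<And>a b c d. {a, b, c, d} \<subseteq> V \<Longrightarrow> \<not> two_K2 E a b c d"
      "\<And>a b c d. {a, b, c, d} \<subseteq> V \<Longrightarrow> \<not> two_K2 (co E) a b c d"
    by metis
  then show ?thesis
  proof cases
    case 1
    then show ?thesis using two_K2_decomp[OF E finV hu] matching by metis
  next
    case 2
    obtain D N C z where d: "V = D \<union> N \<union> C" "decomp (co E) D N C"
      "star_matching (co E) C z"
      using two_K2_decomp[OF sgraph_co[OF E] finV hereditarily_unique_co[OF E finV hu] 2] by metis
    have "decomp E N D C" using decomp_co[OF d(2)] E by simp
    moreover have "V = N \<union> D \<union> C" using d(1) by blast
    ultimately show ?thesis using d(3) co_matching by blast
  next
    case 3
    then show ?thesis using pentagon_decomp[OF E 3(2,1,3,4)] cycle by metis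
  next
    case 4
    then show ?thesis using split_if_no_K2_C4_pentagon[OF E finV 4(2,3,1)] split by metis
  qed
qed

section \<open>Bipartite graphs without the forbidden patterns\<close>

text \<open>
  Only adjacency between the two sides matters from here on.  The first pattern is an induced path
  \<open>a2 b1 a1 b2\<close> with a disjoint edge \<open>a3 b3\<close>, the second consists of two disjoint paths with three
  vertices whose midpoints \<open>a1\<close>, \<open>b1\<close> lie on different sides.
\<close>

definition bip_P4_K2 where
  "bip_P4_K2 R a1 a2 a3 b1 b2 b3 \<longleftrightarrow> distinct [a1, a2, a3] \<and> distinct [b1, b2, b3] \<and>
     R a1 b1 \<and> R a1 b2 \<and> \<not> R a1 b3 \<and> R a2 b1 \<and> \<not> R a2 b2 \<and> \<not> R a2 b3 \<and>
     \<not> R a3 b1 \<and> \<not> R a3 b2 \<and> R a3 b3"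

definition bip_2P3 where
  "bip_2P3 R a1 a2 a3 b1 b2 b3 \<longleftrightarrow> distinct [a1, a2, a3] \<and> distinct [b1, b2, b3] \<and>
     \<not> R a1 b1 \<and> R a1 b2 \<and> R a1 b3 \<and> R a2 b1 \<and> \<not> R a2 b2 \<and> \<not> R a2 b3 \<and>
     R a3 b1 \<and> \<not> R a3 b2 \<and> \<not> R a3 b3"

definition bip_avoid where
  "bip_avoid R A B \<longleftrightarrow> (\<forall>a1\<in>A. \<forall>a2\<in>A. \<forall>a3\<in>A. \<forall>b1\<in>B. \<forall>b2\<in>B. \<forall>b3\<in>B.
     \<not> bip_P4_K2 R a1 a2 a3 b1 b2 b3 \<and> \<not> bip_2P3 R a1 a2 a3 b1 b2 b3)"

lemma bip_avoid_swap: "bip_avoid R A B \<Longrightarrow> bip_avoid (\<lambda>b a. R a b) B A"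
proof -
  have "bip_P4_K2 (\<lambda>b a. R a b) b1 b2 b3 a1 a2 a3 \<longleftrightarrow> bip_P4_K2 R a1 a2 a3 b1 b2 b3"
    "bip_2P3 (\<lambda>b a. R a b) b1 b2 b3 a1 a2 a3 \<longleftrightarrow> bip_2P3 R a1 a2 a3 b1 b2 b3" for a1 a2 a3 b1 b2 b3
    unfolding bip_P4_K2_def bip_2P3_def by argo+
  then show "bip_avoid R A B \<Longrightarrow> bip_avoid (\<lambda>b a. R a b) B A" by (simp add: bip_avoid_def)
qed

lemma bip_avoid_split:
  assumes E: "sgraph E" and hu: "hereditarily_unique E V" and AB: "A \<union> B \<subseteq> V" and dec: "decomp E A B {}"
  shows "bip_avoid E A B"
  unfolding bip_avoid_def
proof (intro ballI)
  fix a1 a2 a3 b1 b2 b3 assume mem: "a1 \<in> A" "a2 \<in> A" "a3 \<in> A" "b1 \<in> B"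
    "b2 \<in> B" "b3 \<in> B"
  have sub: "{a1, a2, a3, b1, b2, b3} \<subseteq> V" using AB mem by auto
  have ne: "a \<noteq> b" if "a \<in> A" "b \<in> B" for a b using decompD(4)[OF dec that] .
  have neq: "a1 \<noteq> b1" "a1 \<noteq> b2" "a1 \<noteq> b3" "a2 \<noteq> b1" "a2 \<noteq> b2"
    "a2 \<noteq> b3" "a3 \<noteq> b1" "a3 \<noteq> b2" "a3 \<noteq> b3"
    using ne mem by simp_all
  have ind: "\<not> E b1 b2" "\<not> E b1 b3" "\<not> E b2 b3" using decompD(8)[OF dec] mem by simp_all
  have cl: "E a1 a2" "E a1 a3" "E a2 a3" if "distinct [a1, a2, a3]"
    using decompD(7)[OF dec] mem that by simp_all
  show "\<not> bip_P4_K2 E a1 a2 a3 b1 b2 b3 \<and> \<not> bip_2P3 E a1 a2 a3 b1 b2 b3"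
  proof (intro conjI notI)
    assume "bip_P4_K2 E a1 a2 a3 b1 b2 b3"
    note f = this[unfolded bip_P4_K2_def]
    show False by (rule no_split_P4_K2[OF E hu sub]) (use f ind cl neq in simp_all)
  next
    assume "bip_2P3 E a1 a2 a3 b1 b2 b3"
    note f = this[unfolded bip_2P3_def]
    show False by (rule no_split_2P3[OF E hu sub]) (use f ind cl neq in simp_all)
  qed
qed

text \<open>
  The patterns of the bipartite complement are excluded as well.  These are a path with six vertices
  and a four-cycle with a disjoint edge.
\<close>

definition bip_free where
  "bip_free R A B \<longleftrightarrow> bip_avoid R A B \<and> bip_avoid (\<lambda>a b. \<not> R a b) A B"

lemma bip_free_not: "bip_free R A B \<Longrightarrow> bip_free (\<lambda>a b. \<not> R a b) A B"
  by (simp add: bip_free_def)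

lemma bip_free_swap: "bip_free R A B \<Longrightarrow> bip_free (\<lambda>b a. R a b) B A"
  unfolding bip_free_def by (auto dest: bip_avoid_swap)

lemma bip_free_split:
  assumes E: "sgraph E" and V: "finite V" and hu: "hereditarily_unique E V" and AB: "A \<union> B \<subseteq> V" and dec: "decomp E A B {}"
  shows "bip_free E A B"
proof -
  have "bip_avoid (co E) B A"
    using bip_avoid_split[OF sgraph_co[OF E] hereditarily_unique_co[OF E V hu]] decomp_co[OF dec E] AB by (simp add: Un_commute)
  then have "bip_avoid (\<lambda>a b. co E b a) A B" by (rule bip_avoid_swap)
  moreover have "co E b a \<longleftrightarrow> \<not> E a b" if "a \<in> A" "b \<in> B" for a b
    using decompD(4)[OF dec that] sgraph_sym[OF E, of a b] by (auto simp: co_def)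
  ultimately have "bip_avoid (\<lambda>a b. \<not> E a b) A B"
    unfolding bip_avoid_def bip_P4_K2_def bip_2P3_def by simp
  then show ?thesis using bip_avoid_split[OF E hu AB dec] by (simp add: bip_free_def)
qed

text \<open>
  In contrast to \<open>stars\<close>, every centre has a leaf and there are at least two stars.
\<close>

definition bip_stars where
  "bip_stars R A B \<longleftrightarrow> (\<forall>b\<in>B. \<exists>!a. a \<in> A \<and> R a b) \<and> (\<forall>a\<in>A. \<exists>b\<in>B. R a b) \<and>
     (\<exists>a\<in>A. \<exists>a'\<in>A. a \<noteq> a')"

definition bip_star_type where
  "bip_star_type R A B \<longleftrightarrow> bip_stars R A B \<or> bip_stars (\<lambda>a b. \<not> R a b) A B \<or>
     bip_stars (\<lambda>b a. R a b) B A \<or> bip_stars (\<lambda>b a. \<not> R a b) B A"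

lemma bip_star_type_not: "bip_star_type (\<lambda>a b. \<not> R a b) A B \<longleftrightarrow> bip_star_type R A B"
  by (auto simp: bip_star_type_def)

lemma bip_star_type_swap: "bip_star_type (\<lambda>b a. R a b) B A \<longleftrightarrow> bip_star_type R A B"
  by (auto simp: bip_star_type_def)

text \<open>
  Every vertex outside \<open>A0\<close>, \<open>B0\<close> sees all or nothing of the opposite part.  The last two clauses
  say that two outer vertices which both see everything are adjacent and that two which both see
  nothing are not.  The outer vertices can then be placed before and after \<open>(A0, B0)\<close> in a
  decomposition.  The notion is symmetric under exchanging the sides and under complement.
\<close>

definition homogeneous where
  "homogeneous R A B A0 B0 \<longleftrightarrow>
     (\<forall>a\<in>A - A0. (\<forall>b\<in>B0. R a b) \<or> (\<forall>b\<in>B0. \<not> R a b)) \<and>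
     (\<forall>b\<in>B - B0. (\<forall>a\<in>A0. R a b) \<or> (\<forall>a\<in>A0. \<not> R a b)) \<and>
     (\<forall>a\<in>A - A0. \<forall>b\<in>B - B0. (\<forall>b'\<in>B0. R a b') \<longrightarrow> (\<forall>a'\<in>A0. R a' b) \<longrightarrow> R a b) \<and>
     (\<forall>a\<in>A - A0. \<forall>b\<in>B - B0. (\<forall>b'\<in>B0. \<not> R a b') \<longrightarrow> (\<forall>a'\<in>A0. \<not> R a' b) \<longrightarrow> \<not> R a b)"

lemma homogeneousI:
  assumes "\<And>a. a \<in> A - A0 \<Longrightarrow> (\<forall>b\<in>B0. R a b) \<or> (\<forall>b\<in>B0. \<not> R a b)"
    and "\<And>b. b \<in> B - B0 \<Longrightarrow> (\<forall>a\<in>A0. R a b) \<or> (\<forall>a\<in>A0. \<not> R a b)"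
    and "\<And>a b. a \<in> A - A0 \<Longrightarrow> b \<in> B - B0 \<Longrightarrow> \<forall>b'\<in>B0. R a b' \<Longrightarrow> \<forall>a'\<in>A0. R a' b \<Longrightarrow> R a b"
    and "\<And>a b. a \<in> A - A0 \<Longrightarrow> b \<in> B - B0 \<Longrightarrow> \<forall>b'\<in>B0. \<not> R a b' \<Longrightarrow> \<forall>a'\<in>A0. \<not> R a' b \<Longrightarrow> \<not> R a b"
  shows "homogeneous R A B A0 B0"
  unfolding homogeneous_def by (intro conjI ballI impI; (rule assms; assumption))

lemma homogeneousD:
  assumes h: "homogeneous R A B A0 B0"
  shows "a \<in> A - A0 \<Longrightarrow> (\<forall>b\<in>B0. R a b) \<or> (\<forall>b\<in>B0. \<not> R a b)"
    and "b \<in> B - B0 \<Longrightarrow> (\<forall>a\<in>A0. R a b) \<or> (\<forall>a\<in>A0. \<not> R a b)"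
    and "a \<in> A - A0 \<Longrightarrow> b \<in> B - B0 \<Longrightarrow> \<forall>b'\<in>B0. R a b' \<Longrightarrow> \<forall>a'\<in>A0. R a' b \<Longrightarrow> R a b"
    and "a \<in> A - A0 \<Longrightarrow> b \<in> B - B0 \<Longrightarrow> \<forall>b'\<in>B0. \<not> R a b' \<Longrightarrow> \<forall>a'\<in>A0. \<not> R a' b \<Longrightarrow> \<not> R a b"
proof -
  note h = h[unfolded homogeneous_def]
  note h1 = h[THEN conjunct1] and h2 = h[THEN conjunct2, THEN conjunct1]
    and h3 = h[THEN conjunct2, THEN conjunct2, THEN conjunct1]
    and h4 = h[THEN conjunct2, THEN conjunct2, THEN conjunct2]
  show "a \<in> A - A0 \<Longrightarrow> (\<forall>b\<in>B0. R a b) \<or> (\<forall>b\<in>B0. \<not> R a b)" by (rule bspec[OF h1])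
  show "b \<in> B - B0 \<Longrightarrow> (\<forall>a\<in>A0. R a b) \<or> (\<forall>a\<in>A0. \<not> R a b)" by (rule bspec[OF h2])
  show "a \<in> A - A0 \<Longrightarrow> b \<in> B - B0 \<Longrightarrow> \<forall>b'\<in>B0. R a b' \<Longrightarrow> \<forall>a'\<in>A0. R a' b \<Longrightarrow> R a b"
    by (rule bspec[OF bspec[OF h3], THEN mp, THEN mp])
  show "a \<in> A - A0 \<Longrightarrow> b \<in> B - B0 \<Longrightarrow> \<forall>b'\<in>B0. \<not> R a b' \<Longrightarrow> \<forall>a'\<in>A0. \<not> R a' b \<Longrightarrow> \<not> R a b"
    by (rule bspec[OF bspec[OF h4], THEN mp, THEN mp])
qed

lemma homogeneous_not:
  assumes "homogeneous (\<lambda>a b. \<not> R a b) A B A0 B0"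
  shows "homogeneous R A B A0 B0"
proof (rule homogeneousI)
  note h = homogeneousD[OF assms, unfolded not_not]
  show "(\<forall>b\<in>B0. R a b) \<or> (\<forall>b\<in>B0. \<not> R a b)" if "a \<in> A - A0" for a using h(1)[OF that] by (rule disj_commute[THEN iffD1])
  show "(\<forall>a\<in>A0. R a b) \<or> (\<forall>a\<in>A0. \<not> R a b)" if "b \<in> B - B0" for b using h(2)[OF that] by (rule disj_commute[THEN iffD1])
  show "R a b" if "a \<in> A - A0" "b \<in> B - B0" "\<forall>b'\<in>B0. R a b'"
    "\<forall>a'\<in>A0. R a' b" for a b
    using h(4)[OF that] .
  show "\<not> R a b" if "a \<in> A - A0" "b \<in> B - B0" "\<forall>b'\<in>B0. \<not> R a b'"
    "\<forall>a'\<in>A0. \<not> R a' b" for a b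
    using h(3)[OF that] .
qed

lemma homogeneous_swap:
  assumes "homogeneous (\<lambda>b a. R a b) B A B0 A0"
  shows "homogeneous R A B A0 B0"
proof (rule homogeneousI)
  note h = homogeneousD[OF assms]
  show "(\<forall>b\<in>B0. R a b) \<or> (\<forall>b\<in>B0. \<not> R a b)" if "a \<in> A - A0" for a using h(2)[OF that] .
  show "(\<forall>a\<in>A0. R a b) \<or> (\<forall>a\<in>A0. \<not> R a b)" if "b \<in> B - B0" for b using h(1)[OF that] .
  show "R a b" if "a \<in> A - A0" "b \<in> B - B0" "\<forall>b'\<in>B0. R a b'"
    "\<forall>a'\<in>A0. R a' b" for a b
    using h(3)[OF that(2,1,4,3)] .
  show "\<not> R a b" if "a \<in> A - A0" "b \<in> B - B0" "\<forall>b'\<in>B0. \<not> R a b'"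
    "\<forall>a'\<in>A0. \<not> R a' b" for a b
    using h(4)[OF that(2,1,4,3)] .
qed

text \<open>
  Every deviation from homogeneity yields a forbidden pattern or a larger configuration.  Maximality
  is required over all four star types because the enlarged configuration may be of a different type:
  if all stars are single edges, a second neighbour of a leaf turns them into stars with centres in
  \<open>B\<close>, and two stars are at the same time the complement of two stars.
\<close>

lemma maximal_stars_homogeneous:
  fixes R :: "'a \<Rightarrow> 'a \<Rightarrow> bool"
  assumes free: "bip_free R A B" and sub: "A0 \<subseteq> A"
    "B0 \<subseteq> B" and fin: "finite A" "finite B"
    and st: "bip_stars R A0 B0"
    and max: "\<And>A1 B1. A1 \<subseteq> A \<Longrightarrow> B1 \<subseteq> B \<Longrightarrow> bip_star_type R A1 B1 \<Longrightarrow>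
      card A1 + card B1 \<le> card A0 + card B0"
  shows "homogeneous R A B A0 B0"
proof -
  have fin0: "finite A0" "finite B0" using sub fin by (auto intro: finite_subset)
  have noP: "\<not> bip_P4_K2 R a1 a2 a3 b1 b2 b3" "\<not> bip_2P3 R a1 a2 a3 b1 b2 b3"
    "\<not> bip_P4_K2 (\<lambda>a b. \<not> R a b) a1 a2 a3 b1 b2 b3" "\<not> bip_2P3 (\<lambda>a b. \<not> R a b) a1 a2 a3 b1 b2 b3"
    if "a1 \<in> A" "a2 \<in> A" "a3 \<in> A" "b1 \<in> B" "b2 \<in> B"
      "b3 \<in> B" for a1 a2 a3 b1 b2 b3
    using free that unfolding bip_free_def bip_avoid_def by simp_all
  define p where "p b = (THE a. a \<in> A0 \<and> R a b)" for b
  have ex1: "\<exists>!a. a \<in> A0 \<and> R a b" if "b \<in> B0" for b using st that by (simp add: bip_stars_def)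
  have p: "p b \<in> A0" "R (p b) b" if "b \<in> B0" for b using theI'[OF ex1[OF that]] by (simp_all add: p_def)
  have Rp: "R a b \<longleftrightarrow> a = p b" if "b \<in> B0" "a \<in> A0" for a b
    using ex1[OF that(1)] p[OF that(1)] that(2) by blast
  have leaf: "\<exists>b\<in>B0. p b = a" if a: "a \<in> A0" for a
  proof -
    obtain b where "b \<in> B0" "R a b" using st a unfolding bip_stars_def by blast
    then show ?thesis using Rp[of b a] a by auto
  qed
  obtain c1 c2 where c: "c1 \<in> A0" "c2 \<in> A0"
    "c1 \<noteq> c2" using st unfolding bip_stars_def by blast
  have memA: "a \<in> A" if "a \<in> A0" for a using that sub by auto
  have memB: "b \<in> B" if "b \<in> B0" for b using that sub by auto
  have part1: "(\<forall>b\<in>B0. R a b) \<or> (\<forall>b\<in>B0. \<not> R a b)" if a: "a \<in> A - A0" for a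
  proof (rule ccontr)
    assume neg: "\<not> ?thesis"
    then obtain b b' where bb: "b \<in> B0" "R a b" "b' \<in> B0" "\<not> R a b'" by blast
    \<comment> \<open>A neighbour and a non-neighbour of a can be found in different stars: if they share a
      star, any leaf of another star replaces one of them.\<close>
    have "\<exists>b1\<in>B0. \<exists>b2\<in>B0. R a b1 \<and> \<not> R a b2 \<and> p b1 \<noteq> p b2"
    proof (cases "p b = p b'")
      case True
      obtain a3 where "a3 \<in> A0" "a3 \<noteq> p b" using c by metis
      then obtain b3 where "b3 \<in> B0" "p b3 \<noteq> p b" using leaf by metis
      then show ?thesis using bb True by metis
    next
      case False
      then show ?thesis using bb by blast
    qed
    then obtain b1 b2 where b12: "b1 \<in> B0" "b2 \<in> B0" "R a b1" "\<not> R a b2"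
      "p b1 \<noteq> p b2" by blast
    let ?a1 = "p b1" and ?a2 = "p b2"
    have a12: "?a1 \<in> A0" "?a2 \<in> A0" "a \<noteq> ?a1" "a \<noteq> ?a2" "a \<in> A"
      "a \<notin> A0" using p b12 a by auto
    have bne: "b1 \<noteq> b2" using b12 by auto
    have s1: "d = b1" if d: "d \<in> B0" "p d = ?a1" for d
    proof (rule ccontr)
      assume db: "d \<noteq> b1"
      have dne: "d \<noteq> b2" using d b12(5) by auto
      have R: "R ?a1 b1" "R ?a1 d" "\<not> R ?a1 b2" "R ?a2 b2" "\<not> R ?a2 b1" "\<not> R ?a2 d"
        using Rp a12 b12 d by auto
      show False
      proof (cases "R a d")
        case True
        then have "bip_2P3 (\<lambda>a b. \<not> R a b) ?a2 a ?a1 b2 b1 d"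
          using R b12 a12 db dne bne by (simp add: bip_2P3_def)
        then show False using noP(4)[of ?a2 a ?a1 b2 b1 d] memA memB a12 b12 d by simp
      next
        case False
        then have "bip_P4_K2 R ?a1 a ?a2 b1 d b2"
          using R b12 a12 db dne bne by (simp add: bip_P4_K2_def)
        then show False using noP(1)[of ?a1 a ?a2 b1 d b2] memA memB a12 b12 d by simp
      qed
    qed
    have only: "\<not> R a d" if d: "d \<in> B0" "d \<noteq> b1" for d
    proof
      assume Rad: "R a d"
      have pd: "p d \<noteq> ?a1" using s1 d by blast
      have dne: "d \<noteq> b2" using Rad b12 by auto
      show False
      proof (cases "p d = ?a2")
        case True
        have "R ?a1 b1" "\<not> R ?a1 b2" "\<not> R ?a1 d" "R ?a2 b2" "R ?a2 d" "\<not> R ?a2 b1"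
          using Rp a12 b12 d True by auto
        then have "bip_P4_K2 (\<lambda>a b. \<not> R a b) ?a1 a ?a2 b2 d b1"
          using Rad b12 a12 d(2) dne bne by (simp add: bip_P4_K2_def)
        then show False using noP(3)[of ?a1 a ?a2 b2 d b1] memA memB a12 b12 d by simp
      next
        case False
        have "R ?a1 b1" "\<not> R ?a1 b2" "\<not> R ?a1 d" "R ?a2 b2" "\<not> R ?a2 d" "\<not> R ?a2 b1"
          using Rp a12 b12 d False pd by auto
        then have "bip_P4_K2 R a ?a1 ?a2 b1 d b2"
          using Rad b12 a12 d(2) dne bne by (simp add: bip_P4_K2_def)
        then show False using noP(1)[of a ?a1 ?a2 b1 d b2] memA memB a12 b12 d by simp
      qed
    qed
    \<comment> \<open>So b1 is the only neighbour of a in B0. It remains to see that all stars are single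
      edges; then a is a second leaf at b1, for stars with centres in B0.\<close>
    have inj: "d = d'" if d: "d \<in> B0" "d' \<in> B0" "p d = p d'" for d d'
    proof (rule ccontr)
      assume dd: "d \<noteq> d'"
      have ne: "d \<noteq> b1" "d' \<noteq> b1" using s1 d dd by metis+
      then have pd: "p d \<noteq> ?a1" using s1 d by blast
      have "\<not> R (p d) b1" "R (p d) d" "R (p d) d'" "\<not> R a d" "\<not> R a d'" "R ?a1 b1"
        "\<not> R ?a1 d" "\<not> R ?a1 d'"
        using Rp p a12 b12 d only ne pd by auto
      then have "bip_2P3 R (p d) a ?a1 b1 d d'"
        using b12 a12 dd ne pd p(1)[OF d(1)] by (auto simp: bip_2P3_def)
      then show False using noP(2)[of "p d" a ?a1 b1 d d'] memA memB a12 b12 d p(1)[OF d(1)] by simp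
    qed
    have "bip_stars (\<lambda>b a. R a b) B0 (insert a A0)"
      unfolding bip_stars_def
    proof (intro conjI ballI)
      fix x assume x: "x \<in> insert a A0"
      show "\<exists>!b. b \<in> B0 \<and> R x b"
      proof (cases "x = a")
        case True
        show ?thesis unfolding True using b12(1,3) only by blast
      next
        case False
        then have xA: "x \<in> A0" using x by simp
        obtain d where d: "d \<in> B0" "p d = x" using leaf[OF xA] by blast
        show ?thesis
        proof (rule ex1I[of _ d])
          show "d \<in> B0 \<and> R x d" using d p(2) by auto
          show "d' = d" if "d' \<in> B0 \<and> R x d'" for d'
            using inj[of d' d] that d Rp[of d' x] xA by metis
        qed
      qed
    next
      fix b assume "b \<in> B0"
      then show "\<exists>x\<in>insert a A0. R x b" using p by blast
    next
      show "\<exists>b\<in>B0. \<exists>b'\<in>B0. b \<noteq> b'" using b12 bne by blast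
    qed
    then have "bip_star_type R (insert a A0) B0" by (simp add: bip_star_type_def)
    then have "card (insert a A0) + card B0 \<le> card A0 + card B0" 
      using max[of "insert a A0" B0] sub a by simp
    then show False using a fin0 by simp
  qed
  have part2: "(\<forall>a\<in>A0. R a b) \<or> (\<forall>a\<in>A0. \<not> R a b)" if b: "b \<in> B - B0" for b
  proof (rule ccontr)
    assume neg: "\<not> ?thesis"
    then obtain a1 a2 where a12: "a1 \<in> A0" "R a1 b" "a2 \<in> A0" "\<not> R a2 b" by blast
    obtain b1 where b1: "b1 \<in> B0" "p b1 = a1" using leaf[OF a12(1)] by blast
    obtain b2 where b2: "b2 \<in> B0" "p b2 = a2" using leaf[OF a12(3)] by blast
    have ne: "a1 \<noteq> a2" "b \<noteq> b1" "b \<noteq> b2" "b1 \<noteq> b2" using a12 b1 b2 b by auto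
    have only: "a3 = a1" if a3: "a3 \<in> A0" "R a3 b" for a3
    proof (rule ccontr)
      assume n3: "a3 \<noteq> a1"
      have n32: "a3 \<noteq> a2" using a3 a12 by auto
      have "R a1 b1" "\<not> R a1 b2" "\<not> R a3 b1" "\<not> R a3 b2" "\<not> R a2 b1" "R a2 b2"
        using Rp b1 b2 a12 a3 ne n3 n32 by auto
      then have "bip_P4_K2 R a1 a3 a2 b b1 b2" using a12 a3 ne n3 n32 by (simp add: bip_P4_K2_def)
      then show False using noP(1)[of a1 a3 a2 b b1 b2] memA memB a12 a3 b1 b2 b by simp
    qed
    have "bip_stars R A0 (insert b B0)"
      unfolding bip_stars_def
    proof (intro conjI ballI)
      fix x assume x: "x \<in> insert b B0"
      show "\<exists>!a. a \<in> A0 \<and> R a x"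
      proof (cases "x = b")
        case True
        show ?thesis unfolding True using a12(1,2) only by blast
      next
        case False
        then show ?thesis using x ex1 by blast
      qed
    next
      fix a assume "a \<in> A0"
      then show "\<exists>x\<in>insert b B0. R a x" using leaf p by blast
    next
      show "\<exists>a\<in>A0. \<exists>a'\<in>A0. a \<noteq> a'" using c by blast
    qed
    then have "bip_star_type R A0 (insert b B0)" by (simp add: bip_star_type_def)
    then have "card A0 + card (insert b B0) \<le> card A0 + card B0" 
      using max[of A0 "insert b B0"] sub b by simp
    then show False using b fin0 by simp
  qed
  have grow: False if "bip_star_type R (insert a A0) (insert b B0)" "a \<in> A - A0"
    "b \<in> B - B0" for a b
  proof -
    have "card (insert a A0) + card (insert b B0) \<le> card A0 + card B0"
      using max[of "insert a A0" "insert b B0"] that sub by simp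
    then show False using that(2,3) fin0 by simp
  qed
  have part3: "R a b" if a: "a \<in> A - A0" and b: "b \<in> B - B0"
    and full: "\<forall>b'\<in>B0. R a b'" "\<forall>a'\<in>A0. R a' b" for a b
  proof (rule ccontr)
    assume nR: "\<not> R a b"
    show False
    proof (cases "\<exists>c3\<in>A0. c3 \<noteq> c1 \<and> c3 \<noteq> c2")
      case True
      then obtain c3 where c3: "c3 \<in> A0" "c3 \<noteq> c1" "c3 \<noteq> c2" by blast
      obtain b1 where b1: "b1 \<in> B0" "p b1 = c1" using leaf[OF c(1)] by blast
      obtain b3 where b3: "b3 \<in> B0" "p b3 = c3" using leaf[OF c3(1)] by blast
      have "\<not> R c2 b3" "\<not> R c2 b1" "\<not> R c1 b3" "R c1 b1" using Rp b1 b3 c c3 by auto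
      moreover have "a \<noteq> c1" "a \<noteq> c2" "b1 \<noteq> b3" "b \<noteq> b1"
        "b \<noteq> b3" using a b c b1 b3 c3 by auto
      ultimately have "bip_P4_K2 (\<lambda>a b. \<not> R a b) c2 c1 a b3 b1 b"
        using full nR c b1(1) b3(1) by (simp add: bip_P4_K2_def)
      then show False using noP(3)[of c2 c1 a b3 b1 b] memA memB a b c b1(1) b3(1) by simp
    next
      case False
      \<comment> \<open>With exactly two stars, a and b extend the complementary star forest.\<close>
      then have A0: "A0 = {c1, c2}" using c by blast
      have an: "a \<noteq> c1" "a \<noteq> c2" using a c by auto
      have "bip_stars (\<lambda>a b. \<not> R a b) (insert a A0) (insert b B0)"
        unfolding bip_stars_def
      proof (intro conjI ballI)
        fix x assume x: "x \<in> insert b B0"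
        show "\<exists>!y. y \<in> insert a A0 \<and> \<not> R y x"
        proof (cases "x = b")
          case True
          show ?thesis unfolding True using nR full(2) by blast
        next
          case False
          then have xB: "x \<in> B0" using x by simp
          have "R a x" using full(1) xB by simp
          moreover have "R c1 x \<longleftrightarrow> \<not> R c2 x" using Rp[OF xB] p[OF xB] c A0 by auto
          ultimately show ?thesis unfolding A0 using c(3) by (cases "R c1 x") auto
        qed
      next
        fix y assume y: "y \<in> insert a A0"
        show "\<exists>x\<in>insert b B0. \<not> R y x"
        proof (cases "y = a")
          case True
          then show ?thesis using nR by blast
        next
          case False
          then have yA: "y \<in> A0" using y by simp
          obtain y' where y': "y' \<in> A0" "y' \<noteq> y" using c by metis
          obtain d where "d \<in> B0" "p d = y'" using leaf[OF y'(1)] by blast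
          then show ?thesis using Rp[of d y] yA y'(2) by blast
        qed
      next
        show "\<exists>y\<in>insert a A0. \<exists>y'\<in>insert a A0. y \<noteq> y'" using c by blast
      qed
      then show False using grow[of a b] a b by (simp add: bip_star_type_def)
    qed
  qed
  have part4: "\<not> R a b" if a: "a \<in> A - A0" and b: "b \<in> B - B0"
    and none: "\<forall>b'\<in>B0. \<not> R a b'" "\<forall>a'\<in>A0. \<not> R a' b" for a b
  proof
    assume Rab: "R a b"
    have "bip_stars R (insert a A0) (insert b B0)"
      unfolding bip_stars_def
    proof (intro conjI ballI)
      fix x assume x: "x \<in> insert b B0"
      show "\<exists>!y. y \<in> insert a A0 \<and> R y x"
      proof (cases "x = b")
        case True
        show ?thesis unfolding True using Rab none(2) by blast
      next
        case False
        then have xB: "x \<in> B0" using x by simp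
        then have "\<not> R a x" using none(1) by simp
        then show ?thesis using ex1[OF xB] by blast
      qed
    next
      fix y assume y: "y \<in> insert a A0"
      show "\<exists>x\<in>insert b B0. R y x" using y Rab leaf p by blast
    next
      show "\<exists>y\<in>insert a A0. \<exists>y'\<in>insert a A0. y \<noteq> y'" using c by blast
    qed
    then show False using grow[of a b] a b by (simp add: bip_star_type_def)
  qed
  show ?thesis by (rule homogeneousI[OF part1 part2 part3 part4])
qed

lemma bip_homogeneous_core:
  fixes R :: "'a \<Rightarrow> 'a \<Rightarrow> bool"
  assumes free: "bip_free R A B" and fin: "finite A" "finite B"
    and K: "a1 \<in> A" "a2 \<in> A" "b1 \<in> B" "b2 \<in> B" "R a1 b1" "\<not> R a1 b2"
      "R a2 b2" "\<not> R a2 b1"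
  obtains A0 B0 where "A0 \<subseteq> A" "B0 \<subseteq> B" "bip_star_type R A0 B0"
    "homogeneous R A B A0 B0"
proof -
  have "bip_stars R {a1, a2} {b1, b2}"
  proof -
    have u1: "\<exists>!a. a \<in> {a1, a2} \<and> R a b1" using K by (intro ex1I[of _ a1]) auto
    have u2: "\<exists>!a. a \<in> {a1, a2} \<and> R a b2" using K by (intro ex1I[of _ a2]) auto
    show ?thesis
      unfolding bip_stars_def
    proof (intro conjI ballI)
      fix b assume "b \<in> {b1, b2}"
      then consider "b = b1" | "b = b2" by blast
      then show "\<exists>!a. a \<in> {a1, a2} \<and> R a b" by cases (simp_all only: u1 u2)
    next
      fix a assume "a \<in> {a1, a2}"
      then show "\<exists>b\<in>{b1, b2}. R a b" using K by auto
    next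
      have "a1 \<noteq> a2" using K by auto
      then show "\<exists>a\<in>{a1, a2}. \<exists>a'\<in>{a1, a2}. a \<noteq> a'" by blast
    qed
  qed
  then have K0: "bip_star_type R {a1, a2} {b1, b2}" by (simp add: bip_star_type_def)
  have "\<exists>P. (fst P \<subseteq> A \<and> snd P \<subseteq> B \<and> bip_star_type R (fst P) (snd P)) \<and>
    (\<forall>Q. fst Q \<subseteq> A \<and> snd Q \<subseteq> B \<and> bip_star_type R (fst Q) (snd Q) \<longrightarrow>
      card (fst Q) + card (snd Q) \<le> card (fst P) + card (snd P))"
  proof (rule ex_has_greatest_nat[where k = "({a1, a2}, {b1, b2})" and b = "Suc (card A + card B)"])
    show "\<forall>Q. fst Q \<subseteq> A \<and> snd Q \<subseteq> B \<and> bip_star_type R (fst Q) (snd Q) \<longrightarrow>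
      card (fst Q) + card (snd Q) < Suc (card A + card B)"
      using fin by (auto simp: less_Suc_eq_le intro!: add_mono card_mono)
  qed (use K K0 in simp)
  then obtain A0 B0 where 0: "A0 \<subseteq> A" "B0 \<subseteq> B" "bip_star_type R A0 B0"
    and max: "\<And>A1 B1. A1 \<subseteq> A \<Longrightarrow> B1 \<subseteq> B \<Longrightarrow> bip_star_type R A1 B1 \<Longrightarrow> card A1 + card B1 \<le> card A0 + card B0"
    by (metis fst_conv snd_conv)
  have max_not: "card A1 + card B1 \<le> card A0 + card B0"
    if "A1 \<subseteq> A" "B1 \<subseteq> B"
      "bip_star_type (\<lambda>a b. \<not> R a b) A1 B1" for A1 B1
    using max[OF that(1,2) bip_star_type_not[THEN iffD1, OF that(3)]] .
  have max_swap: "card B1 + card A1 \<le> card B0 + card A0"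
    if "B1 \<subseteq> B" "A1 \<subseteq> A" "bip_star_type (\<lambda>b a. R a b) B1 A1" for A1 B1
    using max[OF that(2,1) bip_star_type_swap[THEN iffD1, OF that(3)]] by simp
  have max_not_swap: "card B1 + card A1 \<le> card B0 + card A0"
    if "B1 \<subseteq> B" "A1 \<subseteq> A"
      "bip_star_type (\<lambda>b a. \<not> R a b) B1 A1" for A1 B1
    using max_not[OF that(2,1) bip_star_type_swap[where R = "\<lambda>a b. \<not> R a b", THEN iffD1, OF that(3)]] by simp
  have "homogeneous R A B A0 B0"
    using 0(3) unfolding bip_star_type_def
  proof (elim disjE)
    assume "bip_stars R A0 B0"
    then show ?thesis by (rule maximal_stars_homogeneous[OF free 0(1,2) fin _ max])
  next
    assume st: "bip_stars (\<lambda>a b. \<not> R a b) A0 B0"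
    show ?thesis
      by (rule homogeneous_not)
        (rule maximal_stars_homogeneous[OF bip_free_not[OF free] 0(1,2) fin st max_not])
  next
    assume st: "bip_stars (\<lambda>b a. R a b) B0 A0"
    show ?thesis
      by (rule homogeneous_swap)
        (rule maximal_stars_homogeneous[OF bip_free_swap[OF free] 0(2,1) fin(2,1) st max_swap])
  next
    assume st: "bip_stars (\<lambda>b a. \<not> R a b) B0 A0"
    show ?thesis
      by (rule homogeneous_not, rule homogeneous_swap)
        (rule maximal_stars_homogeneous[OF bip_free_swap[OF bip_free_not[OF free]] 0(2,1) fin(2,1) st max_not_swap])
  qed
  then show ?thesis using that 0 by blast
qed

text \<open>
  Nested neighbourhoods would allow to split off a vertex of largest degree, so two independent edges
  exist and a maximal configuration \<open>(A0, B0)\<close> can be chosen.  Its outer vertices come before or after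
  it in a decomposition, hence there are none.
\<close>

theorem bip_indecomposable:
  fixes R :: "'a \<Rightarrow> 'a \<Rightarrow> bool"
  assumes free: "bip_free R A B" and fin: "finite A" "finite B" and two: "card A \<ge> 2"
    and indec: "\<And>A1 B1. A1 \<subseteq> A \<Longrightarrow> B1 \<subseteq> B \<Longrightarrow> \<forall>a\<in>A1. \<forall>b\<in>B - B1. R a b \<Longrightarrow>
      \<forall>a\<in>A - A1. \<forall>b\<in>B1. \<not> R a b \<Longrightarrow> A1 = {} \<and> B1 = {} \<or> A1 = A \<and> B1 = B"
  shows "bip_star_type R A B"
proof -
  define N where "N a = {b \<in> B. R a b}" for a
  obtain a where a: "a \<in> A" "\<And>a'. a' \<in> A \<Longrightarrow> card (N a') \<le> card (N a)"
  proof -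
    have "\<exists>a. a \<in> A \<and> (\<forall>a'. a' \<in> A \<longrightarrow> card (N a') \<le> card (N a))"
    proof -
      obtain a0 where "a0 \<in> A" using two by fastforce
      moreover have "\<forall>a'. a' \<in> A \<longrightarrow> card (N a') < Suc (card B)"
        using fin by (auto simp: N_def less_Suc_eq_le intro: card_mono)
      ultimately show ?thesis by (intro ex_has_greatest_nat[of _ a0])
    qed
    then show thesis using that by blast
  qed
  have "\<not> (\<forall>a'\<in>A - {a}. N a' \<subseteq> N a)"
  proof
    assume *: "\<forall>a'\<in>A - {a}. N a' \<subseteq> N a"
    have "{a} = {} \<and> B - N a = {} \<or> {a} = A \<and> B - N a = B"
      by (rule indec) (use a * in \<open>auto simp: N_def\<close>)
    then show False using two by auto
  qed
  then obtain a2 b2 where a2: "a2 \<in> A" "b2 \<in> N a2" "b2 \<notin> N a" by blast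
  have "\<not> N a \<subseteq> N a2"
  proof
    assume "N a \<subseteq> N a2"
    then have "N a \<subset> N a2" using a2 by blast
    then have "card (N a) < card (N a2)" using fin by (intro psubset_card_mono) (auto simp: N_def)
    then show False using a(2)[OF a2(1)] by simp
  qed
  then obtain b1 where b1: "b1 \<in> N a" "b1 \<notin> N a2" by blast
  obtain A0 B0 where 0: "A0 \<subseteq> A" "B0 \<subseteq> B" "bip_star_type R A0 B0"
    "homogeneous R A B A0 B0"
    using bip_homogeneous_core[OF free fin a(1) a2(1), of b1 b2] a2 b1 by (auto simp: N_def)
  have ne: "A0 \<noteq> {}" "B0 \<noteq> {}"
    using 0(3) unfolding bip_star_type_def bip_stars_def by fastforce+
  note h1 = homogeneousD(1)[OF 0(4)] and h2 = homogeneousD(2)[OF 0(4)]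
    and h3 = homogeneousD(3)[OF 0(4)] and h4 = homogeneousD(4)[OF 0(4)]
  define A1 where "A1 = {a \<in> A - A0. \<forall>b\<in>B0. R a b}"
  define B1 where "B1 = {b \<in> B - B0. \<forall>a\<in>A0. \<not> R a b}"
  have dich1: "\<forall>b\<in>B0. \<not> R a b" if "a \<in> A" "a \<notin> A0" "a \<notin> A1" for a
    using h1[of a] that by (auto simp: A1_def)
  have dich2: "\<forall>a\<in>A0. R a b" if "b \<in> B" "b \<notin> B0" "b \<notin> B1" for b
    using h2[of b] that by (auto simp: B1_def)
  have "A1 = {} \<and> B1 = {} \<or> A1 = A \<and> B1 = B"
  proof (rule indec)
    show "\<forall>a\<in>A1. \<forall>b\<in>B - B1. R a b"
    proof (intro ballI)
      fix a b assume ab: "a \<in> A1" "b \<in> B - B1"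
      show "R a b"
      proof (cases "b \<in> B0")
        case True
        then show ?thesis using ab by (simp add: A1_def)
      next
        case False
        then show ?thesis using h3[of a b] dich2[of b] ab by (simp add: A1_def)
      qed
    qed
    show "\<forall>a\<in>A - A1. \<forall>b\<in>B1. \<not> R a b"
    proof (intro ballI)
      fix a b assume ab: "a \<in> A - A1" "b \<in> B1"
      show "\<not> R a b"
      proof (cases "a \<in> A0")
        case True
        then show ?thesis using ab by (simp add: B1_def)
      next
        case False
        then show ?thesis using h4[of a b] dich1[of a] ab by (simp add: B1_def)
      qed
    qed
  qed (auto simp: A1_def B1_def)
  moreover have "A1 \<noteq> A" using 0(1) ne(1) by (auto simp: A1_def)
  ultimately have e1: "A1 = {}" "B1 = {}" by auto
  have "A0 = {} \<and> B0 = {} \<or> A0 = A \<and> B0 = B"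
  proof (rule indec)
    show "\<forall>a\<in>A0. \<forall>b\<in>B - B0. R a b" using dich2 e1 by blast
    show "\<forall>a\<in>A - A0. \<forall>b\<in>B0. \<not> R a b" using dich1 e1 by blast
  qed (use 0 in auto)
  then show ?thesis using ne 0(3) by auto
qed

section \<open>Erdos-Gallai equalities as decompositions\<close>

lemma consecutive_in_filter_upt:
  "consecutive_in (filter P [0..<m]) k k' \<longleftrightarrow>
     k < k' \<and> k' < m \<and> P k \<and> P k' \<and> (\<forall>j. k < j \<and> j < k' \<longrightarrow> \<not> P j)"
proof -
  define xs where "xs = filter P [0..<m]"
  have sorted: "sorted_wrt (<) xs" unfolding xs_def by (intro sorted_wrt_filter sorted_wrt_upt)
  have set: "j \<in> set xs \<longleftrightarrow> j < m \<and> P j" for j by (auto simp: xs_def)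
  have less: "xs ! i < xs ! j \<longleftrightarrow> i < j" if "i < length xs" "j < length xs" for i j
    using sorted_wrt_nth_less[OF sorted, of i j] sorted_wrt_nth_less[OF sorted, of j i] that
    by (metis less_asym nat_neq_iff)
  show ?thesis
    unfolding xs_def[symmetric]
  proof
    assume "consecutive_in xs k k'"
    then obtain i where i: "Suc i < length xs" "xs ! i = k" "xs ! Suc i = k'"
      unfolding consecutive_in_def by blast
    have mem: "k \<in> set xs" "k' \<in> set xs" using i nth_mem[of i xs] nth_mem[of "Suc i" xs] by auto
    have "k < k'" using less[of i "Suc i"] i by simp
    moreover have "\<not> P j" if j: "k < j" "j < k'" for j
    proof
      assume "P j"
      then have "j \<in> set xs" using set[of j] set[of k'] mem(2) j(2) by simp
      then obtain l where l: "l < length xs" "xs ! l = j" by (auto simp: in_set_conv_nth)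
      have "i < l" "l < Suc i" using less[of i l] less[of l "Suc i"] i l j by auto
      then show False by simp
    qed
    ultimately show "k < k' \<and> k' < m \<and> P k \<and> P k' \<and> (\<forall>j. k < j \<and> j < k' \<longrightarrow> \<not> P j)"
      using mem set by blast
  next
    assume k: "k < k' \<and> k' < m \<and> P k \<and> P k' \<and> (\<forall>j. k < j \<and> j < k' \<longrightarrow> \<not> P j)"
    then have "k \<in> set xs" "k' \<in> set xs" using set by auto
    then obtain i i' where i: "i < length xs" "xs ! i = k" and i': "i' < length xs" "xs ! i' = k'"
      by (auto simp: in_set_conv_nth)
    have ii: "i < i'" using less[of i i'] i i' k by simp
    then have Si: "Suc i < length xs" using i' by simp
    have "xs ! Suc i \<in> set xs" using Si by (rule nth_mem)
    then have P: "P (xs ! Suc i)" using set by blast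
    have "k < xs ! Suc i" using less[of i "Suc i"] i Si by simp
    moreover have "\<not> k' < xs ! Suc i" using less[of i' "Suc i"] i' Si ii by simp
    ultimately have "xs ! Suc i = k'" using k P by (metis nat_neq_iff)
    then show "consecutive_in xs k k'" unfolding consecutive_in_def using Si i by blast
  qed
qed

lemma last_filter_upt:
  assumes "P j" "j < m"
  shows "P (last (filter P [0..<m]))" "last (filter P [0..<m]) < m"
    "\<And>i. i < m \<Longrightarrow> P i \<Longrightarrow> i \<le> last (filter P [0..<m])"
proof -
  define xs where "xs = filter P [0..<m]"
  have sorted: "sorted xs" unfolding xs_def by (intro sorted_wrt_filter) simp
  have set: "i \<in> set xs \<longleftrightarrow> i < m \<and> P i" for i by (auto simp: xs_def)
  have ne: "xs \<noteq> []" using set[of j] assms by auto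
  have "last xs \<in> set xs" using ne by simp
  then show "P (last (filter P [0..<m]))" "last (filter P [0..<m]) < m"
    using set by (auto simp: xs_def)
  fix i assume "i < m" "P i"
  then have "i \<in> set xs" using set by simp
  then obtain l where l: "l < length xs" "xs ! l = i" by (auto simp: in_set_conv_nth)
  have "xs ! l \<le> xs ! (length xs - 1)" using sorted l(1) by (intro sorted_nth_mono) auto
  then show "i \<le> last (filter P [0..<m])" using l(2) ne by (simp add: last_conv_nth xs_def)
qed

lemma sum_le_sum_dominated:
  fixes g :: "'a \<Rightarrow> nat"
  assumes "finite X" "finite Y" "card X = card Y"
    "\<And>x y. x \<in> X \<Longrightarrow> y \<in> Y \<Longrightarrow> g x \<le> g y"
  shows "sum g X \<le> sum g Y"
proof -
  obtain f where f: "bij_betw f X Y" using finite_same_card_bij[OF assms(1-3)] by blast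
  have "sum g X \<le> (\<Sum>x\<in>X. g (f x))" using assms(4) bij_betw_apply[OF f] by (intro sum_mono) blast
  also have "\<dots> = sum g Y" by (rule sum.reindex_bij_betw[OF f])
  finally show ?thesis .
qed

text \<open>
  The number of vertices off the star is even by the handshake lemma, and it is positive because some
  vertex other than \<open>z\<close> is not adjacent to \<open>z\<close>.
\<close>

lemma star_matching_degrees:
  assumes E: "sgraph E" and C: "finite C" and st: "star_matching E C z"
  obtains s where "z \<in> C" "1 \<le> deg E C z"
    "\<And>v. v \<in> C \<Longrightarrow> v \<noteq> z \<Longrightarrow> deg E C v = 1"
    "s \<ge> 1" "card C = deg E C z + 1 + 2 * s"
proof -
  obtain x where x: "x \<in> C" "x \<noteq> z"
    "\<not> E z x" using st unfolding star_matching_def by metis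
  have z: "z \<in> C" using st by (simp add: star_matching_def)
  have one: "deg E C v = 1" if "v \<in> C" "v \<noteq> z" for v
    unfolding deg_eq_1_iff using st that unfolding star_matching_def by metis
  have ge: "1 \<le> deg E C z" unfolding deg_ge_1_iff[OF C] using st unfolding star_matching_def by metis
  have cC: "card C = card (C - {z}) + 1" using C z by (metis Suc_eq_plus1 card_Suc_Diff1)
  have "(\<Sum>v\<in>C. deg E C v) = deg E C z + (\<Sum>v\<in>C - {z}. deg E C v)" using C z by (rule sum.remove)
  also have "(\<Sum>v\<in>C - {z}. deg E C v) = card (C - {z})" using one by simp
  finally have even: "even (deg E C z + card (C - {z}))" using even_sum_deg[OF E C] by simp
  have "{v \<in> C. E z v} \<subset> C - {z}" using x sgraph_irrefl[OF E] by auto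
  then have lt: "deg E C z < card (C - {z})" unfolding deg_def using C by (intro psubset_card_mono) auto
  have "even (card (C - {z}) - deg E C z)" using even lt by auto
  then obtain s where s: "card (C - {z}) - deg E C z = 2 * s" by (rule evenE)
  then have "s \<ge> 1" "card C = deg E C z + 1 + 2 * s" using lt cC by auto
  then show ?thesis using that z one ge by blast
qed

lemma sorted_wrt_ge_replicate: "sorted_wrt (\<ge>) (replicate m (c :: nat))"
  by (induction m) auto

lemma sorted_desc_unique:
  fixes xs ys :: "nat list"
  assumes "sorted_wrt (\<ge>) xs" "sorted_wrt (\<ge>) ys" "mset xs = mset ys"
  shows "xs = ys"
proof -
  have "sorted (rev xs)" "sorted (rev ys)" using assms(1,2) by (simp_all add: sorted_wrt_rev)
  then have "rev xs = rev ys" using assms(3) by (metis mset_rev properties_for_sort)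
  then show ?thesis by simp
qed

text \<open>
  A graph with its vertices listed by descending degree.  Ties are broken by the list, so that the
  first \<open>k\<close> vertices are a well-defined set.
\<close>

locale degree_ordered =
  fixes E :: "'a \<Rightarrow> 'a \<Rightarrow> bool" and V :: "'a set" and vs :: "'a list"
  assumes E: "sgraph E" and dist: "distinct vs" and set_vs: "set vs = V"
    and sorted: "sorted_wrt (\<lambda>u v. deg E V v \<le> deg E V u) vs"
begin

abbreviation d :: "nat list" where "d \<equiv> map (deg E V) vs"
abbreviation n :: nat where "n \<equiv> length vs"

text \<open>
  These are the parts of the decomposition that belongs to an equality at \<open>k\<close>.  A vertex of degree
  exactly \<open>k\<close> outside the first \<open>k\<close> is counted among the independent vertices.
\<close>

definition top_part :: "nat \<Rightarrow> 'a set" where "top_part k = set (take k vs)"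
definition low_part :: "nat \<Rightarrow> 'a set" where "low_part k = {v \<in> V - top_part k. deg E V v \<le> k}"
definition core :: "nat \<Rightarrow> 'a set" where "core k = {v \<in> V - top_part k. k < deg E V v}"
definition vt :: "nat \<Rightarrow> 'a" where "vt i = vs ! (i - 1)"

lemma finV: "finite V" using set_vs by auto

lemma top_subset: "top_part k \<subseteq> V" using set_take_subset[of k vs] by (simp add: top_part_def set_vs)

lemma card_top: "k \<le> n \<Longrightarrow> card (top_part k) = k"
  unfolding top_part_def using dist by (simp add: distinct_card)

lemma top_mono: "k \<le> k' \<Longrightarrow> top_part k \<subseteq> top_part k'"
  unfolding top_part_def by (rule set_take_subset_set_take)

lemma finite_parts: "finite (top_part k)" "finite (low_part k)" "finite (core k)"
  using finV by (simp_all add: top_part_def low_part_def core_def)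

lemma not_top: "V - top_part k = set (drop k vs)"
proof -
  have "V = top_part k \<union> set (drop k vs)" unfolding top_part_def set_vs[symmetric] by (metis append_take_drop_id set_append)
  moreover have "top_part k \<inter> set (drop k vs) = {}"
    unfolding top_part_def using dist by (metis append_take_drop_id distinct_append)
  ultimately show ?thesis by blast
qed

lemma deg_le_top:
  assumes "u \<in> top_part k" "v \<in> V" "v \<notin> top_part k"
  shows "deg E V v \<le> deg E V u"
proof -
  have "v \<in> set (drop k vs)" using not_top assms by blast
  moreover have "sorted_wrt (\<lambda>u v. deg E V v \<le> deg E V u) (take k vs @ drop k vs)" using sorted by simp
  ultimately show ?thesis using assms(1) unfolding sorted_wrt_append top_part_def by blast
qed

lemma parts: "V = top_part k \<union> low_part k \<union> core k"
  "top_part k \<inter> low_part k = {}" "top_part k \<inter> core k = {}"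
  "low_part k \<inter> core k = {}"
  using top_subset[of k] by (auto simp: low_part_def core_def)

lemma inj_vt: "inj_on vt {1..n}"
  using dist by (auto simp: inj_on_def vt_def nth_eq_iff_index_eq)

lemma vt_top: "k \<le> n \<Longrightarrow> vt ` {1..k} = top_part k"
proof -
  assume k: "k \<le> n"
  have "vt ` {1..k} = nth vs ` {0..<k}"
  proof -
    have "(\<lambda>i. i - 1) ` {1..k} = {0..<k}"
      by (auto simp: image_iff intro!: bexI[of _ "Suc _"])
    then show ?thesis unfolding vt_def by (metis image_image)
  qed
  then show ?thesis using nth_image[OF k] by (simp add: top_part_def)
qed

lemma vt_V: "vt ` {1..n} = V"
  using vt_top[of n] by (simp add: top_part_def set_vs)

lemma vt_diff:
  assumes "k \<le> k'" "k' \<le> n"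
  shows "vt ` {k + 1..k'} = top_part k' - top_part k"
proof -
  have "{k + 1..k'} = {1..k'} - {1..k}" by auto
  moreover have "vt ` ({1..k'} - {1..k}) = vt ` {1..k'} - vt ` {1..k}"
    using inj_vt assms by (intro inj_on_image_set_diff[OF inj_vt]) auto
  ultimately show ?thesis using vt_top assms by simp
qed

lemma seq_term: "i \<in> {1..n} \<Longrightarrow> seq_term d i = deg E V (vt i)"
  by (auto simp: vt_def)

lemma sum_vt:
  assumes "I \<subseteq> {1..n}"
  shows "(\<Sum>i\<in>I. g (seq_term d i)) = (\<Sum>v\<in>vt ` I. g (deg E V v))"
proof -
  have "(\<Sum>v\<in>vt ` I. g (deg E V v)) = (\<Sum>i\<in>I. g (deg E V (vt i)))"
    using inj_on_subset[OF inj_vt assms] by (simp add: sum.reindex)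
  moreover have "(\<Sum>i\<in>I. g (seq_term d i)) = (\<Sum>i\<in>I. g (deg E V (vt i)))"
    by (rule sum.cong[OF refl]) (use assms seq_term in \<open>auto simp del: nth_map\<close>)
  ultimately show ?thesis by simp
qed

lemma EG_equality_sums:
  assumes "k \<le> n"
  shows "EG_equality d k \<longleftrightarrow>
    (\<Sum>v\<in>top_part k. deg E V v) = k * (k - 1) + (\<Sum>v\<in>V - top_part k. min k (deg E V v))"
proof -
  have "(\<Sum>i = 1..k. seq_term d i) = (\<Sum>v\<in>top_part k. deg E V v)"
    using sum_vt[of "{1..k}" "\<lambda>x. x"] vt_top[OF assms] assms by simp
  moreover have "vt ` {k + 1..n} = V - top_part k"
    using vt_diff[of k n] assms by (simp add: top_part_def set_vs)
  then have "(\<Sum>i = k + 1..n. min k (seq_term d i)) = (\<Sum>v\<in>V - top_part k. min k (deg E V v))"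
    using sum_vt[of "{k + 1..n}" "min k"] by simp
  ultimately show ?thesis by (simp add: EG_equality_def)
qed

lemma sum_min: "(\<Sum>v\<in>V - top_part k. min k (deg E V v)) = (\<Sum>v\<in>low_part k. deg E V v) + k * card (core k)"
proof -
  have "V - top_part k = low_part k \<union> core k" using parts(1-3)[of k] by blast
  then have "(\<Sum>v\<in>V - top_part k. min k (deg E V v)) =
    (\<Sum>v\<in>low_part k. min k (deg E V v)) + (\<Sum>v\<in>core k. min k (deg E V v))"
    using finite_parts parts(4) by (simp add: sum.union_disjoint)
  moreover have "(\<Sum>v\<in>low_part k. min k (deg E V v)) = (\<Sum>v\<in>low_part k. deg E V v)"
    by (rule sum.cong) (auto simp: low_part_def)
  moreover have "(\<Sum>v\<in>core k. min k (deg E V v)) = (\<Sum>v\<in>core k. k)"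
    by (rule sum.cong) (auto simp: core_def)
  ultimately show ?thesis by simp
qed

text \<open>
  Since \<open>min k d\<^sub>i\<close> is \<open>d\<^sub>i\<close> on the independent part and \<open>k\<close> on the core, the Erdos-Gallai equality is
  the degree sum criterion for decompositions.
\<close>

lemma EG_equality_iff_decomp:
  assumes "k \<le> n"
  shows "EG_equality d k \<longleftrightarrow> decomp E (top_part k) (low_part k) (core k)"
  using decomp_iff_degree_sum[OF E finite_parts(1,2,3) parts(2-4), of k] parts(1)[of k, symmetric]
    card_top[OF assms] EG_equality_sums[OF assms] sum_min[of k]
  by (simp add: distrib_left add_ac)

text \<open>
  The clique of a decomposition need not consist of the first vertices of the list, owing to ties.
  But the difference of the two sides of the Erdos-Gallai inequality, as a function of a \<open>k\<close>-set, is
  largest at the first \<open>k\<close> vertices, where it is still at most 0.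
\<close>

lemma EG_equality_of_decomp:
  assumes dec: "decomp E A B C" and V: "V = A \<union> B \<union> C"
  shows "EG_equality d (card A)" "card A \<le> n"
proof -
  have fin: "finite A" "finite B" "finite C" using finV V by auto
  have n: "n = card V" using dist set_vs distinct_card by metis
  show le: "card A \<le> n" unfolding n V by (rule card_mono) (use fin in auto)
  define k where "k = card A"
  have kn: "k \<le> n" using le by (simp add: k_def)
  \<comment> \<open>Moving v from outside into the k-set raises the left side of the inequality minus the
    right side by this amount.\<close>
  let ?g = "\<lambda>v. deg E V v + min k (deg E V v)"
  have cards: "card A = card (top_part k)" using card_top[OF kn] by (simp add: k_def)
  have "sum ?g (A - top_part k) \<le> sum ?g (top_part k - A)"
  proof (rule sum_le_sum_dominated)
    show "card (A - top_part k) = card (top_part k - A)"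
      using cards fin finite_parts(1) by (simp add: card_Diff_subset_Int Int_commute)
    show "?g x \<le> ?g y" if "x \<in> A - top_part k" "y \<in> top_part k - A" for x y
    proof -
      have "deg E V x \<le> deg E V y" using deg_le_top[of y k x] that V by auto
      then show ?thesis by (simp add: min_def)
    qed
  qed (use fin finite_parts in auto)
  moreover have "sum ?g A = sum ?g (A \<inter> top_part k) + sum ?g (A - top_part k)"
    using fin sum.Int_Diff[of A ?g "top_part k"] by simp
  moreover have "sum ?g (top_part k) = sum ?g (A \<inter> top_part k) + sum ?g (top_part k - A)"
    using finite_parts sum.Int_Diff[of "top_part k" ?g A] by (simp add: Int_commute)
  ultimately have gle: "sum ?g A \<le> sum ?g (top_part k)" by linarith
  have mins: "(\<Sum>v\<in>V. min k (deg E V v)) = (\<Sum>v\<in>S. min k (deg E V v)) + (\<Sum>v\<in>V - S. min k (deg E V v))"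
    if "S \<subseteq> V" for S
    using sum.subset_diff[OF that finV] by (simp add: add.commute)
  have sumA: "(\<Sum>v\<in>A. deg E V v) = k * (k - 1) + (\<Sum>v\<in>V - A. min k (deg E V v))"
  proof -
    have disj: "A \<inter> B = {}" "A \<inter> C = {}"
      "B \<inter> C = {}" using decompD(1-3)[OF dec] by auto
    have "V - A = B \<union> C" using V disj by blast
    then have "(\<Sum>v\<in>V - A. min k (deg E V v)) =
      (\<Sum>v\<in>B. min k (deg E V v)) + (\<Sum>v\<in>C. min k (deg E V v))"
      using fin disj by (simp add: sum.union_disjoint)
    moreover have "(\<Sum>v\<in>B. min k (deg E V v)) = (\<Sum>v\<in>B. deg E V v)"
    proof (rule sum.cong[OF refl])
      fix b assume "b \<in> B"
      then have "deg E V b = deg E A b" using decomp_deg_indep[OF E fin dec] V by simp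
      then show "min k (deg E V b) = deg E V b" using deg_le_card[OF fin(1), of E b] by (simp add: k_def)
    qed
    moreover have "(\<Sum>v\<in>C. min k (deg E V v)) = (\<Sum>v\<in>C. k)"
    proof (rule sum.cong[OF refl])
      fix c assume "c \<in> C"
      then have "deg E V c = card A + deg E C c" using decomp_deg_core[OF E fin dec] V by simp
      then show "min k (deg E V c) = k" by (simp add: k_def)
    qed
    ultimately show ?thesis
      using decomp_iff_degree_sum[OF E fin disj] dec V by (simp add: k_def distrib_left add_ac)
  qed
  have "(\<Sum>v\<in>top_part k. deg E V v) \<le> k * (k - 1) + (\<Sum>v\<in>V - top_part k. min k (deg E V v))"
    using degree_sum_le[OF E finite_parts(1,2,3) parts(2-4), of k] parts(1)[of k, symmetric]
      card_top[OF kn] sum_min[of k] by (simp add: distrib_left add_ac)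
  moreover have "sum ?g A = (\<Sum>v\<in>A. deg E V v) + (\<Sum>v\<in>A. min k (deg E V v))"
    "sum ?g (top_part k) = (\<Sum>v\<in>top_part k. deg E V v) + (\<Sum>v\<in>top_part k. min k (deg E V v))"
    by (simp_all add: sum.distrib)
  moreover have "A \<subseteq> V" using V by blast
  ultimately have "(\<Sum>v\<in>top_part k. deg E V v) = k * (k - 1) + (\<Sum>v\<in>V - top_part k. min k (deg E V v))"
    using gle sumA mins[of A] mins[OF top_subset[of k]] by linarith
  then show "EG_equality d (card A)" using EG_equality_sums[OF kn] by (simp add: k_def)
qed

lemma EG_equality_of_refinement:
  assumes k: "k \<le> n" "EG_equality d k" and dec: "decomp E D N C" and C: "core k = D \<union> N \<union> C"
  shows "EG_equality d (k + card D)" "k + card D \<le> n"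
proof -
  have deck: "decomp E (top_part k) (low_part k) (core k)" using EG_equality_iff_decomp k by simp
  have "decomp E (top_part k \<union> D) (low_part k \<union> N) C" by (rule decomp_trans[OF deck C dec E])
  moreover have "V = (top_part k \<union> D) \<union> (low_part k \<union> N) \<union> C" using parts(1)[of k] C by blast
  moreover have "card (top_part k \<union> D) = k + card D"
  proof -
    have "top_part k \<inter> D = {}" using parts(3)[of k] C by blast
    moreover have "finite D" using finite_parts(3)[of k] C by simp
    ultimately show ?thesis using card_top[OF k(1)] finite_parts(1) by (simp add: card_Un_disjoint)
  qed
  ultimately show "EG_equality d (k + card D)" "k + card D \<le> n"
    using EG_equality_of_decomp[of "top_part k \<union> D" "low_part k \<union> N" C] by simp_all
qed

lemma dstar_eq: "dstar d j = card {v \<in> V. j \<le> deg E V v}"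
proof -
  define I where "I = {i \<in> {1..n}. j \<le> deg E V (vt i)}"
  have I: "{i \<in> {1..length d}. j \<le> seq_term d i} = I"
    using seq_term by (auto simp: I_def simp del: nth_map)
  define m where "m = Max (insert 0 I)"
  have finI: "finite I" by (simp add: I_def)
  have anti: "deg E V (vt i) \<le> deg E V (vt i')" if "1 \<le> i'" "i' \<le> i" "i \<le> n" for i i'
  proof (cases "i' = i")
    case False
    then show ?thesis
      using sorted_wrt_nth_less[OF sorted, of "i' - 1" "i - 1"] that by (simp add: vt_def)
  qed simp
  have "I = {1..m}"
  proof (intro equalityI subsetI)
    fix i assume "i \<in> I"
    then show "i \<in> {1..m}" using finI by (auto simp: m_def I_def)
  next
    fix i assume i: "i \<in> {1..m}"
    then have "m \<noteq> 0" by auto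
    moreover have "m \<in> insert 0 I" unfolding m_def using finI by (intro Max_in) auto
    ultimately have "m \<in> I" by simp
    then show "i \<in> I" using anti[of i m] i by (auto simp: I_def)
  qed
  then have "card I = m" by simp
  moreover have "vt ` I = {v \<in> V. j \<le> deg E V v}" unfolding I_def vt_V[symmetric] by auto
  moreover have "inj_on vt I" using inj_vt by (rule inj_on_subset) (auto simp: I_def)
  ultimately have "card {v \<in> V. j \<le> deg E V v} = m" by (metis card_image)
  then show ?thesis unfolding dstar_def I m_def by simp
qed

lemma delta_eq:
  assumes "k \<le> n"
  shows "delta d k = card {v \<in> V - top_part k. deg E V v = k}"
proof -
  define I where "I = {i \<in> {k + 1..n}. deg E V (vt i) = k}"
  have "i \<in> {1..length d} \<and> k < i \<and> seq_term d i = k \<longleftrightarrow> i \<in> {k + 1..n} \<and> deg E V (vt i) = k" for i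
    using seq_term[of i] by (cases "i \<in> {1..n}") (auto simp del: nth_map)
  then have I: "{i \<in> {1..length d}. k < i \<and> seq_term d i = k} = I" by (simp add: I_def)
  have "vt ` I = {v \<in> vt ` {k + 1..n}. deg E V v = k}" unfolding I_def by blast
  then have "vt ` I = {v \<in> V - top_part k. deg E V v = k}"
    using vt_diff[of k n] assms by (simp add: top_part_def set_vs)
  moreover have "inj_on vt I" using inj_vt by (rule inj_on_subset) (auto simp: I_def)
  ultimately have "card {v \<in> V - top_part k. deg E V v = k} = card I" by (metis card_image)
  then show ?thesis unfolding delta_def I by simp
qed

lemma tail_terms_eq:
  assumes "t \<le> n"
  obtains ws where "tail_terms d t = map (deg E V) ws" "distinct ws" "set ws = core t"
    "sorted_wrt (\<ge>) (map (deg E V) ws)"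
proof -
  define ws where "ws = filter (\<lambda>v. t < deg E V v) (drop t vs)"
  have comp: "concat (map (\<lambda>i. if P i then [f i] else []) xs) = map f (filter P xs)"
    for P :: "nat \<Rightarrow> bool" and f :: "nat \<Rightarrow> nat" and xs
    by (induction xs) auto
  have "tail_terms d t = map (seq_term d) (filter (\<lambda>i. t < i \<and> t < seq_term d i) [1..<n + 1])"
    unfolding tail_terms_def comp by simp
  also have "[1..<n + 1] = [1..<t + 1] @ [t + 1..<n + 1]" 
  proof -
    have "n + 1 = (t + 1) + (n - t)" using assms by simp
    then show ?thesis by (metis upt_add_eq_append le_add2)
  qed
  also have "filter (\<lambda>i. t < i \<and> t < seq_term d i) ([1..<t + 1] @ [t + 1..<n + 1]) =
    filter (\<lambda>i. t < deg E V (vt i)) [t + 1..<n + 1]"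
  proof -
    have "filter (\<lambda>i. t < i \<and> t < seq_term d i) [1..<t + 1] = []" by (auto simp: filter_empty_conv)
    moreover have "filter (\<lambda>i. t < i \<and> t < seq_term d i) [t + 1..<n + 1] =
      filter (\<lambda>i. t < deg E V (vt i)) [t + 1..<n + 1]"
      by (rule filter_cong) (use seq_term in \<open>auto simp del: nth_map\<close>)
    ultimately show ?thesis by simp
  qed
  also have "map (seq_term d) (filter (\<lambda>i. t < deg E V (vt i)) [t + 1..<n + 1]) =
    map (\<lambda>i. deg E V (vt i)) (filter (\<lambda>i. t < deg E V (vt i)) [t + 1..<n + 1])"
    by (rule map_cong[OF refl]) (use seq_term in \<open>auto simp del: nth_map\<close>)
  also have "\<dots> = map (deg E V) (filter (\<lambda>v. t < deg E V v) (map vt [t + 1..<n + 1]))"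
    by (simp add: filter_map comp_def)
  also have "map vt [t + 1..<n + 1] = drop t vs"
    by (rule nth_equalityI) (auto simp: vt_def simp del: upt_Suc)
  finally have "tail_terms d t = map (deg E V) ws" by (simp add: ws_def)
  moreover have "distinct ws" using dist by (simp add: ws_def)
  moreover have "set ws = core t" unfolding core_def not_top by (auto simp: ws_def)
  moreover have "sorted_wrt (\<ge>) (map (deg E V) ws)"
    using sorted sorted_wrt_drop[OF sorted, of t] by (simp add: ws_def sorted_wrt_map sorted_wrt_filter)
  ultimately show ?thesis using that by blast
qed

section \<open>The component between consecutive equalities\<close>

text \<open>
  Here \<open>A\<close> and \<open>B\<close> are the two sides of the split graph between the equalities \<open>k\<close> and \<open>k'\<close>.  The
  vertices of degree exactly \<open>k'\<close> see all of \<open>A\<close>; they are kept apart as \<open>Bs\<close>, since they are isolated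
  in the remaining graph and belong to no split piece.
\<close>

context
  fixes k k' :: nat and A B Bs :: "'a set"
  assumes kk: "k < k'" "k' \<le> n" and EGk: "EG_equality d k" and EGk': "EG_equality d k'"
    and Arest: "top_part k' - top_part k \<subseteq> core k"
  defines "A \<equiv> top_part k' - top_part k"
    and "B \<equiv> {v \<in> V - top_part k'. k < deg E V v \<and> deg E V v < k'}"
    and "Bs \<equiv> {v \<in> V - top_part k'. deg E V v = k'}"
begin

lemma dec_k: "decomp E (top_part k) (low_part k) (core k)" using EG_equality_iff_decomp[of k] EGk kk by simp
lemma dec_k': "decomp E (top_part k') (low_part k') (core k')" using EG_equality_iff_decomp[of k'] EGk' kk by simp

lemma fin_AB: "finite A" "finite B" "finite Bs"
  using finV finite_parts by (auto simp: A_def B_def Bs_def)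

lemma card_A: "card A = k' - k" "A \<noteq> {}"
proof -
  show "card A = k' - k"
    using card_Diff_subset[OF finite_parts(1) top_mono, of k k'] card_top kk by (simp add: A_def)
  then show "A \<noteq> {}" using kk by auto
qed

lemma core_k_eq: "core k = A \<union> B \<union> (Bs \<union> core k')"
proof -
  have "top_part k \<subseteq> top_part k'" using top_mono kk by simp
  then have "core k \<subseteq> A \<union> B \<union> (Bs \<union> core k')"
    unfolding core_def A_def B_def Bs_def using kk by auto
  moreover have "A \<union> B \<union> (Bs \<union> core k') \<subseteq> core k"
    using Arest \<open>top_part k \<subseteq> top_part k'\<close> kk unfolding A_def B_def Bs_def core_def by auto
  ultimately show ?thesis by blast
qed

lemma Bs_adj: "b \<in> Bs \<Longrightarrow> u \<in> top_part k' \<Longrightarrow> E b u"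
proof -
  assume b: "b \<in> Bs" and u: "u \<in> top_part k'"
  have "b \<in> low_part k'" using b by (auto simp: Bs_def low_part_def)
  then have "deg E V b = deg E (top_part k') b"
    using decomp_deg_indep[OF E finite_parts(1,2,3) dec_k'] parts(1)[of k'] by simp
  then have "deg E (top_part k') b = card (top_part k')" using b card_top[OF kk(2)] by (simp add: Bs_def)
  then show "E b u" using deg_eq_card_iff[OF finite_parts(1)] u by blast
qed

lemma low_sub: "B \<subseteq> low_part k'" "Bs \<subseteq> low_part k'" "A \<subseteq> top_part k'"
  by (auto simp: A_def B_def Bs_def low_part_def)

lemma dec_A: "decomp E A B (Bs \<union> core k')"
proof (rule decompI)
  show "a \<noteq> b" if "a \<in> A" "b \<in> B" for a b using that by (auto simp: A_def B_def)
  show "a \<noteq> c" if "a \<in> A" "c \<in> Bs \<union> core k'" for a c using that by (auto simp: A_def Bs_def core_def)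
  show "b \<noteq> c" if "b \<in> B" "c \<in> Bs \<union> core k'" for b c using that by (auto simp: B_def Bs_def core_def)
  show "E a a'" if "a \<in> A" "a' \<in> A" "a \<noteq> a'" for a a'
    using decompD(7)[OF dec_k'] that low_sub by blast
  show "\<not> E b b'" if "b \<in> B" "b' \<in> B" for b b'
    using decompD(8)[OF dec_k'] that low_sub by blast
  show "E a c" if "a \<in> A" "c \<in> Bs \<union> core k'" for a c
  proof (cases "c \<in> Bs")
    case True
    then show ?thesis using Bs_adj[of c a] that low_sub sgraph_sym[OF E, of a c] by blast
  next
    case False
    then show ?thesis using decompD(9)[OF dec_k', of a c] that low_sub by blast
  qed
  show "\<not> E b c" if "b \<in> B" "c \<in> Bs \<union> core k'" for b c
    using decompD(8)[OF dec_k', of b c] decompD(10)[OF dec_k', of b c] that low_sub by blast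
qed

lemma dec_Bs: "decomp E {} Bs (core k')"
  using decomp_subset[OF dec_k', of "{}" Bs "core k'"] low_sub by simp

lemma deg_B:
  assumes b: "b \<in> B"
  shows "deg E V b = k + deg E A b" "deg (co E) A b + deg E A b = k' - k"
proof -
  have "b \<in> low_part k'" "b \<in> core k" using b low_sub core_k_eq by auto
  then have "deg E V b = deg E (top_part k') b"
    using decomp_deg_indep[OF E finite_parts(1,2,3) dec_k'] parts(1)[of k'] by simp
  also have "top_part k' = top_part k \<union> A" using top_mono[of k k'] kk by (auto simp: A_def)
  also have "deg E (top_part k \<union> A) b = deg E (top_part k) b + deg E A b"
    using finite_parts fin_AB by (intro deg_Un) (auto simp: A_def)
  also have "deg E (top_part k) b = k"
  proof -
    have "\<forall>u\<in>top_part k. E b u" using decompD(9)[OF dec_k] \<open>b \<in> core k\<close> sgraph_sym[OF E] by metis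
    then have "deg E (top_part k) b = card (top_part k)" using deg_eq_card_iff[OF finite_parts(1)] by blast
    then show ?thesis using card_top kk by simp
  qed
  finally show "deg E V b = k + deg E A b" .
  have "b \<notin> A" using b by (auto simp: A_def B_def)
  then show "deg (co E) A b + deg E A b = k' - k"
    using deg_co_outside[OF fin_AB(1)] card_A by simp
qed

text \<open>
  The degree of a clique vertex is computed from its neighbours on the other side, with respect to
  \<open>k'\<close>, and from its non-neighbours there, with respect to \<open>k\<close>.
\<close>

lemma deg_A:
  assumes a: "a \<in> A"
  shows "deg E V a = k' - 1 + card (core k') + card Bs + deg E B a"
    and "deg E V a + 1 + deg (co E) B a = k + card (core k)"
proof -
  have "a \<in> top_part k'" "a \<in> core k" using a Arest by (auto simp: A_def)
  have "deg E V a = k' - 1 + card (core k') + deg E (low_part k') a"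
    using decomp_deg_clique[OF E finite_parts(1,2,3) dec_k' \<open>a \<in> top_part k'\<close>] parts(1)[of k'] card_top[OF kk(2)] by simp
  moreover have "deg E (low_part k') a = card Bs + deg E B a"
  proof -
    define L where "L = {v \<in> V - top_part k'. deg E V v \<le> k}"
    have "low_part k' = (Bs \<union> B) \<union> L" using kk by (auto simp: low_part_def Bs_def B_def L_def)
    moreover have "deg E ((Bs \<union> B) \<union> L) a = deg E (Bs \<union> B) a + deg E L a"
      using fin_AB finV kk by (intro deg_Un) (auto simp: Bs_def B_def L_def)
    moreover have "deg E (Bs \<union> B) a = deg E Bs a + deg E B a"
      using fin_AB by (intro deg_Un) (auto simp: Bs_def B_def)
    moreover have "deg E Bs a = card Bs"
    proof -
      have "\<forall>b\<in>Bs. E a b" using Bs_adj \<open>a \<in> top_part k'\<close> sgraph_sym[OF E] by metis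
      then show ?thesis using deg_eq_card_iff[OF fin_AB(3)] by blast
    qed
    moreover have "deg E L a = 0"
    proof -
      have "L \<subseteq> low_part k" using top_mono[of k k'] kk by (auto simp: L_def low_part_def)
      then have "\<forall>v\<in>L. \<not> E a v" using decompD(10)[OF dec_k] \<open>a \<in> core k\<close> sgraph_sym[OF E] by (metis subsetD)
      moreover have "finite L" using finV by (simp add: L_def)
      ultimately show ?thesis by (simp add: deg_eq_0_iff)
    qed
    ultimately show ?thesis by simp
  qed
  ultimately show "deg E V a = k' - 1 + card (core k') + card Bs + deg E B a" by simp
  have "deg E V a = k + deg E (core k) a"
    using decomp_deg_core[OF E finite_parts(1,2,3) dec_k \<open>a \<in> core k\<close>] parts(1)[of k] card_top kk by simp
  moreover have "deg (co E) (core k) a + deg E (core k) a = card (core k) - 1"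
    using deg_co_inside[OF E finite_parts(3) \<open>a \<in> core k\<close>] .
  moreover have "card (core k) \<ge> 1"
    using \<open>a \<in> core k\<close> finite_parts(3) by (metis card_gt_0_iff empty_iff less_eq_Suc_le One_nat_def)
  moreover have "deg (co E) (core k) a = deg (co E) B a"
  proof -
    have "v \<in> B" if v: "v \<in> core k" "co E a v" for v
    proof (rule ccontr)
      assume "v \<notin> B"
      then consider "v \<in> A" | "v \<in> Bs \<union> core k'" using v(1) core_k_eq by blast
      then have "E a v \<or> a = v"
        using decompD(7)[OF dec_A a] decompD(9)[OF dec_A a] by cases auto
      then show False using v(2) by (auto simp: co_def)
    qed
    then have "{v \<in> core k. co E a v} = {v \<in> B. co E a v}" using core_k_eq by blast
    then show ?thesis by (simp only: deg_def)
  qed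
  ultimately show "deg E V a + 1 + deg (co E) B a = k + card (core k)" by linarith
qed

text \<open>
  The first \<open>k'\<close> vertices, \<open>Bs\<close> and the core are all counted, so a clique vertex has this degree
  exactly if it has one neighbour in \<open>B\<close>.
\<close>

lemma dstar_k':
  assumes "\<And>a. a \<in> A \<Longrightarrow> k' \<le> deg E V a"
  shows "dstar d k' = k' + card Bs + card (core k')"
proof -
  obtain a where a: "a \<in> A" using card_A by blast
  have "k' \<le> deg E V u" if "u \<in> top_part k'" for u
  proof (cases "u \<in> top_part k")
    case True
    have "a \<in> V" "a \<notin> top_part k" using a top_subset by (auto simp: A_def)
    then show ?thesis using deg_le_top[OF True, of a] assms[OF a] by simp
  next
    case False
    then show ?thesis using assms that by (simp add: A_def)
  qed
  then have "{v \<in> V. k' \<le> deg E V v} = (top_part k' \<union> Bs) \<union> core k'"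
    using top_subset[of k'] by (auto simp: Bs_def core_def)
  moreover have "card ((top_part k' \<union> Bs) \<union> core k') = card (top_part k' \<union> Bs) + card (core k')"
    using finite_parts fin_AB by (intro card_Un_disjoint) (auto simp: Bs_def core_def)
  moreover have "card (top_part k' \<union> Bs) = card (top_part k') + card Bs"
    using finite_parts fin_AB by (intro card_Un_disjoint) (auto simp: Bs_def)
  ultimately show ?thesis using dstar_eq[of k'] card_top[OF kk(2)] by simp
qed

text \<open>
  The terms equal to \<open>k\<close> beyond the first \<open>k\<close> are removed from the count, which leaves the first \<open>k\<close>
  vertices and the core.  Subtracting 2 gives the degree of a clique vertex with one non-neighbour
  in \<open>B\<close>.
\<close>

lemma dstar_k: "int (dstar d k) - int (delta d k) = int (k + card (core k))"
proof -
  obtain a where a: "a \<in> A" using card_A by blast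
  have aV: "a \<in> V" "a \<notin> top_part k"
    "k < deg E V a" using a Arest by (auto simp: A_def core_def)
  have "k \<le> deg E V u" if "u \<in> top_part k" for u using deg_le_top[OF that aV(1,2)] aV(3) by simp
  then have "{v \<in> V. k \<le> deg E V v} = (top_part k \<union> core k) \<union> {v \<in> V - top_part k. deg E V v = k}"
    using top_subset[of k] by (auto simp: core_def)
  moreover have "card ((top_part k \<union> core k) \<union> {v \<in> V - top_part k. deg E V v = k}) =
    card (top_part k \<union> core k) + card {v \<in> V - top_part k. deg E V v = k}"
    using finite_parts finV by (intro card_Un_disjoint) (auto simp: core_def)
  moreover have "card (top_part k \<union> core k) = k + card (core k)"
    using card_Un_disjoint[OF finite_parts(1,3) parts(3)] card_top kk by simp
  ultimately show ?thesis using dstar_eq[of k] delta_eq[of k] kk by simp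
qed

text \<open>
  Condition (a)(ii) speaks of all terms strictly between \<open>k\<close> and \<open>k'\<close>; they belong to vertices in \<open>B\<close>
  once the clique vertices are known to have larger degree.
\<close>

lemma B_iff:
  assumes "\<And>a. a \<in> A \<Longrightarrow> k' \<le> deg E V a"
    and "i \<in> {1..length d}" "k < seq_term d i" "seq_term d i < k'"
  shows "vt i \<in> B" "seq_term d i = deg E V (vt i)"
proof -
  have i: "i \<in> {1..n}" using assms(2) by simp
  show s: "seq_term d i = deg E V (vt i)" using seq_term[OF i] .
  have v: "vt i \<in> V" using vt_V i by blast
  obtain a where a: "a \<in> A" using card_A by blast
  have "vt i \<notin> top_part k'"
  proof
    assume t: "vt i \<in> top_part k'"
    have "vt i \<notin> A" using assms(1)[of "vt i"] assms(4) s by auto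
    then have "vt i \<in> top_part k" using t by (simp add: A_def)
    moreover have "a \<in> V" "a \<notin> top_part k" using a top_subset by (auto simp: A_def)
    ultimately have "deg E V a \<le> deg E V (vt i)" by (rule deg_le_top)
    then show False using assms(1)[OF a] assms(4) s by simp
  qed
  then show "vt i \<in> B" using v assms(3,4) s by (simp add: B_def)
qed

lemma constructible_step:
  assumes good: "constructible E (core k')" and st: "star_type E A B"
  shows "constructible E (core k)"
proof -
  have "constructible E (Bs \<union> core k')" using constructible_add_isolated[OF good dec_Bs] .
  then have "constructible E (A \<union> B \<union> (Bs \<union> core k'))" using dec_A st by (intro constructible.attach)
  then show ?thesis using core_k_eq by simp
qed

lemma star_type_of_cond_ii:
  assumes "cond_a_ii d k k'"
  shows "star_type E A B"
proof -
  obtain c where c: "c \<in> {k + 1, k' - 1}"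
    "\<And>i. i \<in> {1..length d} \<Longrightarrow> k < seq_term d i \<Longrightarrow> seq_term d i < k' \<Longrightarrow> seq_term d i = c"
    using assms unfolding cond_a_ii_def by blast
  have B: "deg E V b = c" if b: "b \<in> B" for b
  proof -
    have "b \<in> vt ` {1..n}" using b vt_V by (auto simp: B_def)
    then obtain i where i: "i \<in> {1..n}" "b = vt i" by blast
    then show ?thesis using c(2)[of i] seq_term[OF i(1)] b by (simp add: B_def)
  qed
  show ?thesis
  proof (cases "c = k + 1")
    case True
    then have "stars E A B" unfolding stars_def using B deg_B(1) by fastforce
    then show ?thesis by (simp add: star_type_def)
  next
    case False
    then have "c = k' - 1" using c(1) by simp
    have "deg (co E) A b = 1" if "b \<in> B" for b
      using deg_B[OF that] B[OF that] \<open>c = k' - 1\<close> kk by simp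
    then show ?thesis by (simp add: star_type_def stars_def)
  qed
qed

text \<open>
  The case of a common clique degree below \<open>k'\<close> has to be excluded: the clique would then have no
  neighbour outside the first \<open>k'\<close> vertices, and at most \<open>k\<close> terms would be at least \<open>k'\<close>.
\<close>

lemma star_type_of_cond_i:
  assumes "cond_a_i d k k'" "k + 2 \<le> k'"
  shows "star_type E A B"
proof -
  obtain c where c: "\<And>i. i \<in> {k<..k'} \<Longrightarrow> seq_term d i = c"
    "int c \<in> {int (dstar d k'), int (dstar d k) - int (delta d k) - 2}"
    using assms unfolding cond_a_i_def by blast
  have A: "deg E V a = c" if a: "a \<in> A" for a
  proof -
    have "a \<in> vt ` {k + 1..k'}" using a vt_diff[of k k'] kk by (simp add: A_def)
    then obtain i where i: "i \<in> {k + 1..k'}" "a = vt i" by blast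
    then show ?thesis using c(1)[of i] seq_term[of i] kk by simp
  qed
  obtain a0 where a0: "a0 \<in> A" using card_A by blast
  show ?thesis
  proof (cases "c = dstar d k'")
    case True
    have "k' \<le> c"
    proof (rule ccontr)
      assume "\<not> k' \<le> c"
      then have ck: "c = k' - 1" "card (core k') = 0" "card Bs = 0"
        using deg_A(1)[OF a0] A[OF a0] by linarith+
      then have empty: "core k' = {}" "Bs = {}" using finite_parts fin_AB by auto
      have "{v \<in> V. k' \<le> deg E V v} \<subseteq> top_part k"
      proof
        fix v assume v: "v \<in> {v \<in> V. k' \<le> deg E V v}"
        have "v \<in> top_part k'"
        proof (rule ccontr)
          assume "v \<notin> top_part k'"
          moreover have "k' < deg E V v \<or> deg E V v = k'" using v by auto
          ultimately have "v \<in> core k' \<or> v \<in> Bs" using v unfolding core_def Bs_def by blast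
          then show False using empty by blast
        qed
        moreover have "v \<notin> A" using v A[of v] \<open>\<not> k' \<le> c\<close> by auto
        ultimately show "v \<in> top_part k" by (simp add: A_def)
      qed
      then have "dstar d k' \<le> k"
        using card_mono[OF finite_parts(1)] card_top[of k] kk dstar_eq[of k'] by (metis less_le_trans less_imp_le)
      then show False using True ck(1) assms(2) by simp
    qed
    then have "dstar d k' = k' + card Bs + card (core k')" using A by (intro dstar_k') simp
    then have "deg E B a = 1" if "a \<in> A" for a using deg_A(1)[OF that] A[OF that] True kk by simp
    then show ?thesis by (simp add: star_type_def stars_def)
  next
    case False
    then have "int c = int (k + card (core k)) - 2" using c(2) dstar_k by simp
    then have "deg (co E) B a = 1" if "a \<in> A" for a using deg_A(2)[OF that] A[OF that] by linarith
    then show ?thesis by (simp add: star_type_def stars_def)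
  qed
qed

text \<open>
  Any decomposition of the bipartite graph between \<open>A\<close> and \<open>B\<close> refines the one at \<open>k\<close> and would
  produce an equality strictly between \<open>k\<close> and \<open>k'\<close>, so \<open>bip_indecomposable\<close> applies.  Its four star
  types correspond to the four values allowed by condition (a).
\<close>

lemma cond_of_hereditarily_unique:
  assumes hu: "hereditarily_unique E V" and two: "k + 2 \<le> k'"
    and gap: "\<And>j. k < j \<Longrightarrow> j < k' \<Longrightarrow> \<not> EG_equality d j"
  shows "cond_a_i d k k' \<or> cond_a_ii d k k'"
proof -
  have ABV: "A \<union> B \<subseteq> V" using top_subset by (auto simp: A_def B_def)
  have "decomp E A B {}" using decomp_subset[OF dec_A, of A B "{}"] by simp
  then have free: "bip_free E A B" by (rule bip_free_split[OF E finV hu ABV])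
  have star: "bip_star_type E A B"
  proof (rule bip_indecomposable[OF free fin_AB(1,2)])
    show "2 \<le> card A" using card_A two by simp
    fix A1 B1 assume sub: "A1 \<subseteq> A" "B1 \<subseteq> B"
      and full: "\<forall>a\<in>A1. \<forall>b\<in>B - B1. E a b" and none: "\<forall>a\<in>A - A1. \<forall>b\<in>B1. \<not> E a b"
    let ?C = "(A - A1) \<union> (B - B1) \<union> (Bs \<union> core k')"
    note D = decompD[OF dec_A]
    have none': "\<not> E b a" if "b \<in> B1" "a \<in> A - A1" for a b
      using none that sgraph_sym[OF E, of a b] by simp
    have "decomp E A1 B1 ?C"
    proof (rule decompI)
      show "a \<noteq> b" if "a \<in> A1" "b \<in> B1" for a b using D(4) that sub by blast
      show "a \<noteq> c" if "a \<in> A1" "c \<in> ?C" for a c using D(4,5) that sub by blast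
      show "b \<noteq> c" if "b \<in> B1" "c \<in> ?C" for b c using D(4,6) that sub by blast
      show "E a a'" if "a \<in> A1" "a' \<in> A1" "a \<noteq> a'" for a a' using D(7) that sub by blast
      show "\<not> E b b'" if "b \<in> B1" "b' \<in> B1" for b b' using D(8) that sub by blast
      show "E a c" if a: "a \<in> A1" and c: "c \<in> ?C" for a c
      proof -
        consider "c \<in> A - A1" | "c \<in> B - B1" | "c \<in> Bs \<union> core k'" using c by blast
        then show ?thesis
        proof cases
          case 1
          then have "a \<in> A" "c \<in> A" "a \<noteq> c" using a sub by auto
          then show ?thesis by (rule D(7))
        next
          case 2
          then show ?thesis using full a by blast
        next
          case 3
          have "a \<in> A" using a sub by auto
          then show ?thesis using D(9) 3 by blast
        qed
      qed
      show "\<not> E b c" if b: "b \<in> B1" and c: "c \<in> ?C" for b c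
      proof -
        have bB: "b \<in> B" using b sub by auto
        consider "c \<in> A - A1" | "c \<in> B - B1" | "c \<in> Bs \<union> core k'" using c by blast
        then show ?thesis
        proof cases
          case 1
          then show ?thesis using none' b by blast
        next
          case 2
          then show ?thesis using D(8)[OF bB] by blast
        next
          case 3
          then show ?thesis using D(10)[OF bB] by blast
        qed
      qed
    qed
    moreover have "core k = A1 \<union> B1 \<union> ?C" using core_k_eq sub by blast
    ultimately have EG: "EG_equality d (k + card A1)"
      using EG_equality_of_refinement[of k A1 B1 ?C] kk EGk by simp
    have finA1: "finite A1" using sub fin_AB finite_subset by blast
    have cA1: "card A1 \<le> k' - k" using card_mono[OF fin_AB(1) sub(1)] card_A by simp
    have "\<not> (0 < card A1 \<and> card A1 < k' - k)"
    proof
      assume "0 < card A1 \<and> card A1 < k' - k"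
      then have "k < k + card A1" "k + card A1 < k'" by linarith+
      then show False using gap EG by blast
    qed
    then consider "card A1 = 0" | "card A1 = card A" using cA1 card_A by linarith
    then show "A1 = {} \<and> B1 = {} \<or> A1 = A \<and> B1 = B"
    proof cases
      case 1
      then have "A1 = {}" using finA1 by simp
      moreover have "b \<notin> B1" for b
      proof
        assume b: "b \<in> B1"
        then have bB: "b \<in> B" using sub by auto
        have "deg E A b = 0" unfolding deg_eq_0_iff[OF fin_AB(1)] using none' b \<open>A1 = {}\<close> by blast
        then show False using deg_B(1)[OF bB] bB by (simp add: B_def)
      qed
      ultimately show ?thesis by blast
    next
      case 2
      then have AA: "A1 = A" using card_subset_eq[OF fin_AB(1) sub(1)] by simp
      have "b \<in> B1" if b: "b \<in> B" for b
      proof (rule ccontr)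
        assume "b \<notin> B1"
        then have "\<forall>a\<in>A. E b a" using full AA b sgraph_sym[OF E] by blast
        then have "deg E A b = card A" using deg_eq_card_iff[OF fin_AB(1)] by blast
        then show False using deg_B(1)[OF b] card_A b kk by (simp add: B_def)
      qed
      then show ?thesis using AA sub by blast
    qed
  qed
  have ge_if_nbr: "k' \<le> deg E V a" if "a \<in> A" "b \<in> B" "E a b" for a b
  proof -
    have "1 \<le> deg E B a" unfolding deg_ge_1_iff[OF fin_AB(2)] using that by blast
    then show ?thesis using deg_A(1)[OF that(1)] kk by simp
  qed
  have ii: "cond_a_ii d k k'"
    if c: "c \<in> {k + 1, k' - 1}" "\<And>b. b \<in> B \<Longrightarrow> deg E V b = c" and ge: "\<And>a. a \<in> A \<Longrightarrow> k' \<le> deg E V a" for c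
    unfolding cond_a_ii_def
  proof (rule bexI[OF _ c(1)], intro ballI impI)
    fix i assume "i \<in> {1..length d}" "k < seq_term d i \<and> seq_term d i < k'"
    then show "seq_term d i = c" using B_iff[OF ge, of i] c(2) by metis
  qed
  have i: "cond_a_i d k k'"
    if c: "int c \<in> {int (dstar d k'), int (dstar d k) - int (delta d k) - 2}" "\<And>a. a \<in> A \<Longrightarrow> deg E V a = c" for c
    unfolding cond_a_i_def
  proof (intro exI[of _ c] conjI ballI c(1))
    fix i assume i: "i \<in> {k<..k'}"
    then have "vt i \<in> A" using vt_diff[of k k'] kk by (auto simp: A_def)
    moreover have "i \<in> {1..n}" using i kk by simp
    ultimately show "seq_term d i = c" using c(2) seq_term by simp
  qed
  have swap: "E a b \<longleftrightarrow> E b a" for a b using sgraph_sym[OF E] .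
  have co_AB: "co E b a \<longleftrightarrow> \<not> E a b"
    "co E a b \<longleftrightarrow> \<not> E a b" if "a \<in> A" "b \<in> B" for a b
    using decompD(4)[OF dec_A that] swap[of a b] by (auto simp: co_def)
  from star consider
      "bip_stars E A B" | "bip_stars (\<lambda>a b. \<not> E a b) A B"
    | "bip_stars (\<lambda>b a. E a b) B A" | "bip_stars (\<lambda>b a. \<not> E a b) B A"
    unfolding bip_star_type_def by blast
  then show ?thesis
  proof cases
    case 1
    note st = 1[unfolded bip_stars_def]
    have "deg E V b = k + 1" if b: "b \<in> B" for b
    proof -
      have "\<exists>!a. a \<in> A \<and> E b a" using st[THEN conjunct1] b swap[of b] by simp
      then have "deg E A b = 1" by (simp only: deg_eq_1_iff)
      then show ?thesis using deg_B(1)[OF b] by simp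
    qed
    moreover have "k' \<le> deg E V a" if "a \<in> A" for a
      using st[THEN conjunct2, THEN conjunct1] that ge_if_nbr by blast
    ultimately show ?thesis using ii[of "k + 1"] by simp
  next
    case 2
    note st = 2[unfolded bip_stars_def]
    have uniq: "\<exists>!a. a \<in> A \<and> \<not> E a b" if "b \<in> B" for b using st[THEN conjunct1] that by blast
    have "deg E V b = k' - 1" if b: "b \<in> B" for b
    proof -
      have "\<exists>!a. a \<in> A \<and> co E b a" using uniq[OF b] co_AB b by metis
      then have "deg (co E) A b = 1" by (simp only: deg_eq_1_iff)
      then show ?thesis using deg_B[OF b] kk by simp
    qed
    moreover have "k' \<le> deg E V a" if a: "a \<in> A" for a
    proof -
      obtain a' where a': "a' \<in> A" "a' \<noteq> a" using st[THEN conjunct2, THEN conjunct2] by metis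
      obtain b where b: "b \<in> B" "\<not> E a' b" using st[THEN conjunct2, THEN conjunct1] a'(1) by blast
      have "E a b" using uniq[OF b(1)] a a' b(2) by blast
      then show ?thesis using ge_if_nbr a b(1) by blast
    qed
    ultimately show ?thesis using ii[of "k' - 1"] by simp
  next
    case 3
    note st = 3[unfolded bip_stars_def]
    have one: "deg E B a = 1" if "a \<in> A" for a
      unfolding deg_eq_1_iff using st[THEN conjunct1] that by blast
    have "k' \<le> deg E V a" if "a \<in> A" for a using deg_A(1)[OF that] one[OF that] kk by simp
    then have "dstar d k' = k' + card Bs + card (core k')" by (rule dstar_k')
    then have "deg E V a = dstar d k'" if "a \<in> A" for a using deg_A(1)[OF that] one[OF that] kk by simp
    then show ?thesis using i[of "dstar d k'"] by simp
  next
    case 4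
    note st = 4[unfolded bip_stars_def]
    have one: "deg (co E) B a = 1" if a: "a \<in> A" for a
    proof -
      have "\<exists>!b. b \<in> B \<and> \<not> E a b" using st[THEN conjunct1] a by blast
      then have "\<exists>!b. b \<in> B \<and> co E a b" using co_AB(2)[OF a] by metis
      then show ?thesis by (simp only: deg_eq_1_iff)
    qed
    have eq: "deg E V a = k + card (core k) - 2" "2 \<le> k + card (core k)" if "a \<in> A" for a
      using deg_A(2)[OF that] one[OF that] by linarith+
    obtain a0 where "a0 \<in> A" using card_A by blast
    then have "int (k + card (core k) - 2) = int (dstar d k) - int (delta d k) - 2"
      using dstar_k eq(2) by simp
    then show ?thesis using i[of "k + card (core k) - 2"] eq(1) by simp
  qed
qed

end

section \<open>The conditions on the degree sequence\<close>

lemma top_diff_subset_rest: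
  assumes k: "k + 2 \<le> k'" "k' \<le> n" "EG_equality d k'"
  shows "top_part k' - top_part k \<subseteq> core k"
proof
  fix a assume a: "a \<in> top_part k' - top_part k"
  have "deg E V a = k' - 1 + card (core k') + deg E (low_part k') a"
    using decomp_deg_clique[OF E finite_parts(1,2,3), of k' k' k' a] EG_equality_iff_decomp[OF k(2)] k a
      parts(1)[of k'] card_top[OF k(2)] by simp
  then show "a \<in> core k" using a top_subset k by (auto simp: core_def)
qed

lemma top_Suc_subset_rest:
  assumes "Suc k \<le> n" "core k \<noteq> {}"
  shows "top_part (Suc k) - top_part k \<subseteq> core k"
proof
  fix a assume a: "a \<in> top_part (Suc k) - top_part k"
  obtain r where r: "r \<in> V" "r \<notin> top_part k"
    "k < deg E V r" using assms(2) by (auto simp: core_def)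
  have "card (top_part (Suc k) - top_part k) = 1"
    using card_Diff_subset[OF finite_parts(1) top_mono, of k "Suc k"] card_top assms by simp
  then have single: "top_part (Suc k) - top_part k = {a}" using a by (metis card_1_singletonE singletonD)
  have "k < deg E V a"
  proof (cases "r \<in> top_part (Suc k)")
    case True
    then show ?thesis using single r by auto
  next
    case False
    then show ?thesis using deg_le_top[of a "Suc k" r] a r by simp
  qed
  then show "a \<in> core k" using a top_subset by (auto simp: core_def)
qed

definition EG_cond :: bool where
  "EG_cond \<longleftrightarrow> (\<forall>k k'. consecutive_in (EG d) k k' \<and> k' \<ge> k + 2 \<longrightarrow>
       cond_a_i d k k' \<or> cond_a_ii d k k') \<and>
    (let t = last (EG d); w = tail_terms d t in
       w \<noteq> [] \<longrightarrow>
       (\<exists>r s. r \<ge> 2 \<and> s \<ge> 1 \<and>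
          (w = replicate 5 (t + 2) \<or>
           w = replicate (2 * r) (t + 1) \<or>
           w = (t + r) # replicate (2 * s + r) (t + 1) \<or>
           w = replicate (2 * r) (t + 2 * r - 2) \<or>
           w = replicate (2 * s + r) (t + 2 * s + r - 1) @ [t + 2 * s])))"

lemma EG_equality_0: "EG_equality d 0"
  by (simp add: EG_equality_def)

lemma consecutive_EG:
  "consecutive_in (EG d) k k' \<longleftrightarrow> k < k' \<and> k' \<le> n \<and> EG_equality d k \<and> EG_equality d k' \<and>
     (\<forall>j. k < j \<and> j < k' \<longrightarrow> \<not> EG_equality d j)"
  unfolding EG_def consecutive_in_filter_upt by auto

lemma last_EG:
  "EG_equality d (last (EG d))" "last (EG d) \<le> n"
  "i \<le> n \<Longrightarrow> EG_equality d i \<Longrightarrow> i \<le> last (EG d)"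
  unfolding EG_def using last_filter_upt[of "EG_equality d" 0 "length d + 1"] EG_equality_0 by auto

lemma deg_core:
  assumes "t \<le> n" "EG_equality d t" "v \<in> core t"
  shows "deg E V v = t + deg E (core t) v"
  using decomp_deg_core[OF E finite_parts(1,2,3), of t t t v] EG_equality_iff_decomp[OF assms(1)] assms
    parts(1)[of t] card_top[OF assms(1)] by simp

lemma constructible_last_core:
  assumes EG_cond
  shows "constructible E (core (last (EG d)))"
proof -
  define t where "t = last (EG d)"
  have t: "t \<le> n" "EG_equality d t" using last_EG by (simp_all add: t_def)
  obtain ws where ws: "tail_terms d t = map (deg E V) ws" "distinct ws" "set ws = core t"
    using tail_terms_eq[OF t(1)] by blast
  have card: "card (core t) = length ws" using ws(2,3) distinct_card by metis
  have deg: "deg E V v = t + deg E (core t) v" if "v \<in> core t" for v using deg_core[OF t that] .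
  have codeg: "deg (co E) (core t) v + deg E (core t) v = length ws - 1" if "v \<in> core t" for v
    using deg_co_inside[OF E finite_parts(3) that] card by simp
  have all: "deg E V v = c" if "map (deg E V) us = replicate m c" "v \<in> set us" for us m c v
  proof -
    have "deg E V v \<in> set (map (deg E V) us)" using that(2) by simp
    then show ?thesis unfolding that(1) by (simp split: if_splits)
  qed
  have len: "length us = m" if "map (deg E V) us = replicate m c" for us m c
    using arg_cong[OF that, of length] by simp
  show ?thesis
    unfolding t_def[symmetric]
  proof (cases "ws = []")
    case True
    then show "constructible E (core t)" using ws(3) constructible_empty by simp
  next
    case False
    then have "map (deg E V) ws \<noteq> []" by simp
    then obtain r s where rs: "r \<ge> 2" "s \<ge> 1" and w:
      "map (deg E V) ws = replicate 5 (t + 2) \<or>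
       map (deg E V) ws = replicate (2 * r) (t + 1) \<or>
       map (deg E V) ws = (t + r) # replicate (2 * s + r) (t + 1) \<or>
       map (deg E V) ws = replicate (2 * r) (t + 2 * r - 2) \<or>
       map (deg E V) ws = replicate (2 * s + r) (t + 2 * s + r - 1) @ [t + 2 * s]"
      using assms unfolding EG_cond_def Let_def t_def[symmetric] ws(1) by metis
    from w show "constructible E (core t)"
    proof (elim disjE)
      assume w: "map (deg E V) ws = replicate 5 (t + 2)"
      have "deg E (core t) v = 2" if "v \<in> core t" for v using all[OF w] deg[OF that] ws(3) that by simp
      then have "five_cycle E (core t)" using card len[OF w] by (simp add: five_cycle_def)
      then show ?thesis by (rule constructible.five_cycle)
    next
      assume w: "map (deg E V) ws = replicate (2 * r) (t + 1)"
      have "deg E (core t) v = 1" if "v \<in> core t" for v using all[OF w] deg[OF that] ws(3) that by simp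
      then show ?thesis by (intro constructible.near_matching) (simp add: near_matching_def)
    next
      assume w: "map (deg E V) ws = (t + r) # replicate (2 * s + r) (t + 1)"
      then obtain c cs where c: "ws = c # cs" "map (deg E V) cs = replicate (2 * s + r) (t + 1)"
        by (cases ws) auto
      have "deg E (core t) v \<le> 1" if "v \<in> core t" "v \<noteq> c" for v
      proof -
        have "v \<in> set cs" using ws(3) c(1) that by auto
        then show ?thesis using all[OF c(2), of v] deg[OF that(1)] by simp
      qed
      then show ?thesis by (intro constructible.near_matching) (auto simp: near_matching_def)
    next
      assume w: "map (deg E V) ws = replicate (2 * r) (t + 2 * r - 2)"
      have "deg (co E) (core t) v = 1" if "v \<in> core t" for v
        using all[OF w, of v] deg[OF that] codeg[OF that] len[OF w] ws(3) that rs by simp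
      then show ?thesis by (intro constructible.co_near_matching) (simp add: near_matching_def)
    next
      assume w: "map (deg E V) ws = replicate (2 * s + r) (t + 2 * s + r - 1) @ [t + 2 * s]"
      then obtain c cs where c: "ws = cs @ [c]" "map (deg E V) cs = replicate (2 * s + r) (t + 2 * s + r - 1)"
        by (cases ws rule: rev_cases) auto
      have "deg (co E) (core t) v \<le> 1" if "v \<in> core t" "v \<noteq> c" for v
      proof -
        have "v \<in> set cs" using ws(3) c(1) that by auto
        then have "t + deg E (core t) v = t + 2 * s + r - 1"
          using all[OF c(2), of v] deg[OF that(1)] by simp
        then show ?thesis using codeg[OF that(1)] len[OF c(2)] c(1) rs by simp
      qed
      then show ?thesis by (intro constructible.co_near_matching) (auto simp: near_matching_def)
    qed
  qed
qed

text \<open>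
  Induction from the last equality backwards: the core at \<open>k\<close> arises from the core at the next equality
  by attaching one split piece.
\<close>

theorem constructible_of_EG_cond:
  assumes cond: EG_cond
  shows "constructible E V"
proof -
  have good: "constructible E (core k)" if "k \<le> n" "EG_equality d k" for k
    using that
  proof (induction "n - k" arbitrary: k rule: less_induct)
    case less
    show ?case
    proof (cases "\<exists>j. k < j \<and> j \<le> n \<and> EG_equality d j")
      case False
      then have "k = last (EG d)" using last_EG less.prems by (metis le_neq_implies_less)
      then show ?thesis using constructible_last_core[OF cond] by simp
    next
      case True
      define k' where "k' = (LEAST j. k < j \<and> j \<le> n \<and> EG_equality d j)"
      have k': "k < k'" "k' \<le> n"
        "EG_equality d k'" using LeastI_ex[OF True] by (simp_all add: k'_def)
      have gap: "\<not> EG_equality d j" if "k < j" "j < k'" for j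
        using not_less_Least[of j "\<lambda>j. k < j \<and> j \<le> n \<and> EG_equality d j"] that k'(2) by (auto simp: k'_def)
      have IH: "constructible E (core k')" using less.hyps[of k'] k' by simp
      show ?thesis
      proof (cases "k + 2 \<le> k'")
        case True
        then have "consecutive_in (EG d) k k'" unfolding consecutive_EG using k' less.prems gap by blast
        then have "cond_a_i d k k' \<or> cond_a_ii d k k'" using cond True unfolding EG_cond_def by blast
        moreover have Ar: "top_part k' - top_part k \<subseteq> core k" using top_diff_subset_rest[OF True k'(2,3)] .
        ultimately have "star_type E (top_part k' - top_part k) {v \<in> V - top_part k'. k < deg E V v \<and> deg E V v < k'}"
          using star_type_of_cond_i[OF k'(1,2) less.prems(2) k'(3) Ar _ True]
            star_type_of_cond_ii[OF k'(1,2) less.prems(2) k'(3) Ar] by blast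
        then show ?thesis using constructible_step[OF k'(1,2) less.prems(2) k'(3) Ar IH] by blast
      next
        case False
        then have Sk: "k' = Suc k" using k' by simp
        show ?thesis
        proof (cases "core k = {}")
          case True
          then show ?thesis using constructible_empty by simp
        next
          case False
          have Ar: "top_part k' - top_part k \<subseteq> core k" using top_Suc_subset_rest[OF _ False] k' Sk by simp
          have empty: "{v \<in> V - top_part k'. k < deg E V v \<and> deg E V v < k'} = {}" using Sk by auto
          have "star_type E (top_part k' - top_part k) {}" by (simp add: star_type_def stars_def)
          then have "star_type E (top_part k' - top_part k) {v \<in> V - top_part k'. k < deg E V v \<and> deg E V v < k'}"
            by (simp only: empty)
          then show ?thesis using constructible_step[OF k'(1,2) less.prems(2) k'(3) Ar IH] by blast
        qed
      qed
    qed
  qed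
  have "decomp E (top_part 0) (low_part 0) (core 0)" using EG_equality_iff_decomp[of 0] EG_equality_0 by simp
  then have "decomp E {} (low_part 0) (core 0)" by (simp add: top_part_def)
  then have "constructible E (low_part 0 \<union> core 0)" using good[of 0] EG_equality_0 by (intro constructible_add_isolated) auto
  then show ?thesis using parts(1)[of 0] by (simp add: top_part_def)
qed

text \<open>
  A clique vertex that could be split off would give an equality beyond the last one, and the degrees
  in the core exceed \<open>t\<close>, so that it has no isolated vertex.
\<close>

lemma last_core_indecomposable:
  assumes dec: "decomp E D N C" and C: "core (last (EG d)) = D \<union> N \<union> C"
  shows "D = {}" "N = {}"
proof -
  define t where "t = last (EG d)"
  have t: "t \<le> n" "EG_equality d t" using last_EG by (simp_all add: t_def)
  have fin: "finite D" "finite N" "finite C" using finite_parts(3)[of t] C by (auto simp: t_def)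
  have "t + card D \<le> t"
    using EG_equality_of_refinement[OF t dec] C last_EG(3)[of "t + card D"] by (simp add: t_def)
  then show D: "D = {}" using fin by simp
  show "N = {}"
  proof (rule ccontr)
    assume "N \<noteq> {}"
    then obtain v where v: "v \<in> N" by blast
    have "deg E (D \<union> N \<union> C) v = deg E D v" using decomp_deg_indep[OF E fin dec v] .
    then have "deg E (core t) v = 0" using C D by (simp add: t_def)
    moreover have "v \<in> core t" using v C by (simp add: t_def)
    ultimately have "deg E V v = t" using deg_core[OF t] by simp
    then show False using \<open>v \<in> core t\<close> by (simp add: core_def)
  qed
qed

text \<open>
  The core after the last equality cannot be decomposed, so it is one of the pieces found in
  \<open>hereditarily_unique_structure\<close>, and a split piece is impossible.  A star with \<open>r\<close> leaves and \<open>s\<close>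
  further edges gives the second or third sequence in (b), depending on whether \<open>r = 1\<close>, and its
  complement the fourth or fifth.
\<close>

theorem EG_cond_of_hereditarily_unique:
  assumes hu: "hereditarily_unique E V"
  shows EG_cond
proof -
  define t where "t = last (EG d)"
  have t: "t \<le> n" "EG_equality d t" using last_EG by (simp_all add: t_def)
  obtain ws where ws: "tail_terms d t = map (deg E V) ws" "distinct ws" "set ws = core t"
    "sorted_wrt (\<ge>) (map (deg E V) ws)"
    using tail_terms_eq[OF t(1)] by blast
  let ?w = "map (deg E V) ws"
  have card: "card (core t) = length ws" using ws(2,3) distinct_card by metis
  have deg: "deg E V v = t + deg E (core t) v" if "v \<in> core t" for v using deg_core[OF t that] .
  have codeg: "deg (co E) (core t) v + deg E (core t) v = length ws - 1" if "v \<in> core t" for v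
    using deg_co_inside[OF E finite_parts(3) that] card by simp
  have const: "?w = replicate (length ws) (t + c)" if "\<And>v. v \<in> core t \<Longrightarrow> deg E (core t) v = c" for c
  proof -
    have "\<forall>x\<in>set ?w. x = t + c" using that deg ws(3) by simp
    then have "?w = replicate (length ?w) (t + c)" by (metis replicate_length_same)
    then show ?thesis by simp
  qed
  \<comment> \<open>A descending list is determined by its elements with multiplicity, so it is enough to
    know the degree of the centre z and the common degree of all other vertices.\<close>
  have w_unique: "?w = u"
    if z: "z \<in> core t" "deg E (core t) z = b" and others: "\<And>v. v \<in> core t \<Longrightarrow> v \<noteq> z \<Longrightarrow> deg E (core t) v = c"
      and u: "sorted_wrt (\<ge>) u" "mset u = add_mset (t + b) (replicate_mset (length ws - 1) (t + c))" for z b c u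
  proof (rule sorted_desc_unique[OF ws(4) u(1)])
    have "mset ?w = image_mset (deg E V) (mset_set (core t))"
      using ws(2,3) by (simp add: mset_set_set[symmetric])
    also have "core t = insert z (core t - {z})" using z by blast
    also have "image_mset (deg E V) (mset_set (insert z (core t - {z}))) =
      add_mset (deg E V z) (image_mset (deg E V) (mset_set (core t - {z})))"
      using finite_parts(3) by (simp del: insert_Diff_single)
    also have "image_mset (deg E V) (mset_set (core t - {z})) = image_mset (\<lambda>_. t + c) (mset_set (core t - {z}))"
      using others deg finite_parts(3) by (intro image_mset_cong) simp
    also have "\<dots> = replicate_mset (length ws - 1) (t + c)"
      using z card finite_parts(3) by (simp add: image_mset_const_eq card_Diff_singleton)
    finally show "mset ?w = mset u" using u(2) deg[OF z(1)] z(2) by simp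
  qed
  have huC: "hereditarily_unique E (core t)" using hu by (rule hereditarily_unique_subset) (auto simp: core_def)
  have tail: "\<exists>r s. r \<ge> 2 \<and> s \<ge> 1 \<and>
          (?w = replicate 5 (t + 2) \<or>
           ?w = replicate (2 * r) (t + 1) \<or>
           ?w = (t + r) # replicate (2 * s + r) (t + 1) \<or>
           ?w = replicate (2 * r) (t + 2 * r - 2) \<or>
           ?w = replicate (2 * s + r) (t + 2 * s + r - 1) @ [t + 2 * s])"
    if ne: "?w \<noteq> []"
    using E finite_parts(3) huC
  proof (cases rule: hereditarily_unique_structure)
    case (matching D N C z)
    then have C: "core t = C" using last_core_indecomposable[OF matching(2)] by (simp add: t_def)
    obtain s where s: "z \<in> C" "1 \<le> deg E C z"
      "\<And>v. v \<in> C \<Longrightarrow> v \<noteq> z \<Longrightarrow> deg E C v = 1"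
      "s \<ge> 1" "card C = deg E C z + 1 + 2 * s"
      using star_matching_degrees[OF E _ matching(3)] C finite_parts(3)[of t] by metis
    show ?thesis
    proof (cases "deg E C z = 1")
      case True
      then have "\<And>v. v \<in> core t \<Longrightarrow> deg E (core t) v = 1" using s(3) C by metis
      then have "?w = replicate (length ws) (t + 1)" by (rule const)
      moreover have "length ws = 2 * (s + 1)" using s(5) True card C by simp
      ultimately have "?w = replicate (2 * (s + 1)) (t + 1)" by simp
      moreover have "s + 1 \<ge> 2" using s(4) by simp
      ultimately show ?thesis using s(4) by (intro exI[of _ "s + 1"] exI[of _ s]) (simp only: simp_thms)
    next
      case False
      define r where "r = deg E C z"
      have r: "r \<ge> 2" using False s(2) by (simp add: r_def)
      have "?w = (t + r) # replicate (2 * s + r) (t + 1)"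
      proof (rule w_unique)
        show "z \<in> core t" "deg E (core t) z = r" using s(1) C by (simp_all add: r_def)
        show "deg E (core t) v = 1" if "v \<in> core t" "v \<noteq> z" for v using s(3) that C by simp
        show "sorted_wrt (\<ge>) ((t + r) # replicate (2 * s + r) (t + 1))"
          using r by (simp add: sorted_wrt_ge_replicate del: replicate_add)
        have "length ws - 1 = 2 * s + r" using card C s(5) by (simp add: r_def)
        then show "mset ((t + r) # replicate (2 * s + r) (t + 1)) =
          add_mset (t + r) (replicate_mset (length ws - 1) (t + 1))" by simp
      qed
      then show ?thesis using r s(4) by (intro exI[of _ r] exI[of _ s]) (simp only: simp_thms)
    qed
  next
    case (co_matching D N C z)
    then have C: "core t = C" using last_core_indecomposable[OF co_matching(2)] by (simp add: t_def)
    obtain s where s: "z \<in> C" "1 \<le> deg (co E) C z"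
      "\<And>v. v \<in> C \<Longrightarrow> v \<noteq> z \<Longrightarrow> deg (co E) C v = 1"
      "s \<ge> 1" "card C = deg (co E) C z + 1 + 2 * s"
      using star_matching_degrees[OF sgraph_co[OF E] _ co_matching(3)] C finite_parts(3)[of t] by metis
    define r where "r = deg (co E) C z"
    have len: "length ws = r + 1 + 2 * s" using card C s(5) by (simp add: r_def)
    have others: "deg E (core t) v = 2 * s + r - 1" if "v \<in> core t" "v \<noteq> z" for v
      using codeg[OF that(1)] s(3)[of v] that C len by simp
    have zdeg: "deg E (core t) z = 2 * s" using codeg[of z] s(1) C len by (simp add: r_def)
    show ?thesis
    proof (cases "r = 1")
      case True
      then have "deg E (core t) v = 2 * s" if "v \<in> core t" for v
        using others[OF that] zdeg by (cases "v = z") auto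
      then have "?w = replicate (length ws) (t + 2 * s)" by (rule const)
      moreover have "length ws = 2 * (s + 1)" using len True by simp
      moreover have "t + 2 * s = t + 2 * (s + 1) - 2" by simp
      ultimately have "?w = replicate (2 * (s + 1)) (t + 2 * (s + 1) - 2)" by metis
      moreover have "s + 1 \<ge> 2" using s(4) by simp
      ultimately show ?thesis using s(4) by (intro exI[of _ "s + 1"] exI[of _ s]) (simp only: simp_thms)
    next
      case False
      then have r: "r \<ge> 2" using s(2) by (simp add: r_def)
      have "?w = replicate (2 * s + r) (t + 2 * s + r - 1) @ [t + 2 * s]"
      proof (rule w_unique)
        show "z \<in> core t" "deg E (core t) z = 2 * s" using s(1) C zdeg by simp_all
        show "deg E (core t) v = 2 * s + r - 1" if "v \<in> core t" "v \<noteq> z" for v using others that .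
        show "sorted_wrt (\<ge>) (replicate (2 * s + r) (t + 2 * s + r - 1) @ [t + 2 * s])"
          using r by (simp add: sorted_wrt_append sorted_wrt_ge_replicate)
        have "length ws - 1 = 2 * s + r" "t + (2 * s + r - 1) = t + 2 * s + r - 1" using len r by simp_all
        then show "mset (replicate (2 * s + r) (t + 2 * s + r - 1) @ [t + 2 * s]) =
          add_mset (t + 2 * s) (replicate_mset (length ws - 1) (t + (2 * s + r - 1)))" by simp
      qed
      then show ?thesis using r s(4) by (intro exI[of _ r] exI[of _ s]) (simp only: simp_thms)
    qed
  next
    case (cycle D N C)
    then have C: "core t = C" using last_core_indecomposable[OF cycle(2)] by (simp add: t_def)
    then have "deg E (core t) v = 2" if "v \<in> core t" for v using cycle(3) that by (simp add: five_cycle_def)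
    then have "?w = replicate (length ws) (t + 2)" by (rule const)
    moreover have "length ws = 5" using card cycle(3) C by (simp add: five_cycle_def)
    ultimately have "?w = replicate 5 (t + 2)" by simp
    moreover have "(2::nat) \<ge> 2" "(1::nat) \<ge> 1" by simp_all
    ultimately show ?thesis by (intro exI[of _ 2] exI[of _ 1]) (simp only: simp_thms)
  next
    case (split A B)
    then have "core t = {}" using last_core_indecomposable[OF split(2)] by (simp add: t_def)
    then show ?thesis using ne ws(3) by simp
  qed
  have "cond_a_i d k k' \<or> cond_a_ii d k k'" if c: "consecutive_in (EG d) k k'" and two: "k + 2 \<le> k'" for k k'
  proof -
    have k: "k < k'" "k' \<le> n" "EG_equality d k" "EG_equality d k'"
      "\<And>j. k < j \<Longrightarrow> j < k' \<Longrightarrow> \<not> EG_equality d j"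
      using c unfolding consecutive_EG by blast+
    show ?thesis
      using cond_of_hereditarily_unique[OF k(1-4) top_diff_subset_rest[OF two k(2,4)] hu two k(5)] .
  qed
  then show ?thesis unfolding EG_cond_def Let_def t_def[symmetric] ws(1) using tail by blast
qed

end

section \<open>From relations to digraphs\<close>

lemma iso_on_sym:
  assumes "iso_on E X E' Y"
  shows "iso_on E' Y E X"
proof -
  obtain f where f: "bij_betw f X Y" "\<And>u v. u \<in> X \<Longrightarrow> v \<in> X \<Longrightarrow> E' (f u) (f v) \<longleftrightarrow> E u v"
    using assms unfolding iso_on_def by metis
  define g where "g = inv_into X f"
  have g: "bij_betw g Y X" unfolding g_def by (rule bij_betw_inv_into[OF f(1)])
  have fg: "f (g y) = y" if "y \<in> Y" for y
    using that f(1) unfolding g_def by (auto simp: bij_betw_def f_inv_into_f)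
  have "E (g u) (g v) \<longleftrightarrow> E' u v" if "u \<in> Y" "v \<in> Y" for u v
    using f(2)[of "g u" "g v"] fg that bij_betw_apply[OF g] by simp
  then show ?thesis using g unfolding iso_on_def by blast
qed

definition edge :: "'a pair_pre_digraph \<Rightarrow> 'a \<Rightarrow> 'a \<Rightarrow> bool" where
  "edge G u v \<longleftrightarrow> (u, v) \<in> parcs G"

definition graph_of :: "('a \<Rightarrow> 'a \<Rightarrow> bool) \<Rightarrow> 'a set \<Rightarrow> 'a pair_pre_digraph" where
  "graph_of E X = \<lparr> pverts = X, parcs = {(u, v). u \<in> X \<and> v \<in> X \<and> E u v} \<rparr>"

lemma graph_of_simps [simp]:
  "pverts (graph_of E X) = X" "edge (graph_of E X) u v \<longleftrightarrow> u \<in> X \<and> v \<in> X \<and> E u v"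
  by (simp_all add: graph_of_def edge_def)

lemma pair_graph_edge:
  assumes "pair_graph G"
  shows "sgraph (edge G)" "finite (pverts G)"
    "edge G u v \<Longrightarrow> u \<in> pverts G" "edge G u v \<Longrightarrow> v \<in> pverts G"
proof -
  interpret pair_graph G by fact
  show "sgraph (edge G)"
    by (rule sgraphI) (auto simp: edge_def dest: arcs_symmetric no_loops')
  show "finite (pverts G)" by (rule pair_finite_verts)
  show "edge G u v \<Longrightarrow> u \<in> pverts G" "edge G u v \<Longrightarrow> v \<in> pverts G"
    by (auto simp: edge_def dest: in_arcsD1 in_arcsD2)
qed

lemma pair_graphI_edge:
  assumes "sgraph (edge G)" "finite (pverts G)"
    and "\<And>u v. edge G u v \<Longrightarrow> u \<in> pverts G \<and> v \<in> pverts G"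
  shows "pair_graph G"
proof -
  have sub: "parcs G \<subseteq> pverts G \<times> pverts G" using assms(3) by (auto simp: edge_def)
  then have "finite (parcs G)" using assms(2) by (meson finite_SigmaI finite_subset)
  moreover have "sym (parcs G)"
    using sgraph_sym[OF assms(1)] by (auto simp: sym_def edge_def)
  moreover have "fst e \<noteq> snd e" if "e \<in> parcs G" for e
    using sgraph_irrefl[OF assms(1), of "fst e"] that by (cases e) (auto simp: edge_def)
  ultimately show ?thesis
    using assms(2) sub by unfold_locales (auto simp: symmetric_def)
qed

lemma out_degree_edge:
  assumes "pair_graph G"
  shows "out_degree (with_proj G) v = deg (edge G) (pverts G) v"
proof -
  have "out_arcs (with_proj G) v = (\<lambda>u. (v, u)) ` {u \<in> pverts G. edge G v u}"
    using pair_graph_edge(4)[OF assms] by (auto simp: out_arcs_def edge_def)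
  then show ?thesis by (simp add: out_degree_def deg_def card_image inj_on_def)
qed

lemma degree_sequence_edge:
  assumes "pair_graph G"
  shows "degree_sequence G = rev (sorted_list_of_multiset
    (image_mset (deg (edge G) (pverts G)) (mset_set (pverts G))))"
  unfolding degree_sequence_def using out_degree_edge[OF assms] by presburger

lemma degree_sequence_eq_imp_card_eq:
  fixes G H :: "'a pair_pre_digraph"
  assumes G: "pair_graph G" "pair_graph H" and eq: "degree_sequence H = degree_sequence G"
  shows "card {v \<in> pverts H. deg (edge H) (pverts H) v = c} = card {v \<in> pverts G. deg (edge G) (pverts G) v = c}"
proof -
  have count: "count (image_mset p (mset_set X)) c = card {x \<in> X. p x = c}"
    if "finite X" for p :: "'a \<Rightarrow> nat" and X
    using that by (simp add: count_image_mset_eq_card_vimage)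
  have "image_mset (deg (edge H) (pverts H)) (mset_set (pverts H)) =
    image_mset (deg (edge G) (pverts G)) (mset_set (pverts G))"
    using eq unfolding degree_sequence_edge[OF G(1)] degree_sequence_edge[OF G(2)]
    by (metis mset_sorted_list_of_multiset rev_is_rev_conv)
  then show ?thesis
    using count[OF pair_graph_edge(2)[OF G(1)]] count[OF pair_graph_edge(2)[OF G(2)]] by metis
qed

lemma digraph_iso_iff_iso_on:
  assumes G: "pair_graph G" and H: "pair_graph H"
  shows "digraph_iso (with_proj H) (with_proj G) \<longleftrightarrow>
    iso_on (edge H) (pverts H) (edge G) (pverts G)"
proof
  assume "digraph_iso (with_proj H) (with_proj G)"
  then obtain h where h: "pre_digraph.digraph_isomorphism (with_proj H) h"
    "with_proj G = app_iso h (with_proj H)"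
    unfolding digraph_iso_def by blast
  define f where "f = iso_verts h"
  have V: "pverts G = f ` pverts H" using arg_cong[OF h(2), of verts] by (simp add: f_def)
  have P: "parcs G = iso_arcs h ` parcs H" using arg_cong[OF h(2), of arcs] by simp
  have "tail (with_proj G) = iso_tail h" "head (with_proj G) = iso_head h" using h(2) by simp_all
  then have th: "iso_tail h = fst" "iso_head h = snd" by simp_all
  have inj: "inj_on f (pverts H)" using h(1) by (simp add: pre_digraph.digraph_isomorphism_def f_def)
  have "f (fst e) = fst (iso_arcs h e)" "f (snd e) = snd (iso_arcs h e)" if "e \<in> parcs H" for e
    using h(1) that th by (simp_all add: pre_digraph.digraph_isomorphism_def f_def)
  then have arcs: "iso_arcs h e = (f (fst e), f (snd e))" if "e \<in> parcs H" for e
    using that by (metis prod.collapse)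
  have "edge G (f u) (f v) \<longleftrightarrow> edge H u v" if uv: "u \<in> pverts H" "v \<in> pverts H" for u v
  proof
    assume "edge G (f u) (f v)"
    then obtain e where e: "e \<in> parcs H" "(f u, f v) = iso_arcs h e" unfolding edge_def P by blast
    then have eq: "f u = f (fst e)" "f v = f (snd e)" using arcs[OF e(1)] by simp_all
    have "edge H (fst e) (snd e)" using e(1) by (simp add: edge_def)
    then have "fst e \<in> pverts H" "snd e \<in> pverts H" using pair_graph_edge(3,4)[OF H] by blast+
    then have "u = fst e" "v = snd e" using eq inj uv by (auto dest: inj_onD)
    then show "edge H u v" using e(1) by (simp add: edge_def)
  next
    assume "edge H u v"
    then have "(u, v) \<in> parcs H" by (simp add: edge_def)
    then show "edge G (f u) (f v)" unfolding edge_def P using arcs[of "(u, v)"] by (metis fst_conv snd_conv imageI)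
  qed
  then show "iso_on (edge H) (pverts H) (edge G) (pverts G)"
    unfolding iso_on_def using inj V by (intro exI[of _ f]) (simp add: bij_betw_def)
next
  assume "iso_on (edge H) (pverts H) (edge G) (pverts G)"
  then obtain f where f: "bij_betw f (pverts H) (pverts G)"
    "\<And>u v. u \<in> pverts H \<Longrightarrow> v \<in> pverts H \<Longrightarrow> edge G (f u) (f v) \<longleftrightarrow> edge H u v"
    unfolding iso_on_def by metis
  define h where "h = \<lparr> iso_verts = f, iso_arcs = map_prod f f, iso_head = snd, iso_tail = fst \<rparr>"
  interpret H: pair_graph H by fact
  have inj: "inj_on f (pverts H)" and V: "f ` pverts H = pverts G" using f(1) by (simp_all add: bij_betw_def)
  have mem: "fst e \<in> pverts H" "snd e \<in> pverts H" if "e \<in> parcs H" for e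
    using that H.arc_fst_in_verts H.arc_snd_in_verts by auto
  have "inj_on (map_prod f f) (parcs H)"
  proof (rule inj_onI)
    fix e e' assume "e \<in> parcs H" "e' \<in> parcs H" "map_prod f f e = map_prod f f e'"
    then show "e = e'" using mem[of e] mem[of e'] inj by (cases e; cases e') (auto dest: inj_onD)
  qed
  then have "pre_digraph.digraph_isomorphism (with_proj H) h"
    using inj H.wf_digraph_axioms by (simp add: pre_digraph.digraph_isomorphism_def h_def)
  moreover have "map_prod f f ` parcs H = parcs G"
  proof (intro equalityI subsetI)
    fix e assume "e \<in> map_prod f f ` parcs H"
    then obtain u v where uv: "(u, v) \<in> parcs H" "e = (f u, f v)" by auto
    then have "edge H u v" by (simp add: edge_def)
    then have "edge G (f u) (f v)" using f(2) mem[OF uv(1)] by simp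
    then show "e \<in> parcs G" using uv(2) by (simp add: edge_def)
  next
    fix e assume e: "e \<in> parcs G"
    then have "edge G (fst e) (snd e)" by (simp add: edge_def)
    then have "fst e \<in> pverts G" "snd e \<in> pverts G" using pair_graph_edge(3,4)[OF G] by blast+
    then obtain u v where uv: "u \<in> pverts H" "v \<in> pverts H" "fst e = f u"
      "snd e = f v" using V by blast
    then have "edge H u v" using f(2) \<open>edge G (fst e) (snd e)\<close> by simp
    then have "(u, v) \<in> parcs H" by (simp add: edge_def)
    moreover have "e = map_prod f f (u, v)" using uv by (metis map_prod_simp prod.collapse)
    ultimately show "e \<in> map_prod f f ` parcs H" by blast
  qed
  then have "with_proj G = app_iso h (with_proj H)"
    using V by (simp add: app_iso_def h_def with_proj_def)
  ultimately show "digraph_iso (with_proj H) (with_proj G)" unfolding digraph_iso_def by blast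
qed

lemma hereditarily_unique_of_hereditary_unigraph:
  assumes "hereditary_unigraph G"
  shows "hereditarily_unique (edge G) (pverts G)"
  unfolding hereditarily_unique_def
proof (intro allI impI)
  have G: "pair_graph G" using assms by (simp add: hereditary_unigraph_def)
  note E = pair_graph_edge[OF G]
  fix X E' assume X: "X \<subseteq> pverts G" and E': "sgraph E'" "\<forall>v\<in>X. deg E' X v = deg (edge G) X v"
  have fin: "finite X" using X E(2) by (rule finite_subset)
  have graph: "pair_graph (graph_of F X)" if "sgraph F" for F
  proof (rule pair_graphI_edge)
    show "sgraph (edge (graph_of F X))"
      using sgraph_sym[OF that] sgraph_irrefl[OF that] by (intro sgraphI) auto
  qed (use fin in auto)
  define H where "H = graph_of (edge G) X"
  define H' where "H' = graph_of E' X"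
  have H: "pair_graph H" "pair_graph H'" using graph E(1) E'(1) by (simp_all add: H_def H'_def)
  have verts: "pverts H = X" "pverts H' = X" by (simp_all add: H_def H'_def)
  have degs: "deg (edge H) X v = deg (edge G) X v" "deg (edge H') X v = deg E' X v" if "v \<in> X" for v
    using that by (auto simp: H_def H'_def intro!: deg_cong)
  interpret G: pair_graph G by fact
  interpret H: pair_graph H by fact
  have "induced_subgraph (with_proj H) (with_proj G)"
  proof (rule induced_subgraphI)
    show "subgraph (with_proj H) (with_proj G)"
      by (rule subgraphI)
        (use X in \<open>auto simp: H_def graph_of_def edge_def compatible_def
          intro: G.wf_digraph_axioms H.wf_digraph_axioms[unfolded H_def graph_of_def edge_def]\<close>)
    show "arcs (with_proj H) =
      {e \<in> arcs (with_proj G). tail (with_proj G) e \<in> verts (with_proj H) \<and> head (with_proj G) e \<in> verts (with_proj H)}"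
      by (auto simp: H_def graph_of_def edge_def)
  qed
  then have "unigraph H" using assms by (simp add: hereditary_unigraph_def)
  moreover have "degree_sequence H' = degree_sequence H"
  proof -
    have "image_mset (deg (edge H') X) (mset_set X) = image_mset (deg (edge H) X) (mset_set X)"
      using degs E'(2) fin by (intro image_mset_cong) simp
    then show ?thesis unfolding degree_sequence_edge[OF H(1)] degree_sequence_edge[OF H(2)] verts by simp
  qed
  ultimately have "digraph_iso (with_proj H') (with_proj H)" using H(2) by (simp add: unigraph_def)
  then have "iso_on (edge H') X (edge H) X"
    using digraph_iso_iff_iso_on[OF H] verts by simp
  then have "iso_on E' X (edge G) X"
    unfolding iso_on_def H_def H'_def by (auto simp: bij_betw_apply)
  then show "iso_on (edge G) X E' X" by (rule iso_on_sym)
qed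

text \<open>
  Two graphs with the same degree sequence are related by a bijection that preserves degrees, and for
  constructible graphs this suffices to make them isomorphic.
\<close>

lemma hereditary_unigraph_of_constructible:
  assumes G: "pair_graph G" and good: "constructible (edge G) (pverts G)"
  shows "hereditary_unigraph G"
  unfolding hereditary_unigraph_def
proof (intro conjI allI impI G)
  note E = pair_graph_edge[OF G]
  fix H assume ind: "induced_subgraph (with_proj H) (with_proj G)"
  have V: "pverts H \<subseteq> pverts G"
    using ind by (auto simp: induced_subgraph_def subgraph_def)
  have edgeH: "edge H u v \<longleftrightarrow> edge G u v \<and> u \<in> pverts H \<and> v \<in> pverts H" for u v
    using ind by (auto simp: induced_subgraph_def edge_def)
  have fin: "finite (pverts H)" using V E(2) by (rule finite_subset)
  have H: "pair_graph H"
  proof (rule pair_graphI_edge[OF _ fin])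
    show "sgraph (edge H)"
      using sgraph_sym[OF E(1)] sgraph_irrefl[OF E(1)] edgeH by (intro sgraphI) auto
  qed (use edgeH in blast)
  have goodH: "constructible (edge G) (pverts H)" using constructible_subset[OF E(1) good E(2) V] .
  have deg: "deg (edge H) (pverts H) v = deg (edge G) (pverts H) v" if "v \<in> pverts H" for v
    using edgeH that by (intro deg_cong) simp
  show "unigraph H"
    unfolding unigraph_def
  proof (intro conjI allI impI H)
    fix H' :: "'a pair_pre_digraph" assume "pair_graph H' \<and> degree_sequence H' = degree_sequence H"
    then have H': "pair_graph H'" "degree_sequence H' = degree_sequence H" by simp_all
    obtain f where f: "bij_betw f (pverts H) (pverts H')"
      "\<And>v. v \<in> pverts H \<Longrightarrow> deg (edge H') (pverts H') (f v) = deg (edge H) (pverts H) v"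
      using exists_label_preserving_bij[OF fin pair_graph_edge(2)[OF H'(1)]
        degree_sequence_eq_imp_card_eq[OF H'(1) H H'(2)[symmetric]]] by blast
    have "iso_on (edge G) (pverts H) (edge H') (pverts H')"
      using constructible_unique_realization[OF E(1) pair_graph_edge(1)[OF H'(1)] goodH fin f(1)] f(2) deg by simp
    then have "iso_on (edge H) (pverts H) (edge H') (pverts H')"
      unfolding iso_on_def using edgeH by (auto simp: edgeH)
    then have "iso_on (edge H') (pverts H') (edge H) (pverts H)" by (rule iso_on_sym)
    then show "digraph_iso (with_proj H') (with_proj H)"
      using digraph_iso_iff_iso_on[OF H H'(1)] by simp
  qed
qed

lemma degree_ordered_vertices:
  assumes G: "pair_graph G"
  obtains vs where "degree_ordered (edge G) (pverts G) vs"
    "degree_sequence G = map (deg (edge G) (pverts G)) vs"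
proof -
  let ?deg = "deg (edge G) (pverts G)"
  obtain xs where xs: "set xs = pverts G" "distinct xs"
    using finite_distinct_list[OF pair_graph_edge(2)[OF G]] by blast
  define ys where "ys = sort_key ?deg xs"
  have ys: "set ys = pverts G" "distinct ys" "sorted (map ?deg ys)" using xs by (simp_all add: ys_def)
  have "mset (map ?deg ys) = image_mset ?deg (mset_set (pverts G))"
    using ys(1,2) by (simp add: mset_set_set[symmetric])
  then have "sorted_list_of_multiset (image_mset ?deg (mset_set (pverts G))) = sort (map ?deg ys)"
    by (metis sorted_list_of_multiset_mset)
  also have "\<dots> = map ?deg ys" using ys(3) by (rule sorted_sort_id)
  finally have "degree_sequence G = map ?deg (rev ys)"
    unfolding degree_sequence_edge[OF G] by (simp add: rev_map)
  moreover have "degree_ordered (edge G) (pverts G) (rev ys)"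
    using pair_graph_edge(1)[OF G] ys by unfold_locales (simp_all add: sorted_wrt_rev sorted_map)
  ultimately show ?thesis using that by blast
qed

theorem theorem6p3:
  fixes G :: "'a pair_pre_digraph" and d :: "nat list"
  assumes "pair_graph G"
    and "d = degree_sequence G"
  shows "hereditary_unigraph G \<longleftrightarrow>
    (\<forall>k k'. consecutive_in (EG d) k k' \<and> k' \<ge> k + 2 \<longrightarrow>
       cond_a_i d k k' \<or> cond_a_ii d k k') \<and>
    (let t = last (EG d); w = tail_terms d t in
       w \<noteq> [] \<longrightarrow>
       (\<exists>r s. r \<ge> 2 \<and> s \<ge> 1 \<and>
          (w = replicate 5 (t + 2) \<or>
           w = replicate (2 * r) (t + 1) \<or>
           w = (t + r) # replicate (2 * s + r) (t + 1) \<or>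
           w = replicate (2 * r) (t + 2 * r - 2) \<or>
           w = replicate (2 * s + r) (t + 2 * s + r - 1) @ [t + 2 * s])))"
proof -
  obtain vs where vs: "degree_ordered (edge G) (pverts G) vs"
    "degree_sequence G = map (deg (edge G) (pverts G)) vs"
    using degree_ordered_vertices[OF assms(1)] by blast
  interpret degree_ordered "edge G" "pverts G" vs by (rule vs(1))
  have "hereditary_unigraph G \<longleftrightarrow> EG_cond"
    using EG_cond_of_hereditarily_unique hereditarily_unique_of_hereditary_unigraph constructible_of_EG_cond
      hereditary_unigraph_of_constructible[OF assms(1)] by blast
  then show ?thesis unfolding EG_cond_def assms(2) vs(2) .
qed

end
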